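(* Let $\mathfrak g$ be a Lie algebra over a field $k$. For each crossed module $M$ over the enveloping algebra $U(\mathfrak g)$ there is a non-negative increasing filtration $(F_pM)_{p\in\mathbb Z}$ of $M$ by crossed submodules (so $F_pM\subseteq F_{p+1}M$ for all $p$ and $F_pM=0$ for $p<0$) such that $\bigcup_{p\in\mathbb Z}F_pM=M$ and, for every $p\in\mathbb Z$, $F_pM/F_{p-1}M$ is a comodule with trivial structure, i.e. $\rho(\overline m)=\overline m\otimes1$ for all $\overline m\in F_pM/F_{p-1}M$.
   Context: $U(\mathfrak g)$ is a Hopf algebra with the elements of $\mathfrak g$ primitive. A crossed module over a Hopf algebra $H$ is a left $H$-module $M$ which is also a right $H$-comodule via $\rho:M\to M\otimes H$, $\rho(m)=\sum m_{\langle0\rangle}\otimes m_{\langle1\rangle}$, such that $\rho(hm)=\sum h_{(2)}m_{\langle0\rangle}\otimes h_{(3)}m_{\langle1\rangle}S(h_{(1)})$ for all $h\in H$, $m\in M$, where $S$ is the antipode. A crossed submodule is a subspace that is both an $H$-submodule and an $H$-subcomodule. *)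

theory Defs
  imports "HOL-Algebra.QuotRing" "Jordan_Normal_Form.Missing_VectorSpace"
begin

section \<open>Free vector spaces and quotient spaces\<close>

text \<open>
  Vector spaces are those of the locale \<^locale>\<open>vectorspace\<close>. The fields \<^const>\<open>mult\<close> and \<^const>\<open>one\<close>
  of a module record carry no information unless the record is used as an algebra.
\<close>

definition free_space :: "('k, 'r) ring_scheme \<Rightarrow> 'x set \<Rightarrow> ('k, 'x \<Rightarrow> 'k) module"
  where "free_space K X =
    \<lparr>carrier = {c. (\<forall>x\<in>X. c x \<in> carrier K) \<and> (\<forall>x. x \<notin> X \<longrightarrow> c x = \<zero>\<^bsub>K\<^esub>) \<and> finite {x. c x \<noteq> \<zero>\<^bsub>K\<^esub>}},
     mult = undefined, one = undefined,
     zero = (\<lambda>_. \<zero>\<^bsub>K\<^esub>),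
     add = (\<lambda>c d x. c x \<oplus>\<^bsub>K\<^esub> d x),
     smult = (\<lambda>a c x. a \<otimes>\<^bsub>K\<^esub> c x)\<rparr>"

definition delta :: "('k, 'r) ring_scheme \<Rightarrow> 'x \<Rightarrow> 'x \<Rightarrow> 'k"
  where "delta K x = (\<lambda>y. if y = x then \<one>\<^bsub>K\<^esub> else \<zero>\<^bsub>K\<^esub>)"

definition lin_ext ::
  "('k, 'r) ring_scheme \<Rightarrow> ('k, 'z, 'c) module_scheme \<Rightarrow> ('x \<Rightarrow> 'z) \<Rightarrow> ('x \<Rightarrow> 'k) \<Rightarrow> 'z"
  where "lin_ext K Z f c = (\<Oplus>\<^bsub>Z\<^esub>x\<in>{x. c x \<noteq> \<zero>\<^bsub>K\<^esub>}. c x \<odot>\<^bsub>Z\<^esub> f x)"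

text \<open>
  Addition and multiplication are those of \<^const>\<open>FactRing\<close>; the latter is meaningful when \<open>V\<close> is an
  algebra and \<open>N\<close> a two-sided ideal. Scalars act by \<open>a (N + v) = N + a v\<close>.
\<close>

definition quotient_space :: "('k, 'v, 'c) module_scheme \<Rightarrow> 'v set \<Rightarrow> ('k, 'v set) module"
  where "quotient_space V N =
    ring.extend (V Quot N) \<lparr>smult = (\<lambda>a X. \<Union>v\<in>X. N +>\<^bsub>V\<^esub> (a \<odot>\<^bsub>V\<^esub> v))\<rparr>"


section \<open>Tensor products\<close>

definition tensor_relations ::
  "('k, 'r) ring_scheme \<Rightarrow> ('k, 'v, 'c) module_scheme \<Rightarrow> ('k, 'w, 'd) module_scheme \<Rightarrow> ('v \<times> 'w \<Rightarrow> 'k) set"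
  where "tensor_relations K V W = (let T = free_space K (carrier V \<times> carrier W) in
    {delta K (v \<oplus>\<^bsub>V\<^esub> v', w) \<ominus>\<^bsub>T\<^esub> delta K (v, w) \<ominus>\<^bsub>T\<^esub> delta K (v', w) | v v' w.
       v \<in> carrier V \<and> v' \<in> carrier V \<and> w \<in> carrier W} \<union>
    {delta K (v, w \<oplus>\<^bsub>W\<^esub> w') \<ominus>\<^bsub>T\<^esub> delta K (v, w) \<ominus>\<^bsub>T\<^esub> delta K (v, w') | v w w'.
       v \<in> carrier V \<and> w \<in> carrier W \<and> w' \<in> carrier W} \<union>
    {delta K (a \<odot>\<^bsub>V\<^esub> v, w) \<ominus>\<^bsub>T\<^esub> a \<odot>\<^bsub>T\<^esub> delta K (v, w) | a v w.
       a \<in> carrier K \<and> v \<in> carrier V \<and> w \<in> carrier W} \<union>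
    {delta K (v, a \<odot>\<^bsub>W\<^esub> w) \<ominus>\<^bsub>T\<^esub> a \<odot>\<^bsub>T\<^esub> delta K (v, w) | a v w.
       a \<in> carrier K \<and> v \<in> carrier V \<and> w \<in> carrier W})"

definition tensor_kernel ::
  "('k, 'r) ring_scheme \<Rightarrow> ('k, 'v, 'c) module_scheme \<Rightarrow> ('k, 'w, 'd) module_scheme \<Rightarrow> ('v \<times> 'w \<Rightarrow> 'k) set"
  where "tensor_kernel K V W =
    module.span K (free_space K (carrier V \<times> carrier W)) (tensor_relations K V W)"

definition tensor ::
  "('k, 'r) ring_scheme \<Rightarrow> ('k, 'v, 'c) module_scheme \<Rightarrow> ('k, 'w, 'd) module_scheme \<Rightarrow>
   ('k, ('v \<times> 'w \<Rightarrow> 'k) set) module"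
  where "tensor K V W =
    quotient_space (free_space K (carrier V \<times> carrier W)) (tensor_kernel K V W)"

definition pure_tensor ::
  "('k, 'r) ring_scheme \<Rightarrow> ('k, 'v, 'c) module_scheme \<Rightarrow> ('k, 'w, 'd) module_scheme \<Rightarrow>
   'v \<Rightarrow> 'w \<Rightarrow> ('v \<times> 'w \<Rightarrow> 'k) set"
  where "pure_tensor K V W v w =
    tensor_kernel K V W +>\<^bsub>free_space K (carrier V \<times> carrier W)\<^esub> delta K (v, w)"

text \<open>
  The linear map \<open>V \<otimes> W \<rightarrow> Z\<close> with \<open>v \<otimes> w \<mapsto> f v w\<close>. For bilinear \<open>f\<close> the linear extension of \<open>f\<close> is
  constant on each coset, and \<^const>\<open>the_elem\<close> extracts that constant. Sweedler sums are rendered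
  by this map: \<open>\<Sum> f t\<^sub>(\<^sub>1\<^sub>) t\<^sub>(\<^sub>2\<^sub>)\<close> is \<open>tensor_lift K Z f t\<close>.
\<close>

definition tensor_lift ::
  "('k, 'r) ring_scheme \<Rightarrow> ('k, 'z, 'c) module_scheme \<Rightarrow> ('v \<Rightarrow> 'w \<Rightarrow> 'z) \<Rightarrow> ('v \<times> 'w \<Rightarrow> 'k) set \<Rightarrow> 'z"
  where "tensor_lift K Z f t = the_elem (lin_ext K Z (\<lambda>(v, w). f v w) ` t)"

text \<open>The map \<open>f \<otimes> g\<close> into \<open>V \<otimes> W\<close>.\<close>

definition tensor_map ::
  "('k, 'r) ring_scheme \<Rightarrow> ('k, 'v, 'c) module_scheme \<Rightarrow> ('k, 'w, 'd) module_scheme \<Rightarrow>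
   ('x \<Rightarrow> 'v) \<Rightarrow> ('y \<Rightarrow> 'w) \<Rightarrow> ('x \<times> 'y \<Rightarrow> 'k) set \<Rightarrow> ('v \<times> 'w \<Rightarrow> 'k) set"
  where "tensor_map K V W f g =
    tensor_lift K (tensor K V W) (\<lambda>x y. pure_tensor K V W (f x) (g y))"

text \<open>The canonical map \<open>(U \<otimes> V) \<otimes> W \<rightarrow> U \<otimes> (V \<otimes> W)\<close>.\<close>

definition tensor_assoc ::
  "('k, 'r) ring_scheme \<Rightarrow> ('k, 'u, 'b) module_scheme \<Rightarrow> ('k, 'v, 'c) module_scheme \<Rightarrow>
   ('k, 'w, 'd) module_scheme \<Rightarrow>
   (('u \<times> 'v \<Rightarrow> 'k) set \<times> 'w \<Rightarrow> 'k) set \<Rightarrow> ('u \<times> ('v \<times> 'w \<Rightarrow> 'k) set \<Rightarrow> 'k) set"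
  where "tensor_assoc K U V W = (let T = tensor K U (tensor K V W) in
    tensor_lift K T (\<lambda>s w.
      tensor_lift K T (\<lambda>u v. pure_tensor K U (tensor K V W) u (pure_tensor K V W v w)) s))"

definition tensor_algebra_product ::
  "('k, 'r) ring_scheme \<Rightarrow> ('k, 'v, 'c) module_scheme \<Rightarrow> ('k, 'w, 'd) module_scheme \<Rightarrow>
   ('k, ('v \<times> 'w \<Rightarrow> 'k) set) module"
  where "tensor_algebra_product K A B = (let T = tensor K A B in
    T\<lparr>mult := (\<lambda>s t.
         tensor_lift K T (\<lambda>a b.
           tensor_lift K T (\<lambda>a' b'. pure_tensor K A B (a \<otimes>\<^bsub>A\<^esub> a') (b \<otimes>\<^bsub>B\<^esub> b')) t) s),
      one := pure_tensor K A B \<one>\<^bsub>A\<^esub> \<one>\<^bsub>B\<^esub>\<rparr>)"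


section \<open>Comodules and crossed modules over a Hopf algebra\<close>

text \<open>The underlying algebra of a Hopf algebra together with its coalgebra structure and antipode.\<close>

record ('k, 'h) hopf_algebra = "('k, 'h) module" +
  comult :: "'h \<Rightarrow> ('h \<times> 'h \<Rightarrow> 'k) set"
  counit :: "'h \<Rightarrow> 'k"
  antipode :: "'h \<Rightarrow> 'h"

locale right_comodule = vectorspace K M
  for K :: "('k, 'r) ring_scheme" and H :: "('k, 'h, 'c) hopf_algebra_scheme"
    and M :: "('k, 'm, 'd) module_scheme" +
  fixes \<rho> :: "'m \<Rightarrow> ('m \<times> 'h \<Rightarrow> 'k) set"
  assumes coaction_linear: "\<rho> \<in> module_hom K M (tensor K M H)"
    and coaction_coassoc: "m \<in> carrier M \<Longrightarrow>
      tensor_assoc K M H H (tensor_map K (tensor K M H) H \<rho> (\<lambda>h. h) (\<rho> m)) =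
      tensor_map K M (tensor K H H) (\<lambda>m. m) (comult H) (\<rho> m)"
    and coaction_counit: "m \<in> carrier M \<Longrightarrow>
      tensor_lift K M (\<lambda>m h. counit H h \<odot>\<^bsub>M\<^esub> m) (\<rho> m) = m"

locale left_module = vectorspace K M
  for K :: "('k, 'r) ring_scheme" and H :: "('k, 'h, 'c) module_scheme"
    and M :: "('k, 'm, 'd) module_scheme" +
  fixes act :: "'h \<Rightarrow> 'm \<Rightarrow> 'm"
  assumes act_closed: "\<lbrakk>h \<in> carrier H; m \<in> carrier M\<rbrakk> \<Longrightarrow> act h m \<in> carrier M"
    and act_add_left: "\<lbrakk>h \<in> carrier H; h' \<in> carrier H; m \<in> carrier M\<rbrakk> \<Longrightarrow>
      act (h \<oplus>\<^bsub>H\<^esub> h') m = act h m \<oplus>\<^bsub>M\<^esub> act h' m"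
    and act_add_right: "\<lbrakk>h \<in> carrier H; m \<in> carrier M; m' \<in> carrier M\<rbrakk> \<Longrightarrow>
      act h (m \<oplus>\<^bsub>M\<^esub> m') = act h m \<oplus>\<^bsub>M\<^esub> act h m'"
    and act_smult_left: "\<lbrakk>a \<in> carrier K; h \<in> carrier H; m \<in> carrier M\<rbrakk> \<Longrightarrow>
      act (a \<odot>\<^bsub>H\<^esub> h) m = a \<odot>\<^bsub>M\<^esub> act h m"
    and act_smult_right: "\<lbrakk>a \<in> carrier K; h \<in> carrier H; m \<in> carrier M\<rbrakk> \<Longrightarrow>
      act h (a \<odot>\<^bsub>M\<^esub> m) = a \<odot>\<^bsub>M\<^esub> act h m"
    and act_one: "m \<in> carrier M \<Longrightarrow> act \<one>\<^bsub>H\<^esub> m = m"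
    and act_mult: "\<lbrakk>h \<in> carrier H; h' \<in> carrier H; m \<in> carrier M\<rbrakk> \<Longrightarrow>
      act (h \<otimes>\<^bsub>H\<^esub> h') m = act h (act h' m)"

text \<open>
  The compatibility axiom reads
  \<open>\<rho>(h m) = \<Sum> h\<^sub>(\<^sub>2\<^sub>) m\<^sub>\<langle>\<^sub>0\<^sub>\<rangle> \<otimes> h\<^sub>(\<^sub>3\<^sub>) m\<^sub>\<langle>\<^sub>1\<^sub>\<rangle> S(h\<^sub>(\<^sub>1\<^sub>))\<close>, with
  \<open>\<Sum> h\<^sub>(\<^sub>1\<^sub>) \<otimes> (h\<^sub>(\<^sub>2\<^sub>) \<otimes> h\<^sub>(\<^sub>3\<^sub>)) = (id \<otimes> \<Delta>)(\<Delta>(h))\<close>.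
\<close>

locale crossed_module = left_module K H M act + right_comodule K H M \<rho>
  for K :: "('k, 'r) ring_scheme" and H :: "('k, 'h, 'c) hopf_algebra_scheme"
    and M :: "('k, 'm, 'd) module_scheme" and act \<rho> +
  assumes coaction_act: "\<lbrakk>h \<in> carrier H; m \<in> carrier M\<rbrakk> \<Longrightarrow>
    \<rho> (act h m) =
    tensor_lift K (tensor K M H) (\<lambda>h1 t.
      tensor_lift K (tensor K M H) (\<lambda>h2 h3.
        tensor_lift K (tensor K M H) (\<lambda>m0 m1.
          pure_tensor K M H (act h2 m0) (h3 \<otimes>\<^bsub>H\<^esub> m1 \<otimes>\<^bsub>H\<^esub> antipode H h1)) (\<rho> m)) t)
      (tensor_map K H (tensor K H H) (\<lambda>h. h) (comult H) (comult H h))"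

text \<open>
  For \<open>N \<subseteq> M\<close>, \<open>tensor_map K M H (\<lambda>m. m) (\<lambda>h. h)\<close> is the canonical injection
  \<open>N \<otimes> H \<rightarrow> M \<otimes> H\<close>. Its image and its inverse are needed explicitly, since the elements of
  \<open>N \<otimes> H\<close> and of \<open>M \<otimes> H\<close> are cosets of different subspaces.
\<close>

definition subcomodule ::
  "('k, 'r) ring_scheme \<Rightarrow> ('k, 'h, 'c) hopf_algebra_scheme \<Rightarrow> ('k, 'm, 'd) module_scheme \<Rightarrow>
   ('m \<Rightarrow> ('m \<times> 'h \<Rightarrow> 'k) set) \<Rightarrow> 'm set \<Rightarrow> bool"
  where "subcomodule K H M \<rho> N \<longleftrightarrow> subspace K N M \<and>
    \<rho> ` N \<subseteq> tensor_map K M H (\<lambda>m. m) (\<lambda>h. h) ` carrier (tensor K (M\<lparr>carrier := N\<rparr>) H)"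

definition sub_coaction ::
  "('k, 'r) ring_scheme \<Rightarrow> ('k, 'h, 'c) hopf_algebra_scheme \<Rightarrow> ('k, 'm, 'd) module_scheme \<Rightarrow>
   ('m \<Rightarrow> ('m \<times> 'h \<Rightarrow> 'k) set) \<Rightarrow> 'm set \<Rightarrow> 'm \<Rightarrow> ('m \<times> 'h \<Rightarrow> 'k) set"
  where "sub_coaction K H M \<rho> N n =
    inv_into (carrier (tensor K (M\<lparr>carrier := N\<rparr>) H)) (tensor_map K M H (\<lambda>m. m) (\<lambda>h. h)) (\<rho> n)"

text \<open>The map induced by \<open>(\<pi> \<otimes> id) \<circ> \<rho>\<close> on \<open>V / N\<close>, where \<open>\<pi> : V \<rightarrow> V / N\<close> is the projection.\<close>

definition quotient_coaction ::
  "('k, 'r) ring_scheme \<Rightarrow> ('k, 'h, 'c) hopf_algebra_scheme \<Rightarrow> ('k, 'm, 'd) module_scheme \<Rightarrow>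
   ('m \<Rightarrow> ('m \<times> 'h \<Rightarrow> 'k) set) \<Rightarrow> 'm set \<Rightarrow> 'm set \<Rightarrow> ('m set \<times> 'h \<Rightarrow> 'k) set"
  where "quotient_coaction K H V \<rho> N X = the_elem
    ((\<lambda>v. tensor_map K (quotient_space V N) H (\<lambda>x. N +>\<^bsub>V\<^esub> x) (\<lambda>h. h) (\<rho> v)) ` X)"

definition trivial_comodule ::
  "('k, 'r) ring_scheme \<Rightarrow> ('k, 'h, 'c) hopf_algebra_scheme \<Rightarrow> ('k, 'm, 'd) module_scheme \<Rightarrow>
   ('m \<Rightarrow> ('m \<times> 'h \<Rightarrow> 'k) set) \<Rightarrow> bool"
  where "trivial_comodule K H M \<rho> \<longleftrightarrow> right_comodule K H M \<rho> \<and>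
    (\<forall>m\<in>carrier M. \<rho> m = pure_tensor K M H m \<one>\<^bsub>H\<^esub>)"

definition crossed_submodule ::
  "('k, 'r) ring_scheme \<Rightarrow> ('k, 'h, 'c) hopf_algebra_scheme \<Rightarrow> ('k, 'm, 'd) module_scheme \<Rightarrow>
   ('h \<Rightarrow> 'm \<Rightarrow> 'm) \<Rightarrow> ('m \<Rightarrow> ('m \<times> 'h \<Rightarrow> 'k) set) \<Rightarrow> 'm set \<Rightarrow> bool"
  where "crossed_submodule K H M act \<rho> N \<longleftrightarrow> subspace K N M \<and>
    (\<forall>h\<in>carrier H. \<forall>n\<in>N. act h n \<in> N) \<and> subcomodule K H M \<rho> N"


section \<open>Lie algebras and their enveloping algebras\<close>

record ('k, 'g) lie_algebra = "('k, 'g) module" +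
  bracket :: "'g \<Rightarrow> 'g \<Rightarrow> 'g"

locale lie_algebra = vectorspace K L
  for K :: "('k, 'r) ring_scheme" and L :: "('k, 'g, 'c) lie_algebra_scheme" +
  assumes bracket_closed: "\<lbrakk>x \<in> carrier L; y \<in> carrier L\<rbrakk> \<Longrightarrow> bracket L x y \<in> carrier L"
    and bracket_add_left: "\<lbrakk>x \<in> carrier L; y \<in> carrier L; z \<in> carrier L\<rbrakk> \<Longrightarrow>
      bracket L (x \<oplus>\<^bsub>L\<^esub> y) z = bracket L x z \<oplus>\<^bsub>L\<^esub> bracket L y z"
    and bracket_add_right: "\<lbrakk>x \<in> carrier L; y \<in> carrier L; z \<in> carrier L\<rbrakk> \<Longrightarrow>
      bracket L x (y \<oplus>\<^bsub>L\<^esub> z) = bracket L x y \<oplus>\<^bsub>L\<^esub> bracket L x z"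
    and bracket_smult_left: "\<lbrakk>a \<in> carrier K; x \<in> carrier L; y \<in> carrier L\<rbrakk> \<Longrightarrow>
      bracket L (a \<odot>\<^bsub>L\<^esub> x) y = a \<odot>\<^bsub>L\<^esub> bracket L x y"
    and bracket_smult_right: "\<lbrakk>a \<in> carrier K; x \<in> carrier L; y \<in> carrier L\<rbrakk> \<Longrightarrow>
      bracket L x (a \<odot>\<^bsub>L\<^esub> y) = a \<odot>\<^bsub>L\<^esub> bracket L x y"
    and bracket_self: "x \<in> carrier L \<Longrightarrow> bracket L x x = \<zero>\<^bsub>L\<^esub>"
    and jacobi: "\<lbrakk>x \<in> carrier L; y \<in> carrier L; z \<in> carrier L\<rbrakk> \<Longrightarrow>
      bracket L x (bracket L y z) \<oplus>\<^bsub>L\<^esub> bracket L y (bracket L z x) \<oplus>\<^bsub>L\<^esub> bracket L z (bracket L x y)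
        = \<zero>\<^bsub>L\<^esub>"

text \<open>The free associative unital algebra: words multiply by concatenation.\<close>

definition free_algebra :: "('k, 'r) ring_scheme \<Rightarrow> 'x set \<Rightarrow> ('k, 'x list \<Rightarrow> 'k) module"
  where "free_algebra K X = (free_space K (lists X))
    \<lparr>mult := (\<lambda>c d w. \<Oplus>\<^bsub>K\<^esub>i\<in>{..length w}. c (take i w) \<otimes>\<^bsub>K\<^esub> d (drop i w)),
     one := delta K []\<rparr>"

text \<open>
  The first two families of relations make the free algebra on the set \<open>\<gg>\<close> into the tensor algebra of
  the vector space \<open>\<gg>\<close>; the last one is \<open>x y - y x = [x, y]\<close>.
\<close>

definition uea_ideal :: "('k, 'r) ring_scheme \<Rightarrow> ('k, 'g, 'c) lie_algebra_scheme \<Rightarrow> ('g list \<Rightarrow> 'k) set"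
  where "uea_ideal K L = (let T = free_algebra K (carrier L) in genideal T
    ({delta K [x \<oplus>\<^bsub>L\<^esub> y] \<ominus>\<^bsub>T\<^esub> delta K [x] \<ominus>\<^bsub>T\<^esub> delta K [y] | x y. x \<in> carrier L \<and> y \<in> carrier L} \<union>
     {delta K [a \<odot>\<^bsub>L\<^esub> x] \<ominus>\<^bsub>T\<^esub> a \<odot>\<^bsub>T\<^esub> delta K [x] | a x. a \<in> carrier K \<and> x \<in> carrier L} \<union>
     {delta K [x] \<otimes>\<^bsub>T\<^esub> delta K [y] \<ominus>\<^bsub>T\<^esub> delta K [y] \<otimes>\<^bsub>T\<^esub> delta K [x] \<ominus>\<^bsub>T\<^esub> delta K [bracket L x y] | x y.
        x \<in> carrier L \<and> y \<in> carrier L}))"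

definition uea_algebra ::
  "('k, 'r) ring_scheme \<Rightarrow> ('k, 'g, 'c) lie_algebra_scheme \<Rightarrow> ('k, ('g list \<Rightarrow> 'k) set) module"
  where "uea_algebra K L = quotient_space (free_algebra K (carrier L)) (uea_ideal K L)"

definition uea_incl ::
  "('k, 'r) ring_scheme \<Rightarrow> ('k, 'g, 'c) lie_algebra_scheme \<Rightarrow> 'g \<Rightarrow> ('g list \<Rightarrow> 'k) set"
  where "uea_incl K L x = uea_ideal K L +>\<^bsub>free_algebra K (carrier L)\<^esub> delta K [x]"

text \<open>
  The unital algebra homomorphism \<open>U(\<gg>) \<rightarrow> A\<close> extending \<open>f : \<gg> \<rightarrow> A\<close>, for linear \<open>f\<close> with
  \<open>f [x, y] = f x f y - f y f x\<close>.
\<close>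

definition uea_lift ::
  "('k, 'r) ring_scheme \<Rightarrow> ('k, 'z, 'c) module_scheme \<Rightarrow> ('g \<Rightarrow> 'z) \<Rightarrow> ('g list \<Rightarrow> 'k) set \<Rightarrow> 'z"
  where "uea_lift K A f u =
    the_elem (lin_ext K A (\<lambda>w. foldr (\<lambda>x z. f x \<otimes>\<^bsub>A\<^esub> z) w \<one>\<^bsub>A\<^esub>) ` u)"

definition ground_algebra :: "('k, 'r) ring_scheme \<Rightarrow> ('k, 'k) module"
  where "ground_algebra K =
    \<lparr>carrier = carrier K, mult = mult K, one = one K, zero = zero K, add = add K, smult = mult K\<rparr>"

definition opposite_algebra :: "('k, 'v, 'c) module_scheme \<Rightarrow> ('k, 'v, 'c) module_scheme"
  where "opposite_algebra A = A\<lparr>mult := (\<lambda>x y. y \<otimes>\<^bsub>A\<^esub> x)\<rparr>"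

text \<open>
  The Hopf algebra structure in which \<open>\<gg>\<close> is primitive: \<open>\<Delta>\<close> and \<open>\<epsilon>\<close> are the algebra homomorphisms with
  \<open>\<Delta> x = x \<otimes> 1 + 1 \<otimes> x\<close> and \<open>\<epsilon> x = 0\<close>, and \<open>S\<close> is the algebra antihomomorphism with \<open>S x = - x\<close>.
\<close>

definition uea ::
  "('k, 'r) ring_scheme \<Rightarrow> ('k, 'g, 'c) lie_algebra_scheme \<Rightarrow> ('k, ('g list \<Rightarrow> 'k) set) hopf_algebra"
  where "uea K L = (let U = uea_algebra K L in module.extend U
    \<lparr>comult = uea_lift K (tensor_algebra_product K U U)
       (\<lambda>x. pure_tensor K U U (uea_incl K L x) \<one>\<^bsub>U\<^esub> \<oplus>\<^bsub>tensor K U U\<^esub>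
            pure_tensor K U U \<one>\<^bsub>U\<^esub> (uea_incl K L x)),
     counit = uea_lift K (ground_algebra K) (\<lambda>_. \<zero>\<^bsub>K\<^esub>),
     antipode = uea_lift K (opposite_algebra U) (\<lambda>x. \<ominus>\<^bsub>U\<^esub> uea_incl K L x)\<rparr>)"

end

theory Submission
  imports Defs
begin

text \<open>
  Put \<open>F\<^sub>-\<^sub>1 = 0\<close> and \<open>F\<^sub>p = {m. \<rho> m - m \<otimes> 1 \<in> F\<^sub>p\<^sub>-\<^sub>1 \<otimes> U}\<close>, so that \<open>F\<^sub>p / F\<^sub>p\<^sub>-\<^sub>1\<close> consists of the
  coinvariants of \<open>M / F\<^sub>p\<^sub>-\<^sub>1\<close>. Then \<open>\<rho> m \<in> F\<^sub>p \<otimes> U\<close> for \<open>m \<in> F\<^sub>p\<close>, and for primitive \<open>x\<close> the compatibility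
  axiom becomes \<open>\<rho>(x m) = x m\<^sub>0 \<otimes> m\<^sub>1 + m\<^sub>0 \<otimes> [x, m\<^sub>1]\<close>, which shows by induction on \<open>p\<close> that \<open>F\<^sub>p\<close> is a
  submodule. For exhaustion let \<open>U\<^sub>p\<close> be spanned by the words of length at most \<open>p\<close> in \<open>\<gg>\<close>; then
  \<open>\<Delta> u - u \<otimes> 1 \<in> U\<^sub>p\<^sub>-\<^sub>1 \<otimes> U\<close> for \<open>u \<in> U\<^sub>p\<close>. If \<open>\<rho> m \<in> M \<otimes> U\<^sub>p\<close>, coassociativity gives
  \<open>\<rho>((id \<otimes> \<phi>)(\<rho> m - m \<otimes> 1)) \<in> M \<otimes> U\<^sub>p\<^sub>-\<^sub>1\<close> for every functional \<open>\<phi>\<close> on \<open>U\<close>, so by induction all these slices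
  of \<open>\<rho> m - m \<otimes> 1\<close> lie in \<open>F\<^sub>p\<^sub>-\<^sub>1\<close>. Over a field an element of \<open>M \<otimes> U\<close> whose slices lie in \<open>N\<close> lies in
  \<open>N \<otimes> U\<close>, hence \<open>m \<in> F\<^sub>p\<close>.
\<close>

section \<open>Linear algebra\<close>

text \<open>The step for primitive \<open>x\<close> works because the linear map m \<otimes> u |-> x
  m \<otimes> u + m \<otimes> [x, u], which computes \<rho>(x m) from \<rho> m, sends m \<otimes> 1
  to x m \<otimes> 1. It therefore carries \<rho> m - m \<otimes> 1 to \<rho>(x m) - x m \<otimes>
  1, and the induction hypothesis controls the left factors. In the exhaustion step a functional
  \<phi> is traded for an operator on U: coacting on the slice of \<rho> m - m \<otimes> 1 by \<phi>
  amounts to applying u |-> (id \<otimes> \<phi>)(\<Delta> u - u \<otimes> 1) to the right factor of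
  \<rho> m, and this operator shortens words. The encoding adds an obstacle: elements of N \<otimes>
  U and of M \<otimes> U are cosets of different subspaces, so N \<otimes> U occurs inside M
  \<otimes> U only as the image of a map, and the coaction of F_p is obtained by inverting that map.
  Its injectivity and the slice criterion have the same source: functionals with value 1 on a given
  nonzero vector, obtained from Zorn's lemma.\<close>

lemma image_eq_singleton: "\<lbrakk>x \<in> A; \<And>y. y \<in> A \<Longrightarrow> f y = c\<rbrakk> \<Longrightarrow> f ` A = {c}"
  by (simp add: image_constant[of x A c] cong: image_cong)

lemma (in abelian_group) minus_minus_eq:
  "\<lbrakk>x \<in> carrier G; y \<in> carrier G; z \<in> carrier G\<rbrakk> \<Longrightarrow> x \<ominus> y \<ominus> z = x \<ominus> (y \<oplus> z)"
  by (simp add: minus_eq minus_add a_assoc)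

lemma (in abelian_group) minus_self: "x \<in> carrier G \<Longrightarrow> x \<ominus> x = \<zero>"
  by (simp add: minus_eq r_neg)

lemma module_homI:
  assumes "\<And>v. v \<in> carrier V \<Longrightarrow> f v \<in> carrier W"
    and "\<And>u v. \<lbrakk>u \<in> carrier V; v \<in> carrier V\<rbrakk> \<Longrightarrow> f (u \<oplus>\<^bsub>V\<^esub> v) = f u \<oplus>\<^bsub>W\<^esub> f v"
    and "\<And>a v. \<lbrakk>a \<in> carrier K; v \<in> carrier V\<rbrakk> \<Longrightarrow> f (a \<odot>\<^bsub>V\<^esub> v) = a \<odot>\<^bsub>W\<^esub> f v"
  shows "f \<in> module_hom K V W"
  using assms by (auto simp: module_hom_def)

lemma module_hom_in: "\<lbrakk>f \<in> module_hom K V W; v \<in> carrier V\<rbrakk> \<Longrightarrow> f v \<in> carrier W"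
  by (auto simp: module_hom_def)

context
  fixes K :: "('k, 'r) ring_scheme" and V :: "('k, 'v, 'c) module_scheme"
    and W :: "('k, 'w, 'd) module_scheme" and f
  assumes V: "vectorspace K V" and W: "vectorspace K W" and f: "f \<in> module_hom K V W"
begin

lemma mod_hom_of: "mod_hom K V W f"
  using V W f by (simp add: mod_hom_def mod_hom_axioms_def vectorspace_def)

lemma module_hom_zero: "f \<zero>\<^bsub>V\<^esub> = \<zero>\<^bsub>W\<^esub>"
  using mod_hom.f0_is_0[OF mod_hom_of] .

lemma module_hom_minus: "\<lbrakk>u \<in> carrier V; v \<in> carrier V\<rbrakk> \<Longrightarrow> f (u \<ominus>\<^bsub>V\<^esub> v) = f u \<ominus>\<^bsub>W\<^esub> f v"
  using mod_hom.f_minus[OF mod_hom_of] .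

lemma module_hom_neg: "v \<in> carrier V \<Longrightarrow> f (\<ominus>\<^bsub>V\<^esub> v) = \<ominus>\<^bsub>W\<^esub> f v"
  using mod_hom.f_neg[OF mod_hom_of] .

lemma module_hom_ker: "submodule K {v \<in> carrier V. f v = \<zero>\<^bsub>W\<^esub>} V"
  using mod_hom.ker_is_submodule[OF mod_hom_of] by (simp add: mod_hom.ker_def[OF mod_hom_of])

end

lemma module_hom_comp:
  assumes "f \<in> module_hom K U V" "g \<in> module_hom K V W"
  shows "(\<lambda>x. g (f x)) \<in> module_hom K U W"
  using assms by (auto simp: module_hom_def Pi_def)

lemma module_hom_plus:
  assumes W: "vectorspace K W" and f: "f \<in> module_hom K V W" and g: "g \<in> module_hom K V W"
  shows "(\<lambda>x. f x \<oplus>\<^bsub>W\<^esub> g x) \<in> module_hom K V W"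
proof -
  interpret vectorspace K W by fact
  show ?thesis using f g
    by (auto simp: module_hom_def Pi_def smult_r_distr M.a_ac)
qed

lemma module_hom_scale:
  assumes W: "vectorspace K W" and f: "f \<in> module_hom K V W" and a: "a \<in> carrier K"
  shows "(\<lambda>x. a \<odot>\<^bsub>W\<^esub> f x) \<in> module_hom K V W"
proof -
  interpret vectorspace K W by fact
  show ?thesis using f a
    by (auto simp: module_hom_def Pi_def smult_r_distr smult_assoc1[symmetric] R.m_comm)
qed

lemma module_hom_vimage_submodule:
  assumes V: "vectorspace K V" and W: "vectorspace K W" and f: "f \<in> module_hom K V W" 
    and N: "submodule K N W"
  shows "submodule K {v \<in> carrier V. f v \<in> N} V"
proof -
  interpret V: vectorspace K V by fact
  interpret N: submodule K N W by fact
  show ?thesis using f module_hom_zero[OF V W f]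
    by unfold_locales (auto simp: module_hom_def Pi_def)
qed

lemma module_hom_diff:
  assumes W: "vectorspace K W" and f: "f \<in> module_hom K V W" and g: "g \<in> module_hom K V W"
  shows "(\<lambda>x. f x \<ominus>\<^bsub>W\<^esub> g x) \<in> module_hom K V W"
proof -
  interpret vectorspace K W by fact
  show ?thesis using f g
    by (auto simp: module_hom_def Pi_def smult_r_distr M.minus_eq M.minus_add M.a_ac smult_r_minus)
qed

text \<open>Only \<open>carrier\<close>, \<open>zero\<close>, \<open>add\<close> and
  \<open>smult\<close> enter the linear structure, so records that differ in \<open>mult\<close>,
  \<open>one\<close> or extension fields share it. This covers the free algebra, the product algebra
  on U \<otimes> U, the opposite algebra and the Hopf record.\<close>

lemma vectorspace_cong:
  assumes V: "vectorspace K V"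
    and c: "carrier V' = carrier V" and z: "\<zero>\<^bsub>V'\<^esub> = \<zero>\<^bsub>V\<^esub>"
    and a: "add V' = add V" and s: "smult V' = smult V"
  shows "vectorspace K V'"
proof -
  interpret V: vectorspace K V by fact
  have "abelian_group V'"
    by (rule abelian_groupI)
      (auto simp: c z a V.M.a_ac intro: V.M.l_neg)
  then have "module K V'"
    by (intro moduleI)
      (auto simp: c a s V.smult_l_distr V.smult_r_distr V.smult_assoc1 V.is_cring)
  then show ?thesis by (simp add: vectorspace_def V.field_axioms)
qed

lemma module_hom_cong:
  assumes f: "f \<in> module_hom K V W" and V: "vectorspace K V" and eq: "\<And>v. v \<in> carrier V \<Longrightarrow> f v = g v"
  shows "g \<in> module_hom K V W"
proof -
  interpret V: vectorspace K V by fact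
  show ?thesis using f by (auto simp: module_hom_def Pi_def eq[symmetric])
qed

lemma module_hom_id: "(\<lambda>v. v) \<in> module_hom K V V"
  by (auto simp: module_hom_def)

lemma module_hom_const_zero: "vectorspace K W \<Longrightarrow> (\<lambda>v. \<zero>\<^bsub>W\<^esub>) \<in> module_hom K V W"
proof -
  assume "vectorspace K W"
  then interpret vectorspace K W .
  show ?thesis by (auto simp: module_hom_def)
qed

lemma submodule_vectorspace:
  assumes "vectorspace K V" "submodule K N V"
  shows "vectorspace K (V\<lparr>carrier := N\<rparr>)"
  using assms vectorspace.subspace_is_vs[of K V N] by (simp add: subspace_def)

lemma submodule_incl_hom:
  assumes "submodule K N V"
  shows "(\<lambda>v. v) \<in> module_hom K (V\<lparr>carrier := N\<rparr>) V"
  using assms by (auto simp: module_hom_def submodule_def)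

lemma carrier_submodule: "vectorspace K V \<Longrightarrow> submodule K (carrier V) V"
proof -
  assume "vectorspace K V"
  then interpret vectorspace K V .
  show ?thesis by unfold_locales auto
qed

lemma zero_submodule: "vectorspace K V \<Longrightarrow> submodule K {\<zero>\<^bsub>V\<^esub>} V"
proof -
  assume "vectorspace K V"
  then interpret vectorspace K V .
  show ?thesis by unfold_locales auto
qed

section \<open>Free vector spaces and quotients\<close>

lemma free_space_simps [simp]:
  "\<zero>\<^bsub>free_space K X\<^esub> = (\<lambda>_. \<zero>\<^bsub>K\<^esub>)"
  "c \<oplus>\<^bsub>free_space K X\<^esub> d = (\<lambda>x. c x \<oplus>\<^bsub>K\<^esub> d x)"
  "a \<odot>\<^bsub>free_space K X\<^esub> c = (\<lambda>x. a \<otimes>\<^bsub>K\<^esub> c x)"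
  by (auto simp: free_space_def)

lemma carrier_free_space:
  "c \<in> carrier (free_space K X) \<longleftrightarrow>
    (\<forall>x\<in>X. c x \<in> carrier K) \<and> (\<forall>x. x \<notin> X \<longrightarrow> c x = \<zero>\<^bsub>K\<^esub>) \<and> finite {x. c x \<noteq> \<zero>\<^bsub>K\<^esub>}"
  by (auto simp: free_space_def)

context field
begin

lemma free_space_coeff: "c \<in> carrier (free_space R X) \<Longrightarrow> c x \<in> carrier R"
  by (cases "x \<in> X") (auto simp: carrier_free_space)

lemma delta_in_free_space [simp]: "x \<in> X \<Longrightarrow> delta R x \<in> carrier (free_space R X)"
  by (auto simp: carrier_free_space delta_def)

lemma free_space_support: 
  "c \<in> carrier (free_space R X) \<Longrightarrow> finite {x. c x \<noteq> \<zero>} \<and> {x. c x \<noteq> \<zero>} \<subseteq> X"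
  by (auto simp: carrier_free_space)

lemma free_space_abelian_group: "abelian_group (free_space R X)"
proof (rule abelian_groupI)
  fix c d assume c: "c \<in> carrier (free_space R X)" and d: "d \<in> carrier (free_space R X)"
  have "finite {x. c x \<oplus> d x \<noteq> \<zero>}"
    by (rule finite_subset[of _ "{x. c x \<noteq> \<zero>} \<union> {x. d x \<noteq> \<zero>}"])
      (use c d in \<open>auto simp: carrier_free_space\<close>)
  with c d show "c \<oplus>\<^bsub>free_space R X\<^esub> d \<in> carrier (free_space R X)"
    by (auto simp: carrier_free_space)
next
  fix c assume c: "c \<in> carrier (free_space R X)"
  have "finite {x. \<ominus> c x \<noteq> \<zero>}"
    by (rule finite_subset[of _ "{x. c x \<noteq> \<zero>}"])
      (use c in \<open>auto simp: carrier_free_space\<close>)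
  with c show "\<exists>d\<in>carrier (free_space R X). d \<oplus>\<^bsub>free_space R X\<^esub> c = \<zero>\<^bsub>free_space R X\<^esub>"
    by (intro bexI[of _ "\<lambda>x. \<ominus> c x"]) (auto simp: carrier_free_space l_neg free_space_coeff[OF c])
qed (auto simp: fun_eq_iff free_space_coeff a_ac, auto simp: carrier_free_space)

lemma free_space_vectorspace: "vectorspace R (free_space R X)"
proof -
  have "module R (free_space R X)"
  proof (rule moduleI)
    fix a c assume a: "a \<in> carrier R" and c: "c \<in> carrier (free_space R X)"
    have "finite {x. a \<otimes> c x \<noteq> \<zero>}"
      by (rule finite_subset[of _ "{x. c x \<noteq> \<zero>}"])
        (use a c in \<open>auto simp: carrier_free_space\<close>)
    with a c show "a \<odot>\<^bsub>free_space R X\<^esub> c \<in> carrier (free_space R X)"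
      by (auto simp: carrier_free_space)
  qed (auto simp: fun_eq_iff free_space_coeff l_distr r_distr m_assoc is_cring
         free_space_abelian_group)
  then show ?thesis by (simp add: vectorspace_def field_axioms)
qed

text \<open>The support is finite, and each step erases one of its points. The \<open>add\<close>
  case has the shape of a scaled basis vector plus a remainder, so that linearity of a map can be
  used in one stroke.\<close>

lemma free_space_induct [consumes 1, case_names zero add]:
  assumes c: "c \<in> carrier (free_space R X)"
    and zero: "P \<zero>\<^bsub>free_space R X\<^esub>"
    and add: "\<And>a x c. \<lbrakk>a \<in> carrier R; x \<in> X; c \<in> carrier (free_space R X); P c\<rbrakk> \<Longrightarrow>
      P (a \<odot>\<^bsub>free_space R X\<^esub> delta R x \<oplus>\<^bsub>free_space R X\<^esub> c)"
  shows "P c"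
proof -
  have "finite A \<Longrightarrow> c \<in> carrier (free_space R X) \<Longrightarrow> {x. c x \<noteq> \<zero>} = A \<Longrightarrow> P c" for A c
  proof (induction A arbitrary: c rule: finite_induct)
    case empty
    then have "c = \<zero>\<^bsub>free_space R X\<^esub>" by auto
    then show ?case using zero by simp
  next
    case (insert x A)
    define d where "d = c(x := \<zero>)"
    have "{y. d y \<noteq> \<zero>} = {y. c y \<noteq> \<zero>} - {x}" by (auto simp: d_def)
    then have supp: "{y. d y \<noteq> \<zero>} = A" using insert.prems(2) insert.hyps(2) by simp
    have d: "d \<in> carrier (free_space R X)"
      using insert.prems(1) insert.hyps(1) unfolding carrier_free_space supp by (auto simp: d_def)
    have "c x \<noteq> \<zero>" using insert.prems(2) by blast
    then have x: "x \<in> X" using insert.prems(1) by (auto simp: carrier_free_space)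
    have cx: "c x \<in> carrier R" by (rule free_space_coeff[OF insert.prems(1)])
    have "c = c x \<odot>\<^bsub>free_space R X\<^esub> delta R x \<oplus>\<^bsub>free_space R X\<^esub> d"
      using free_space_coeff[OF insert.prems(1)] by (auto simp: fun_eq_iff delta_def d_def)
    then show ?case using add[OF cx x d insert.IH[OF d supp]] by simp
  qed
  then show ?thesis using c by (auto simp: carrier_free_space)
qed

text \<open>\<open>lin_ext\<close> sums over the support, which changes when vectors are added or
  scaled. A common finite index set makes the sums comparable, since extra points contribute
  zero.\<close>

lemma lin_ext_superset:
  assumes Z: "vectorspace R Z" and f: "f \<in> X \<rightarrow> carrier Z"
    and c: "c \<in> carrier (free_space R X)" and A: "finite A" "{x. c x \<noteq> \<zero>} \<subseteq> A" "A \<subseteq> X"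
  shows "lin_ext R Z f c = (\<Oplus>\<^bsub>Z\<^esub>x\<in>A. c x \<odot>\<^bsub>Z\<^esub> f x)"
proof -
  interpret Z: vectorspace R Z by fact
  show ?thesis unfolding lin_ext_def using A f free_space_coeff[OF c]
    by (intro Z.M.add.finprod_mono_neutral_cong_left) (auto intro!: Z.smult_closed simp: Pi_def)
qed

lemma lin_ext_hom:
  assumes Z: "vectorspace R Z" and f: "f \<in> X \<rightarrow> carrier Z"
  shows "lin_ext R Z f \<in> module_hom R (free_space R X) Z"
proof (rule module_homI)
  interpret Z: vectorspace R Z by fact
  interpret F: vectorspace R "free_space R X" by (rule free_space_vectorspace)
  fix c assume c: "c \<in> carrier (free_space R X)"
  note sc = free_space_support[OF c]
  show "lin_ext R Z f c \<in> carrier Z"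
    unfolding lin_ext_def using f sc free_space_coeff[OF c]
    by (intro Z.M.finsum_closed) (auto intro!: Z.smult_closed)
  {
    fix d assume d: "d \<in> carrier (free_space R X)"
    note sd = free_space_support[OF d]
    have cd: "c \<oplus>\<^bsub>free_space R X\<^esub> d \<in> carrier (free_space R X)" using c d by (rule F.M.a_closed)
    let ?A = "{x. c x \<noteq> \<zero>} \<union> {x. d x \<noteq> \<zero>}"
    have A: "finite ?A" "?A \<subseteq> X" using sc sd by auto
    have A3: "{x. (c \<oplus>\<^bsub>free_space R X\<^esub> d) x \<noteq> \<zero>} \<subseteq> ?A" by auto
    have "lin_ext R Z f (c \<oplus>\<^bsub>free_space R X\<^esub> d)
        = (\<Oplus>\<^bsub>Z\<^esub>x\<in>?A. (c \<oplus>\<^bsub>free_space R X\<^esub> d) x \<odot>\<^bsub>Z\<^esub> f x)"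
      by (rule lin_ext_superset[OF Z f cd A(1) A3 A(2)])
    also have "\<dots> = (\<Oplus>\<^bsub>Z\<^esub>x\<in>?A. c x \<odot>\<^bsub>Z\<^esub> f x \<oplus>\<^bsub>Z\<^esub> d x \<odot>\<^bsub>Z\<^esub> f x)"
      using A(2) f free_space_coeff[OF c] free_space_coeff[OF d]
      by (intro Z.M.finsum_cong') (auto simp: subset_eq Pi_def Z.smult_l_distr)
    also have "\<dots> = (\<Oplus>\<^bsub>Z\<^esub>x\<in>?A. c x \<odot>\<^bsub>Z\<^esub> f x) \<oplus>\<^bsub>Z\<^esub> (\<Oplus>\<^bsub>Z\<^esub>x\<in>?A. d x \<odot>\<^bsub>Z\<^esub> f x)"
      using A(2) f free_space_coeff[OF c] free_space_coeff[OF d]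
      by (intro Z.M.finsum_addf) (auto simp: subset_eq Pi_def)
    also have "\<dots> = lin_ext R Z f c \<oplus>\<^bsub>Z\<^esub> lin_ext R Z f d"
      using lin_ext_superset[OF Z f c A(1) _ A(2)] lin_ext_superset[OF Z f d A(1) _ A(2)] by auto
    finally show "lin_ext R Z f (c \<oplus>\<^bsub>free_space R X\<^esub> d) = lin_ext R Z f c \<oplus>\<^bsub>Z\<^esub> lin_ext R Z f d" .
  }
  fix a assume a: "a \<in> carrier R"
  have ac: "a \<odot>\<^bsub>free_space R X\<^esub> c \<in> carrier (free_space R X)" using a c by (rule F.smult_closed)
  have A: "finite {x. c x \<noteq> \<zero>}" "{x. c x \<noteq> \<zero>} \<subseteq> X" using sc by auto
  have A3: "{x. (a \<odot>\<^bsub>free_space R X\<^esub> c) x \<noteq> \<zero>} \<subseteq> {x. c x \<noteq> \<zero>}" using a by auto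
  have "lin_ext R Z f (a \<odot>\<^bsub>free_space R X\<^esub> c)
      = (\<Oplus>\<^bsub>Z\<^esub>x\<in>{x. c x \<noteq> \<zero>}. (a \<odot>\<^bsub>free_space R X\<^esub> c) x \<odot>\<^bsub>Z\<^esub> f x)"
    by (rule lin_ext_superset[OF Z f ac A(1) A3 A(2)])
  also have "\<dots> = (\<Oplus>\<^bsub>Z\<^esub>x\<in>{x. c x \<noteq> \<zero>}. a \<odot>\<^bsub>Z\<^esub> (c x \<odot>\<^bsub>Z\<^esub> f x))"
    using A(2) f a free_space_coeff[OF c]
    by (intro Z.M.finsum_cong') (auto simp: subset_eq Pi_def Z.smult_assoc1)
  also have "\<dots> = a \<odot>\<^bsub>Z\<^esub> lin_ext R Z f c"
    unfolding lin_ext_def using A f a free_space_coeff[OF c]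
    by (intro Z.finsum_smult_ldistr[symmetric]) (auto simp: subset_eq Pi_def)
  finally show "lin_ext R Z f (a \<odot>\<^bsub>free_space R X\<^esub> c) = a \<odot>\<^bsub>Z\<^esub> lin_ext R Z f c" .
qed

lemma lin_ext_delta:
  assumes Z: "vectorspace R Z" and f: "f x \<in> carrier Z"
  shows "lin_ext R Z f (delta R x) = f x"
proof -
  interpret Z: vectorspace R Z by fact
  have "{y. delta R x y \<noteq> \<zero>} = {x}" by (auto simp: delta_def)
  then show ?thesis using f by (simp add: lin_ext_def delta_def)
qed

end

context
  fixes K :: "('k, 'r) ring_scheme" and V :: "('k, 'v, 'c) module_scheme" and N
  assumes V: "vectorspace K V" and N: "submodule K N V"
begin

interpretation V: vectorspace K V by (rule V)
interpretation N: submodule K N V by (rule N)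

lemma submodule_neg: "v \<in> N \<Longrightarrow> \<ominus>\<^bsub>V\<^esub> v \<in> N"
  using N.subset by (metis N.smult_closed V.R.add.inv_closed V.R.one_closed V.smult_minus_1 subsetD)

lemma submodule_minus: "u \<in> N \<Longrightarrow> v \<in> N \<Longrightarrow> u \<ominus>\<^bsub>V\<^esub> v \<in> N"
  by (simp add: V.M.minus_eq submodule_neg)

lemma submodule_abelian_subgroup: "abelian_subgroup N V"
proof (rule abelian_subgroupI3)
  show "additive_subgroup N V"
  proof (rule additive_subgroupI, rule subgroup.intro)
    show "inv\<^bsub>add_monoid V\<^esub> x \<in> N" if "x \<in> N" for x
      using submodule_neg[OF that] by (simp add: a_inv_def)
  qed (use N.subset in auto)
qed (rule V.M.abelian_group_axioms)

interpretation N: abelian_subgroup N V by (rule submodule_abelian_subgroup)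

lemma quotient_space_simps:
  "carrier (quotient_space V N) = a_rcosets\<^bsub>V\<^esub> N"
  "\<zero>\<^bsub>quotient_space V N\<^esub> = N"
  "X \<oplus>\<^bsub>quotient_space V N\<^esub> Y = X <+>\<^bsub>V\<^esub> Y"
  "a \<odot>\<^bsub>quotient_space V N\<^esub> X = (\<Union>v\<in>X. N +>\<^bsub>V\<^esub> (a \<odot>\<^bsub>V\<^esub> v))"
  by (simp_all add: quotient_space_def ring.defs FactRing_def)

lemma quotient_space_E:
  assumes "X \<in> carrier (quotient_space V N)"
  obtains v where "v \<in> carrier V" "X = N +>\<^bsub>V\<^esub> v"
  using assms by (auto simp: quotient_space_simps A_RCOSETS_defs a_r_coset_def)

lemma coset_carrier: "v \<in> carrier V \<Longrightarrow> N +>\<^bsub>V\<^esub> v \<in> carrier (quotient_space V N)"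
  by (auto simp: quotient_space_simps A_RCOSETS_defs a_r_coset_def)

lemma coset_eq_iff:
  "\<lbrakk>u \<in> carrier V; v \<in> carrier V\<rbrakk> \<Longrightarrow> N +>\<^bsub>V\<^esub> u = N +>\<^bsub>V\<^esub> v \<longleftrightarrow> u \<ominus>\<^bsub>V\<^esub> v \<in> N"
  by (metis N.a_rcos_self N.a_repr_independence' N.a_rcos_module V.M.minus_eq)

lemma coset_add: "\<lbrakk>u \<in> carrier V; v \<in> carrier V\<rbrakk> \<Longrightarrow>
    N +>\<^bsub>V\<^esub> (u \<oplus>\<^bsub>V\<^esub> v) = (N +>\<^bsub>V\<^esub> u) \<oplus>\<^bsub>quotient_space V N\<^esub> (N +>\<^bsub>V\<^esub> v)"
  by (simp add: quotient_space_simps N.a_rcos_sum)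

text \<open>Scalar multiplication of a coset is encoded as a union over all its representatives.
  Changing the representative changes a v by an element of N, so the members of this union are one
  and the same coset.\<close>

lemma coset_smult:
  assumes a: "a \<in> carrier K" and v: "v \<in> carrier V"
  shows "N +>\<^bsub>V\<^esub> (a \<odot>\<^bsub>V\<^esub> v) = a \<odot>\<^bsub>quotient_space V N\<^esub> (N +>\<^bsub>V\<^esub> v)"
proof -
  have "N +>\<^bsub>V\<^esub> (a \<odot>\<^bsub>V\<^esub> u) = N +>\<^bsub>V\<^esub> (a \<odot>\<^bsub>V\<^esub> v)" if u: "u \<in> N +>\<^bsub>V\<^esub> v" for u
  proof -
    have uV: "u \<in> carrier V" using u v N.a_elemrcos_carrier by blast
    have "u \<ominus>\<^bsub>V\<^esub> v \<in> N" using u v uV N.a_rcos_module V.M.minus_eq by metis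
    then have "a \<odot>\<^bsub>V\<^esub> (u \<ominus>\<^bsub>V\<^esub> v) \<in> N" using a by simp
    also have "a \<odot>\<^bsub>V\<^esub> (u \<ominus>\<^bsub>V\<^esub> v) = a \<odot>\<^bsub>V\<^esub> u \<ominus>\<^bsub>V\<^esub> a \<odot>\<^bsub>V\<^esub> v"
      using a uV v by (simp add: V.M.minus_eq V.smult_r_distr V.smult_r_minus)
    finally show ?thesis using a uV v by (simp add: coset_eq_iff)
  qed
  then have "(\<Union>u\<in>N +>\<^bsub>V\<^esub> v. N +>\<^bsub>V\<^esub> (a \<odot>\<^bsub>V\<^esub> u)) = (\<Union>u\<in>N +>\<^bsub>V\<^esub> v. N +>\<^bsub>V\<^esub> (a \<odot>\<^bsub>V\<^esub> v))"
    by auto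
  moreover have "v \<in> N +>\<^bsub>V\<^esub> v" using v by (rule N.a_rcos_self)
  ultimately show ?thesis by (auto simp: quotient_space_simps)
qed

lemma quotient_space_vectorspace: "vectorspace K (quotient_space V N)"
proof -
  have cg: "abelian_group (quotient_space V N)"
  proof (rule abelian_groupI)
    fix x y z assume x: "x \<in> carrier (quotient_space V N)" and y: "y \<in> carrier (quotient_space V N)"
      and z: "z \<in> carrier (quotient_space V N)"
    from x obtain u where u: "u \<in> carrier V" "x = N +>\<^bsub>V\<^esub> u" by (rule quotient_space_E)
    from y obtain v where v: "v \<in> carrier V" "y = N +>\<^bsub>V\<^esub> v" by (rule quotient_space_E)
    from z obtain w where w: "w \<in> carrier V" "z = N +>\<^bsub>V\<^esub> w" by (rule quotient_space_E)
    show "x \<oplus>\<^bsub>quotient_space V N\<^esub> y \<oplus>\<^bsub>quotient_space V N\<^esub> z =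
        x \<oplus>\<^bsub>quotient_space V N\<^esub> (y \<oplus>\<^bsub>quotient_space V N\<^esub> z)"
      using u v w by (simp add: coset_add[symmetric] V.M.a_assoc)
  next
    fix x y assume x: "x \<in> carrier (quotient_space V N)" and y: "y \<in> carrier (quotient_space V N)"
    from x obtain u where u: "u \<in> carrier V" "x = N +>\<^bsub>V\<^esub> u" by (rule quotient_space_E)
    from y obtain v where v: "v \<in> carrier V" "y = N +>\<^bsub>V\<^esub> v" by (rule quotient_space_E)
    show "x \<oplus>\<^bsub>quotient_space V N\<^esub> y \<in> carrier (quotient_space V N)"
      using u v by (simp add: coset_add[symmetric] coset_carrier)
    show "x \<oplus>\<^bsub>quotient_space V N\<^esub> y = y \<oplus>\<^bsub>quotient_space V N\<^esub> x"
      using u v by (simp add: coset_add[symmetric] V.M.a_comm)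
  next
    have zero: "\<zero>\<^bsub>quotient_space V N\<^esub> = N +>\<^bsub>V\<^esub> \<zero>\<^bsub>V\<^esub>"
      by (simp add: quotient_space_simps N.a_rcos_const)
    then show "\<zero>\<^bsub>quotient_space V N\<^esub> \<in> carrier (quotient_space V N)"
      by (simp add: coset_carrier)
    fix x assume x: "x \<in> carrier (quotient_space V N)"
    from x obtain u where u: "u \<in> carrier V" "x = N +>\<^bsub>V\<^esub> u" by (rule quotient_space_E)
    show "\<zero>\<^bsub>quotient_space V N\<^esub> \<oplus>\<^bsub>quotient_space V N\<^esub> x = x"
      unfolding zero using u by (simp add: coset_add[symmetric])
    show "\<exists>y\<in>carrier (quotient_space V N). y \<oplus>\<^bsub>quotient_space V N\<^esub> x = \<zero>\<^bsub>quotient_space V N\<^esub>"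
      unfolding zero using u
      by (intro bexI[of _ "N +>\<^bsub>V\<^esub> (\<ominus>\<^bsub>V\<^esub> u)"])
        (simp_all add: coset_add[symmetric] coset_carrier V.M.l_neg)
  qed
  have "module K (quotient_space V N)"
  proof (rule moduleI)
    fix a b x assume a: "a \<in> carrier K" and b: "b \<in> carrier K" and x: "x \<in> carrier (quotient_space V N)"
    from x obtain v where v: "v \<in> carrier V" "x = N +>\<^bsub>V\<^esub> v" by (rule quotient_space_E)
    then show "(a \<oplus>\<^bsub>K\<^esub> b) \<odot>\<^bsub>quotient_space V N\<^esub> x =
       (a \<odot>\<^bsub>quotient_space V N\<^esub> x) \<oplus>\<^bsub>quotient_space V N\<^esub> (b \<odot>\<^bsub>quotient_space V N\<^esub> x)"
      "(a \<otimes>\<^bsub>K\<^esub> b) \<odot>\<^bsub>quotient_space V N\<^esub> x = a \<odot>\<^bsub>quotient_space V N\<^esub> (b \<odot>\<^bsub>quotient_space V N\<^esub> x)"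
      using a b by (simp_all add: coset_smult[symmetric] coset_add[symmetric] V.smult_l_distr V.smult_assoc1)
  next
    fix a x y assume a: "a \<in> carrier K" and x: "x \<in> carrier (quotient_space V N)"
     and y: "y \<in> carrier (quotient_space V N)"
    from x obtain v where v: "v \<in> carrier V" "x = N +>\<^bsub>V\<^esub> v" by (rule quotient_space_E)
    from y obtain w where w: "w \<in> carrier V" "y = N +>\<^bsub>V\<^esub> w" by (rule quotient_space_E)
    show "a \<odot>\<^bsub>quotient_space V N\<^esub> (x \<oplus>\<^bsub>quotient_space V N\<^esub> y) =
       (a \<odot>\<^bsub>quotient_space V N\<^esub> x) \<oplus>\<^bsub>quotient_space V N\<^esub> (a \<odot>\<^bsub>quotient_space V N\<^esub> y)"
      using a v w by (simp add: coset_smult[symmetric] coset_add[symmetric] V.smult_r_distr)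
  next
    fix x assume x: "x \<in> carrier (quotient_space V N)"
    from x obtain v where v: "v \<in> carrier V" "x = N +>\<^bsub>V\<^esub> v" by (rule quotient_space_E)
    then show "\<one>\<^bsub>K\<^esub> \<odot>\<^bsub>quotient_space V N\<^esub> x = x"
      by (simp add: coset_smult[symmetric])
    fix a assume a: "a \<in> carrier K"
    with v show "a \<odot>\<^bsub>quotient_space V N\<^esub> x \<in> carrier (quotient_space V N)"
      by (simp add: coset_smult[symmetric] coset_carrier)
  qed (auto simp: V.is_cring cg)
  then show ?thesis by (simp add: vectorspace_def V.field_axioms)
qed

lemma coset_hom: "(\<lambda>v. N +>\<^bsub>V\<^esub> v) \<in> module_hom K V (quotient_space V N)"
  by (rule module_homI) (auto simp: coset_carrier coset_add coset_smult)

lemma coset_zero: "v \<in> N \<Longrightarrow> N +>\<^bsub>V\<^esub> v = \<zero>\<^bsub>quotient_space V N\<^esub>"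
  by (simp add: quotient_space_simps N.a_rcos_const)

text \<open>A linear map vanishing on N is constant on cosets, so the image of a coset is a
  singleton. The \<open>the_elem\<close> in the maps out of a tensor product or out of U is
  evaluated through this lemma.\<close>

lemma the_elem_coset:
  assumes Z: "vectorspace K Z" and g: "g \<in> module_hom K V Z"
    and gN: "\<And>n. n \<in> N \<Longrightarrow> g n = \<zero>\<^bsub>Z\<^esub>" and v: "v \<in> carrier V"
  shows "the_elem (g ` (N +>\<^bsub>V\<^esub> v)) = g v"
proof -
  interpret Z: vectorspace K Z by fact
  have "g u = g v" if "u \<in> N +>\<^bsub>V\<^esub> v" for u
  proof -
    from that obtain n where n: "n \<in> N" "u = n \<oplus>\<^bsub>V\<^esub> v" by (auto simp: a_r_coset_def r_coset_def)
    then have "n \<in> carrier V" using N.subset by auto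
    then show ?thesis using n v g gN by (simp add: module_hom_add[OF g] module_hom_in[OF g])
  qed
  moreover have "v \<in> N +>\<^bsub>V\<^esub> v" using v by (rule N.a_rcos_self)
  ultimately have "g ` (N +>\<^bsub>V\<^esub> v) = {g v}"
    by (intro image_eq_singleton)
  then show ?thesis by simp
qed

lemma the_elem_hom:
  assumes Z: "vectorspace K Z" and g: "g \<in> module_hom K V Z"
    and gN: "\<And>n. n \<in> N \<Longrightarrow> g n = \<zero>\<^bsub>Z\<^esub>"
  shows "(\<lambda>X. the_elem (g ` X)) \<in> module_hom K (quotient_space V N) Z"
proof (rule module_homI)
  note te = the_elem_coset[OF Z g gN]
  fix X assume "X \<in> carrier (quotient_space V N)"
  then obtain v where v: "v \<in> carrier V" "X = N +>\<^bsub>V\<^esub> v" by (rule quotient_space_E)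
  then show "the_elem (g ` X) \<in> carrier Z"
    using v by (simp add: te module_hom_in[OF g])
  fix a assume a: "a \<in> carrier K"
  then show "the_elem (g ` (a \<odot>\<^bsub>quotient_space V N\<^esub> X)) = a \<odot>\<^bsub>Z\<^esub> the_elem (g ` X)"
    using v by (simp add: coset_smult[symmetric] te module_hom_smult[OF g])
next
  note te = the_elem_coset[OF Z g gN]
  fix X Y assume X: "X \<in> carrier (quotient_space V N)" and Y: "Y \<in> carrier (quotient_space V N)"
  from X obtain v where v: "v \<in> carrier V" "X = N +>\<^bsub>V\<^esub> v" by (rule quotient_space_E)
  from Y obtain w where w: "w \<in> carrier V" "Y = N +>\<^bsub>V\<^esub> w" by (rule quotient_space_E)
  show "the_elem (g ` (X \<oplus>\<^bsub>quotient_space V N\<^esub> Y)) = the_elem (g ` X) \<oplus>\<^bsub>Z\<^esub> the_elem (g ` Y)"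
    using v w by (simp add: coset_add[symmetric] te module_hom_add[OF g])
qed

end

section \<open>Tensor products\<close>

definition bilinear_map ::
  "('k, 'r) ring_scheme \<Rightarrow> ('k, 'v, 'c) module_scheme \<Rightarrow> ('k, 'w, 'd) module_scheme \<Rightarrow>
   ('k, 'z, 'e) module_scheme \<Rightarrow> ('v \<Rightarrow> 'w \<Rightarrow> 'z) \<Rightarrow> bool"
  where "bilinear_map K V W Z f \<longleftrightarrow>
    (\<forall>v\<in>carrier V. f v \<in> module_hom K W Z) \<and> (\<forall>w\<in>carrier W. (\<lambda>v. f v w) \<in> module_hom K V Z)"

lemma bilinear_mapI:
  assumes "\<And>v. v \<in> carrier V \<Longrightarrow> f v \<in> module_hom K W Z"
    and "\<And>w. w \<in> carrier W \<Longrightarrow> (\<lambda>v. f v w) \<in> module_hom K V Z"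
  shows "bilinear_map K V W Z f"
  using assms by (simp add: bilinear_map_def)

lemma bilinear_map_right: "\<lbrakk>bilinear_map K V W Z f; v \<in> carrier V\<rbrakk> \<Longrightarrow> f v \<in> module_hom K W Z"
  by (simp add: bilinear_map_def)

lemma bilinear_map_left: "\<lbrakk>bilinear_map K V W Z f; w \<in> carrier W\<rbrakk> \<Longrightarrow> (\<lambda>v. f v w) \<in> module_hom K V Z"
  by (simp add: bilinear_map_def)

lemma bilinear_map_in: "\<lbrakk>bilinear_map K V W Z f; v \<in> carrier V; w \<in> carrier W\<rbrakk> \<Longrightarrow> f v w \<in> carrier Z"
  using bilinear_map_right module_hom_in by metis

lemma bilinear_map_comp:
  assumes f: "bilinear_map K V W Z f" and g: "g \<in> module_hom K X V" and h: "h \<in> module_hom K Y W"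
  shows "bilinear_map K X Y Z (\<lambda>x y. f (g x) (h y))"
proof (rule bilinear_mapI)
  fix x assume x: "x \<in> carrier X"
  show "(\<lambda>y. f (g x) (h y)) \<in> module_hom K Y Z"
    by (rule module_hom_comp[OF h bilinear_map_right[OF f module_hom_in[OF g x]]])
next
  fix y assume y: "y \<in> carrier Y"
  show "(\<lambda>x. f (g x) (h y)) \<in> module_hom K X Z"
    by (rule module_hom_comp[OF g bilinear_map_left[OF f module_hom_in[OF h y]]])
qed

lemma bilinear_map_plus:
  assumes "vectorspace K Z" "bilinear_map K V W Z f" "bilinear_map K V W Z g"
  shows "bilinear_map K V W Z (\<lambda>v w. f v w \<oplus>\<^bsub>Z\<^esub> g v w)"
  using assms by (auto simp: bilinear_map_def module_hom_plus)

lemma bilinear_map_scale: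
  assumes "vectorspace K Z" "bilinear_map K V W Z f" "a \<in> carrier K"
  shows "bilinear_map K V W Z (\<lambda>v w. a \<odot>\<^bsub>Z\<^esub> f v w)"
  using assms by (auto simp: bilinear_map_def module_hom_scale)

section \<open>Pure tensors and the universal property of the tensor product\<close>

context
  fixes K :: "('k, 'r) ring_scheme" and V :: "('k, 'v, 'c) module_scheme"
    and W :: "('k, 'w, 'd) module_scheme"
  assumes V: "vectorspace K V" and W: "vectorspace K W"
begin

interpretation V: vectorspace K V by (rule V)
interpretation W: vectorspace K W by (rule W)

abbreviation (input) FT where "FT \<equiv> free_space K (carrier V \<times> carrier W)"

interpretation F: vectorspace K FT by (rule V.free_space_vectorspace)

lemma delta_in_FT: "v \<in> carrier V \<Longrightarrow> w \<in> carrier W \<Longrightarrow> delta K (v, w) \<in> carrier FT"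
  by (rule V.delta_in_free_space) simp

lemma tensor_relations_carrier: "tensor_relations K V W \<subseteq> carrier FT"
  unfolding tensor_relations_def Let_def
  by (auto simp del: free_space_simps intro!: F.M.minus_closed F.smult_closed delta_in_FT)

lemma tensor_kernel_submodule: "submodule K (tensor_kernel K V W) FT"
  unfolding tensor_kernel_def by (rule F.span_is_submodule[OF tensor_relations_carrier])

lemma tensor_vectorspace: "vectorspace K (tensor K V W)"
  unfolding tensor_def by (rule quotient_space_vectorspace[OF F.vectorspace_axioms tensor_kernel_submodule])

text \<open>The kernel of \<open>f\<close> is a subspace containing the relations, hence it contains
  their span.\<close>

lemma tensor_kernel_least:
  assumes Z: "vectorspace K Z" and f: "f \<in> module_hom K FT Z"
    and rel: "\<And>r. r \<in> tensor_relations K V W \<Longrightarrow> f r = \<zero>\<^bsub>Z\<^esub>" and n: "n \<in> tensor_kernel K V W"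
  shows "f n = \<zero>\<^bsub>Z\<^esub>"
proof -
  have "module.span K FT (tensor_relations K V W) \<subseteq> {c \<in> carrier FT. f c = \<zero>\<^bsub>Z\<^esub>}"
    using tensor_relations_carrier rel
    by (intro F.span_is_subset module_hom_ker[OF F.vectorspace_axioms Z f]) auto
  then show ?thesis using n by (auto simp: tensor_kernel_def)
qed

lemma tensor_relation_in_kernel: "r \<in> tensor_relations K V W \<Longrightarrow> r \<in> tensor_kernel K V W"
  unfolding tensor_kernel_def using tensor_relations_carrier F.in_own_span by blast

abbreviation (input) PT where "PT \<equiv> pure_tensor K V W"

interpretation T: vectorspace K "tensor K V W" by (rule tensor_vectorspace)

lemma coset_tensor_hom: "(\<lambda>c. tensor_kernel K V W +>\<^bsub>FT\<^esub> c) \<in> module_hom K FT (tensor K V W)"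
  unfolding tensor_def by (rule coset_hom[OF F.vectorspace_axioms tensor_kernel_submodule])

lemma pure_tensor_closed: "\<lbrakk>v \<in> carrier V; w \<in> carrier W\<rbrakk> \<Longrightarrow> PT v w \<in> carrier (tensor K V W)"
  unfolding pure_tensor_def by (rule module_hom_in[OF coset_tensor_hom delta_in_FT])

lemma coset_tensor_relation:
  assumes "c \<ominus>\<^bsub>FT\<^esub> d \<in> tensor_relations K V W" "c \<in> carrier FT" "d \<in> carrier FT"
  shows "tensor_kernel K V W +>\<^bsub>FT\<^esub> c = tensor_kernel K V W +>\<^bsub>FT\<^esub> d"
  using coset_eq_iff[OF F.vectorspace_axioms tensor_kernel_submodule] tensor_relation_in_kernel assms
  by blast

lemma pure_tensor_bilinear: "bilinear_map K V W (tensor K V W) PT"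
proof -
  note [simp] = delta_in_FT pure_tensor_closed
  note [simp del] = free_space_simps
  note hom = coset_tensor_hom
  have al: "PT (v \<oplus>\<^bsub>V\<^esub> v') w = PT v w \<oplus>\<^bsub>tensor K V W\<^esub> PT v' w"
    if c: "v \<in> carrier V" "v' \<in> carrier V" "w \<in> carrier W" for v v' w
  proof -
    have "delta K (v \<oplus>\<^bsub>V\<^esub> v', w) \<ominus>\<^bsub>FT\<^esub> delta K (v, w) \<ominus>\<^bsub>FT\<^esub> delta K (v', w)
        \<in> tensor_relations K V W"
      unfolding tensor_relations_def Let_def using c by blast
    with c show ?thesis unfolding pure_tensor_def
      by (subst module_hom_add[OF hom, symmetric]; simp?)
        (rule coset_tensor_relation, simp_all add: F.M.minus_minus_eq)
  qed
  have ar: "PT v (w \<oplus>\<^bsub>W\<^esub> w') = PT v w \<oplus>\<^bsub>tensor K V W\<^esub> PT v w'"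
    if c: "v \<in> carrier V" "w \<in> carrier W" "w' \<in> carrier W" for v w w'
  proof -
    have "delta K (v, w \<oplus>\<^bsub>W\<^esub> w') \<ominus>\<^bsub>FT\<^esub> delta K (v, w) \<ominus>\<^bsub>FT\<^esub> delta K (v, w')
        \<in> tensor_relations K V W"
      unfolding tensor_relations_def Let_def using c by blast
    with c show ?thesis unfolding pure_tensor_def
      by (subst module_hom_add[OF hom, symmetric]; simp?)
        (rule coset_tensor_relation, simp_all add: F.M.minus_minus_eq)
  qed
  have sl: "PT (a \<odot>\<^bsub>V\<^esub> v) w = a \<odot>\<^bsub>tensor K V W\<^esub> PT v w"
    if c: "a \<in> carrier K" "v \<in> carrier V" "w \<in> carrier W" for a v w
  proof -
    have "delta K (a \<odot>\<^bsub>V\<^esub> v, w) \<ominus>\<^bsub>FT\<^esub> a \<odot>\<^bsub>FT\<^esub> delta K (v, w) \<in> tensor_relations K V W"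
      unfolding tensor_relations_def Let_def using c by blast
    with c show ?thesis unfolding pure_tensor_def
      by (subst module_hom_smult[OF hom, symmetric]; simp?) (rule coset_tensor_relation, simp_all)
  qed
  have sr: "PT v (a \<odot>\<^bsub>W\<^esub> w) = a \<odot>\<^bsub>tensor K V W\<^esub> PT v w"
    if c: "a \<in> carrier K" "v \<in> carrier V" "w \<in> carrier W" for a v w
  proof -
    have "delta K (v, a \<odot>\<^bsub>W\<^esub> w) \<ominus>\<^bsub>FT\<^esub> a \<odot>\<^bsub>FT\<^esub> delta K (v, w) \<in> tensor_relations K V W"
      unfolding tensor_relations_def Let_def using c by blast
    with c show ?thesis unfolding pure_tensor_def
      by (subst module_hom_smult[OF hom, symmetric]; simp?) (rule coset_tensor_relation, simp_all)
  qed
  show ?thesis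
    by (intro bilinear_mapI module_homI pure_tensor_closed) (simp_all add: al ar sl sr)
qed

text \<open>There is no case for scalars because a scalar in front of a pure tensor can be moved
  into its left factor.\<close>

lemma tensor_induct [consumes 1, case_names zero pure add]:
  assumes t: "t \<in> carrier (tensor K V W)"
    and zero: "P \<zero>\<^bsub>tensor K V W\<^esub>"
    and pure: "\<And>v w. \<lbrakk>v \<in> carrier V; w \<in> carrier W\<rbrakk> \<Longrightarrow> P (PT v w)"
    and add: "\<And>s t. \<lbrakk>s \<in> carrier (tensor K V W); t \<in> carrier (tensor K V W); P s; P t\<rbrakk> \<Longrightarrow>
      P (s \<oplus>\<^bsub>tensor K V W\<^esub> t)"
  shows "P t"
proof -
  note [simp del] = free_space_simps
  let ?q = "\<lambda>c. tensor_kernel K V W +>\<^bsub>FT\<^esub> c"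
  note hom = coset_tensor_hom
  from t obtain c where c: "c \<in> carrier FT" "t = ?q c"
    unfolding tensor_def by (rule quotient_space_E[OF F.vectorspace_axioms tensor_kernel_submodule])
  from c(1) have "P (?q c)"
  proof (induction rule: V.free_space_induct)
    case zero
    have "?q \<zero>\<^bsub>FT\<^esub> = \<zero>\<^bsub>tensor K V W\<^esub>"
      by (rule module_hom_zero[OF F.vectorspace_axioms tensor_vectorspace hom])
    then show ?case using \<open>P \<zero>\<^bsub>tensor K V W\<^esub>\<close> by simp
  next
    case (add a x c)
    obtain v w where x: "x = (v, w)" by (cases x)
    have v: "v \<in> carrier V" and w: "w \<in> carrier W" using add x by auto
    have d: "delta K x \<in> carrier FT" using add by simp
    have "?q (a \<odot>\<^bsub>FT\<^esub> delta K x \<oplus>\<^bsub>FT\<^esub> c)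
        = a \<odot>\<^bsub>tensor K V W\<^esub> PT v w \<oplus>\<^bsub>tensor K V W\<^esub> ?q c"
      using add d by (simp add: module_hom_add[OF hom] module_hom_smult[OF hom] pure_tensor_def x)
    also have "a \<odot>\<^bsub>tensor K V W\<^esub> PT v w = PT (a \<odot>\<^bsub>V\<^esub> v) w"
      using module_hom_smult[OF bilinear_map_left[OF pure_tensor_bilinear w]] add v by simp
    finally show ?case
      using add v w module_hom_in[OF hom] by (auto intro!: assms(4) pure pure_tensor_closed)
  qed
  then show ?thesis using c by simp
qed

lemma tensor_hom_in_submodule:
  assumes Z: "vectorspace K Z" and f: "f \<in> module_hom K (tensor K V W) Z" and N: "submodule K N Z"
    and p: "\<And>v w. \<lbrakk>v \<in> carrier V; w \<in> carrier W\<rbrakk> \<Longrightarrow> f (PT v w) \<in> N"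
    and t: "t \<in> carrier (tensor K V W)"
  shows "f t \<in> N"
proof -
  interpret N: submodule K N Z by fact
  from t show ?thesis
    by (induction rule: tensor_induct)
      (auto simp: module_hom_zero[OF tensor_vectorspace Z f] module_hom_add[OF f] p)
qed

text \<open>The main device for later tensor identities: both sides are exhibited as linear maps of
  a tensor \<open>t\<close> and then compared on pure tensors, where they can be computed.\<close>

lemma tensor_hom_eqI:
  assumes Z: "vectorspace K Z"
    and f: "f \<in> module_hom K (tensor K V W) Z" and g: "g \<in> module_hom K (tensor K V W) Z"
    and eq: "\<And>v w. \<lbrakk>v \<in> carrier V; w \<in> carrier W\<rbrakk> \<Longrightarrow> f (PT v w) = g (PT v w)"
    and t: "t \<in> carrier (tensor K V W)"
  shows "f t = g t"
  using t
  by (induction rule: tensor_induct)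
    (auto simp: module_hom_zero[OF tensor_vectorspace Z f] module_hom_zero[OF tensor_vectorspace Z g]
      module_hom_add[OF f] module_hom_add[OF g] eq)

context
  fixes Z :: "('k, 'z, 'e) module_scheme" and f
  assumes Z: "vectorspace K Z" and f: "bilinear_map K V W Z f"
begin

interpretation Z: vectorspace K Z by (rule Z)

text \<open>Bilinearity of \<open>f\<close> makes the linear extension kill the four families of
  relations; together the two claims let it descend to the tensor product.\<close>

lemma tensor_lift_aux:
  shows "lin_ext K Z (\<lambda>(v, w). f v w) \<in> module_hom K FT Z" (is "?l \<in> _")
    and "n \<in> tensor_kernel K V W \<Longrightarrow> lin_ext K Z (\<lambda>(v, w). f v w) n = \<zero>\<^bsub>Z\<^esub>"
proof -
  show hom: "?l \<in> module_hom K FT Z"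
    by (rule V.lin_ext_hom[OF Z]) (auto simp: bilinear_map_in[OF f])
  note [simp del] = free_space_simps
  note [simp] = delta_in_FT module_hom_minus[OF F.vectorspace_axioms Z hom] module_hom_smult[OF hom]
    bilinear_map_in[OF f] module_hom_add[OF bilinear_map_left[OF f]]
    module_hom_add[OF bilinear_map_right[OF f]] module_hom_smult[OF bilinear_map_left[OF f]]
    module_hom_smult[OF bilinear_map_right[OF f]]
  have [simp]: "?l (delta K (v, w)) = f v w" if "v \<in> carrier V" "w \<in> carrier W" for v w
    by (subst V.lin_ext_delta[OF Z]) (use that in simp_all)
  assume n: "n \<in> tensor_kernel K V W"
  show "?l n = \<zero>\<^bsub>Z\<^esub>"
    by (rule tensor_kernel_least[OF Z hom _ n])
      (auto simp: tensor_relations_def Let_def Z.M.minus_minus_eq Z.M.minus_self)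
qed

lemma tensor_lift_hom: "tensor_lift K Z f \<in> module_hom K (tensor K V W) Z"
  unfolding tensor_lift_def[abs_def] tensor_def
  using the_elem_hom[OF F.vectorspace_axioms tensor_kernel_submodule Z tensor_lift_aux] .

lemma tensor_lift_pure: "\<lbrakk>v \<in> carrier V; w \<in> carrier W\<rbrakk> \<Longrightarrow> tensor_lift K Z f (PT v w) = f v w"
  unfolding tensor_lift_def pure_tensor_def
  by (subst the_elem_coset[OF F.vectorspace_axioms tensor_kernel_submodule Z tensor_lift_aux])
    (auto simp: delta_in_FT V.lin_ext_delta[OF Z] bilinear_map_in[OF f])

end

text \<open>Agreement is known on the carriers only, so \<open>f\<close> and \<open>g\<close> may be
  different functions of HOL and extensionality does not apply.\<close>

lemma tensor_lift_cong:
  assumes Z: "vectorspace K Z" and f: "bilinear_map K V W Z f" and g: "bilinear_map K V W Z g"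
    and eq: "\<And>v w. \<lbrakk>v \<in> carrier V; w \<in> carrier W\<rbrakk> \<Longrightarrow> f v w = g v w"
    and t: "t \<in> carrier (tensor K V W)"
  shows "tensor_lift K Z f t = tensor_lift K Z g t"
  by (rule tensor_hom_eqI[OF Z tensor_lift_hom[OF Z f] tensor_lift_hom[OF Z g] _ t])
    (simp add: tensor_lift_pure[OF Z f] tensor_lift_pure[OF Z g] eq)

lemma tensor_lift_plus:
  assumes Z: "vectorspace K Z" and f: "bilinear_map K V W Z f" and g: "bilinear_map K V W Z g"
    and t: "t \<in> carrier (tensor K V W)"
  shows "tensor_lift K Z (\<lambda>v w. f v w \<oplus>\<^bsub>Z\<^esub> g v w) t = tensor_lift K Z f t \<oplus>\<^bsub>Z\<^esub> tensor_lift K Z g t"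
  by (rule tensor_hom_eqI[OF Z tensor_lift_hom[OF Z bilinear_map_plus[OF Z f g]]
        module_hom_plus[OF Z tensor_lift_hom[OF Z f] tensor_lift_hom[OF Z g]] _ t])
    (simp add: tensor_lift_pure[OF Z f] tensor_lift_pure[OF Z g] tensor_lift_pure[OF Z bilinear_map_plus[OF Z f g]])

lemma tensor_lift_scale:
  assumes Z: "vectorspace K Z" and f: "bilinear_map K V W Z f" and a: "a \<in> carrier K"
    and t: "t \<in> carrier (tensor K V W)"
  shows "tensor_lift K Z (\<lambda>v w. a \<odot>\<^bsub>Z\<^esub> f v w) t = a \<odot>\<^bsub>Z\<^esub> tensor_lift K Z f t"
  by (rule tensor_hom_eqI[OF Z tensor_lift_hom[OF Z bilinear_map_scale[OF Z f a]]
        module_hom_scale[OF Z tensor_lift_hom[OF Z f] a] _ t])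
    (simp add: tensor_lift_pure[OF Z f] tensor_lift_pure[OF Z bilinear_map_scale[OF Z f a]])

lemmas pure_tensor_hom_left = bilinear_map_left[OF pure_tensor_bilinear]
  and pure_tensor_hom_right = bilinear_map_right[OF pure_tensor_bilinear]
lemmas pure_tensor_add_right = module_hom_add[OF pure_tensor_hom_right]
  and pure_tensor_smult_left = module_hom_smult[OF pure_tensor_hom_left]
  and pure_tensor_smult_right = module_hom_smult[OF pure_tensor_hom_right]
  and pure_tensor_zero_left = module_hom_zero[OF V tensor_vectorspace pure_tensor_hom_left]
  and pure_tensor_zero_right = module_hom_zero[OF W tensor_vectorspace pure_tensor_hom_right]
  and pure_tensor_minus_left = module_hom_minus[OF V tensor_vectorspace pure_tensor_hom_left]
  and pure_tensor_minus_right = module_hom_minus[OF W tensor_vectorspace pure_tensor_hom_right]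
  and pure_tensor_neg_right = module_hom_neg[OF W tensor_vectorspace pure_tensor_hom_right]

end

text \<open>Nested Sweedler sums are lifts of a bilinear map that depends on an outer variable. The
  outer lift can be evaluated once the inner one is known to depend linearly on that
  variable.\<close>

lemma tensor_lift_bilinear:
  assumes V: "vectorspace K V" and W: "vectorspace K W" and Z: "vectorspace K Z"
    and X: "\<And>v w. \<lbrakk>v \<in> carrier V; w \<in> carrier W\<rbrakk> \<Longrightarrow> (\<lambda>x. f x v w) \<in> module_hom K X Z"
    and f: "\<And>x. x \<in> carrier X \<Longrightarrow> bilinear_map K V W Z (f x)"
    and "vectorspace K X"
  shows "bilinear_map K X (tensor K V W) Z (\<lambda>x t. tensor_lift K Z (f x) t)"
proof (rule bilinear_mapI)
  fix x assume "x \<in> carrier X"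
  then show "tensor_lift K Z (f x) \<in> module_hom K (tensor K V W) Z"
    by (intro tensor_lift_hom[OF V W Z] f)
next
  fix t assume t: "t \<in> carrier (tensor K V W)"
  interpret X: vectorspace K X by fact
  interpret Z: vectorspace K Z by fact
  show "(\<lambda>x. tensor_lift K Z (f x) t) \<in> module_hom K X Z"
  proof (rule module_homI)
    fix x assume x: "x \<in> carrier X"
    show "tensor_lift K Z (f x) t \<in> carrier Z"
      by (rule module_hom_in[OF tensor_lift_hom[OF V W Z f[OF x]] t])
    {
      fix y assume y: "y \<in> carrier X"
      have "tensor_lift K Z (f (x \<oplus>\<^bsub>X\<^esub> y)) t = tensor_lift K Z (\<lambda>v w. f x v w \<oplus>\<^bsub>Z\<^esub> f y v w) t"
        by (rule tensor_lift_cong[OF V W Z f bilinear_map_plus[OF Z f f] _ t])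
          (use x y in \<open>auto simp: module_hom_add[OF X]\<close>)
      then show "tensor_lift K Z (f (x \<oplus>\<^bsub>X\<^esub> y)) t = tensor_lift K Z (f x) t \<oplus>\<^bsub>Z\<^esub> tensor_lift K Z (f y) t"
        using tensor_lift_plus[OF V W Z f[OF x] f[OF y] t] by simp
    }
    fix a assume a: "a \<in> carrier K"
    have "tensor_lift K Z (f (a \<odot>\<^bsub>X\<^esub> x)) t = tensor_lift K Z (\<lambda>v w. a \<odot>\<^bsub>Z\<^esub> f x v w) t"
      by (rule tensor_lift_cong[OF V W Z f bilinear_map_scale[OF Z f] _ t])
        (use x a in \<open>auto simp: module_hom_smult[OF X]\<close>)
    then show "tensor_lift K Z (f (a \<odot>\<^bsub>X\<^esub> x)) t = a \<odot>\<^bsub>Z\<^esub> tensor_lift K Z (f x) t"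
      using tensor_lift_scale[OF V W Z f[OF x] a t] by simp
  qed
qed

context
  fixes K :: "('k, 'r) ring_scheme" and V :: "('k, 'v, 'c) module_scheme"
    and W :: "('k, 'w, 'd) module_scheme" and X :: "('k, 'x, 'e) module_scheme"
    and Y :: "('k, 'y, 'f) module_scheme" and f g
  assumes V: "vectorspace K V" and W: "vectorspace K W"
    and X: "vectorspace K X" and Y: "vectorspace K Y"
    and f: "f \<in> module_hom K X V" and g: "g \<in> module_hom K Y W"
begin

lemma tensor_map_hom: "tensor_map K V W f g \<in> module_hom K (tensor K X Y) (tensor K V W)"
  unfolding tensor_map_def
  by (rule tensor_lift_hom[OF X Y tensor_vectorspace[OF V W] 
        bilinear_map_comp[OF pure_tensor_bilinear[OF V W] f g]])

lemma tensor_map_pure: "\<lbrakk>x \<in> carrier X; y \<in> carrier Y\<rbrakk> \<Longrightarrow>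
    tensor_map K V W f g (pure_tensor K X Y x y) = pure_tensor K V W (f x) (g y)"
  unfolding tensor_map_def
  by (rule tensor_lift_pure[OF X Y tensor_vectorspace[OF V W] 
        bilinear_map_comp[OF pure_tensor_bilinear[OF V W] f g]])

end

section \<open>Linear functionals and slices\<close>

lemma ground_algebra_simps [simp]:
  "carrier (ground_algebra K) = carrier K" "\<zero>\<^bsub>ground_algebra K\<^esub> = \<zero>\<^bsub>K\<^esub>"
  "a \<oplus>\<^bsub>ground_algebra K\<^esub> b = a \<oplus>\<^bsub>K\<^esub> b" "a \<odot>\<^bsub>ground_algebra K\<^esub> b = a \<otimes>\<^bsub>K\<^esub> b"
  "a \<otimes>\<^bsub>ground_algebra K\<^esub> b = a \<otimes>\<^bsub>K\<^esub> b" "\<one>\<^bsub>ground_algebra K\<^esub> = \<one>\<^bsub>K\<^esub>"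
  by (simp_all add: ground_algebra_def)

lemma (in field) ground_algebra_vectorspace: "vectorspace R (ground_algebra R)"
proof -
  have "abelian_group (ground_algebra R)"
    by (rule abelian_groupI) (auto simp: a_ac intro: l_neg)
  then have "module R (ground_algebra R)"
    by (intro moduleI) (auto simp: is_cring l_distr r_distr m_assoc)
  then show ?thesis by (simp add: vectorspace_def field_axioms)
qed

text \<open>Zorn's lemma yields a subspace N maximal among those avoiding \<open>h\<close>.
  Maximality makes N a complement of the line spanned by \<open>h\<close>, and \<phi> is the
  coordinate along \<open>h\<close>.\<close>

lemma (in vectorspace) exists_functional:
  assumes h: "h \<in> carrier V" "h \<noteq> \<zero>\<^bsub>V\<^esub>"
  obtains \<phi> where "\<phi> \<in> module_hom K V (ground_algebra K)" "\<phi> h = \<one>\<^bsub>K\<^esub>"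
proof -
  let ?S = "{N. submodule K N V \<and> h \<notin> N}"
  have m: "module K V" by (rule module_axioms)
  have "submodule K {\<zero>\<^bsub>V\<^esub>} V" by (simp add: submodule_def m)
  then have ne: "?S \<noteq> {}" using h by auto
  have "\<exists>M\<in>?S. \<forall>X\<in>?S. M \<subseteq> X \<longrightarrow> X = M"
  proof (rule subset_Zorn_nonempty[OF ne])
    fix C assume C: "C \<noteq> {}" "subset.chain ?S C"
    have "submodule K (\<Union>C) V"
    proof (rule nested_union_vs[where I = C and N = "\<lambda>i. i"])
      show "\<And>i. i \<in> C \<Longrightarrow> submodule K i V" using C by (auto simp: subset_chain_def)
      show "\<exists>k. k \<in> C \<and> i \<subseteq> k \<and> j \<subseteq> k" if "i \<in> C" "j \<in> C" for i j
        using that C by (metis subset_chain_def order_refl)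
    qed (use C in auto)
    then show "\<Union>C \<in> ?S" using C by (auto simp: subset_chain_def)
  qed
  then obtain N where N: "submodule K N V" "h \<notin> N"
    and max: "\<And>X. submodule K X V \<Longrightarrow> h \<notin> X \<Longrightarrow> N \<subseteq> X \<Longrightarrow> X = N" by blast
  interpret N: submodule K N V by (rule N)
  have m0: "\<ominus>\<^bsub>V\<^esub> \<zero>\<^bsub>V\<^esub> = \<zero>\<^bsub>V\<^esub>" using M.r_neg[OF M.zero_closed] by simp
  have NV: "n \<in> carrier V" if "n \<in> N" for n using that N.subset by auto
  have Nneg: "\<ominus>\<^bsub>V\<^esub> n \<in> N" if "n \<in> N" for n 
    by (rule submodule_neg[OF vectorspace_axioms N(1) that])
  have ex: "\<exists>a\<in>carrier K. w \<ominus>\<^bsub>V\<^esub> a \<odot>\<^bsub>V\<^esub> h \<in> N" if w: "w \<in> carrier V" for w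
  proof (rule ccontr)
    assume no: "\<not> ?thesis"
    \<comment> \<open>\<open>?X\<close> is N + K w. It is strictly larger than N, so maximality puts
      \<open>h\<close> into it: h = n + b w. As \<open>h\<close> is not in N, b is invertible, and
      solving for w expresses it modulo N as a multiple of \<open>h\<close>.\<close>
    let ?X = "{n \<oplus>\<^bsub>V\<^esub> b \<odot>\<^bsub>V\<^esub> w | n b. n \<in> N \<and> b \<in> carrier K}"
    have "submodule K ?X V"
    proof
      show "?X \<subseteq> carrier V" using w NV by auto
    next
      fix x y assume "x \<in> ?X" "y \<in> ?X"
      then obtain n b n' b' where x: "x = n \<oplus>\<^bsub>V\<^esub> b \<odot>\<^bsub>V\<^esub> w" "n \<in> N" "b \<in> carrier K"
        and y: "y = n' \<oplus>\<^bsub>V\<^esub> b' \<odot>\<^bsub>V\<^esub> w" "n' \<in> N" "b' \<in> carrier K" by auto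
      then have "x \<oplus>\<^bsub>V\<^esub> y = (n \<oplus>\<^bsub>V\<^esub> n') \<oplus>\<^bsub>V\<^esub> (b \<oplus>\<^bsub>K\<^esub> b') \<odot>\<^bsub>V\<^esub> w"
        using w NV by (simp add: smult_l_distr M.a_ac)
      then show "x \<oplus>\<^bsub>V\<^esub> y \<in> ?X" using x y by blast
    next
      have "\<zero>\<^bsub>V\<^esub> = \<zero>\<^bsub>V\<^esub> \<oplus>\<^bsub>V\<^esub> \<zero>\<^bsub>K\<^esub> \<odot>\<^bsub>V\<^esub> w" using w by simp
      then show "\<zero>\<^bsub>V\<^esub> \<in> ?X" using N.zero_closed R.zero_closed by blast
    next
      fix c x assume c: "c \<in> carrier K" and "x \<in> ?X"
      then obtain n b where x: "x = n \<oplus>\<^bsub>V\<^esub> b \<odot>\<^bsub>V\<^esub> w" "n \<in> N" "b \<in> carrier K" by auto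
      then have "c \<odot>\<^bsub>V\<^esub> x = c \<odot>\<^bsub>V\<^esub> n \<oplus>\<^bsub>V\<^esub> (c \<otimes>\<^bsub>K\<^esub> b) \<odot>\<^bsub>V\<^esub> w"
        using c w NV by (simp add: smult_r_distr smult_assoc1)
      then show "c \<odot>\<^bsub>V\<^esub> x \<in> ?X" using x c by blast
    qed
    moreover have "N \<subseteq> ?X"
    proof
      fix n assume n: "n \<in> N"
      then have "n = n \<oplus>\<^bsub>V\<^esub> \<zero>\<^bsub>K\<^esub> \<odot>\<^bsub>V\<^esub> w" using w NV by simp
      then show "n \<in> ?X" using n R.zero_closed by blast
    qed
    moreover have "w \<in> ?X"
    proof -
      have "w = \<zero>\<^bsub>V\<^esub> \<oplus>\<^bsub>V\<^esub> \<one>\<^bsub>K\<^esub> \<odot>\<^bsub>V\<^esub> w" using w by simp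
      then show ?thesis using N.zero_closed R.one_closed by blast
    qed
    moreover have "w \<notin> N"
    proof
      assume "w \<in> N"
      then have "w \<ominus>\<^bsub>V\<^esub> \<zero>\<^bsub>K\<^esub> \<odot>\<^bsub>V\<^esub> h \<in> N" using h w by (simp add: M.minus_eq m0)
      then show False using no R.zero_closed by blast
    qed
    ultimately have "h \<in> ?X" using max by blast
    then obtain n b where x: "h = n \<oplus>\<^bsub>V\<^esub> b \<odot>\<^bsub>V\<^esub> w" "n \<in> N" "b \<in> carrier K" by auto
    have "b \<noteq> \<zero>\<^bsub>K\<^esub>" using x h w N(2) NV by auto
    then have b: "b \<in> Units K" using x field_Units by auto
    let ?c = "inv\<^bsub>K\<^esub> b"
    have c: "?c \<in> carrier K" "?c \<otimes>\<^bsub>K\<^esub> b = \<one>\<^bsub>K\<^esub>" using b by auto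
    have "?c \<odot>\<^bsub>V\<^esub> h = ?c \<odot>\<^bsub>V\<^esub> n \<oplus>\<^bsub>V\<^esub> w"
      using x w c NV by (simp add: smult_r_distr smult_assoc1[symmetric])
    then have "w \<ominus>\<^bsub>V\<^esub> ?c \<odot>\<^bsub>V\<^esub> h = \<ominus>\<^bsub>V\<^esub> (?c \<odot>\<^bsub>V\<^esub> n)"
      using x(2) w c NV by (simp add: M.minus_eq M.minus_add M.a_ac M.r_neg M.r_neg1 M.r_neg2)
    also have "\<dots> \<in> N" using x c by (intro Nneg) simp
    finally show False using no c by blast
  qed
  have uniq: "a = b" if ab: "a \<in> carrier K" "b \<in> carrier K" and w: "w \<in> carrier V"
     and N1: "w \<ominus>\<^bsub>V\<^esub> a \<odot>\<^bsub>V\<^esub> h \<in> N" and N2: "w \<ominus>\<^bsub>V\<^esub> b \<odot>\<^bsub>V\<^esub> h \<in> N" for a b w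
  proof (rule ccontr)
    \<comment> \<open>Subtracting the two memberships gives (b - a) h in N, and inverting b - a
      would put \<open>h\<close> itself into N.\<close>
    assume "a \<noteq> b"
    then have "b \<ominus>\<^bsub>K\<^esub> a \<in> Units K" using ab field_Units by auto
    then have c: "inv\<^bsub>K\<^esub> (b \<ominus>\<^bsub>K\<^esub> a) \<in> carrier K" "inv\<^bsub>K\<^esub> (b \<ominus>\<^bsub>K\<^esub> a) \<otimes>\<^bsub>K\<^esub> (b \<ominus>\<^bsub>K\<^esub> a) = \<one>\<^bsub>K\<^esub>"
      by auto
    have "(w \<ominus>\<^bsub>V\<^esub> a \<odot>\<^bsub>V\<^esub> h) \<ominus>\<^bsub>V\<^esub> (w \<ominus>\<^bsub>V\<^esub> b \<odot>\<^bsub>V\<^esub> h) \<in> N"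
      by (rule submodule_minus[OF vectorspace_axioms N(1) N1 N2])
    also have "(w \<ominus>\<^bsub>V\<^esub> a \<odot>\<^bsub>V\<^esub> h) \<ominus>\<^bsub>V\<^esub> (w \<ominus>\<^bsub>V\<^esub> b \<odot>\<^bsub>V\<^esub> h) = (b \<ominus>\<^bsub>K\<^esub> a) \<odot>\<^bsub>V\<^esub> h"
      using ab w h by (simp add: M.minus_eq R.minus_eq smult_l_distr smult_l_minus M.minus_add
          M.a_ac M.r_neg M.r_neg1 M.r_neg2)
    finally have "inv\<^bsub>K\<^esub> (b \<ominus>\<^bsub>K\<^esub> a) \<odot>\<^bsub>V\<^esub> ((b \<ominus>\<^bsub>K\<^esub> a) \<odot>\<^bsub>V\<^esub> h) \<in> N" using c by simp
    then show False using c ab h N(2) by (simp add: smult_assoc1[symmetric])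
  qed
  define \<phi> where "\<phi> w = (THE a. a \<in> carrier K \<and> w \<ominus>\<^bsub>V\<^esub> a \<odot>\<^bsub>V\<^esub> h \<in> N)" for w
  have eqI: "\<phi> w = a" if "a \<in> carrier K" "w \<in> carrier V" "w \<ominus>\<^bsub>V\<^esub> a \<odot>\<^bsub>V\<^esub> h \<in> N" for w a
    unfolding \<phi>_def using that uniq by (intro the_equality) auto
  have \<phi>: "\<phi> w \<in> carrier K" "w \<ominus>\<^bsub>V\<^esub> \<phi> w \<odot>\<^bsub>V\<^esub> h \<in> N" if w: "w \<in> carrier V" for w
    using ex[OF w] eqI[OF _ w] by metis+
  have "\<phi> \<in> module_hom K V (ground_algebra K)"
  proof (rule module_homI; simp)
    fix u assume u: "u \<in> carrier V"
    then show "\<phi> u \<in> carrier K" by (rule \<phi>)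
    {
      fix v assume v: "v \<in> carrier V"
      have "(u \<ominus>\<^bsub>V\<^esub> \<phi> u \<odot>\<^bsub>V\<^esub> h) \<oplus>\<^bsub>V\<^esub> (v \<ominus>\<^bsub>V\<^esub> \<phi> v \<odot>\<^bsub>V\<^esub> h) \<in> N" using \<phi> u v by simp
      also have "(u \<ominus>\<^bsub>V\<^esub> \<phi> u \<odot>\<^bsub>V\<^esub> h) \<oplus>\<^bsub>V\<^esub> (v \<ominus>\<^bsub>V\<^esub> \<phi> v \<odot>\<^bsub>V\<^esub> h) =
          (u \<oplus>\<^bsub>V\<^esub> v) \<ominus>\<^bsub>V\<^esub> (\<phi> u \<oplus>\<^bsub>K\<^esub> \<phi> v) \<odot>\<^bsub>V\<^esub> h"
        using \<phi> u v h by (simp add: M.minus_eq smult_l_distr M.minus_add M.a_ac)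
      finally show "\<phi> (u \<oplus>\<^bsub>V\<^esub> v) = \<phi> u \<oplus>\<^bsub>K\<^esub> \<phi> v" using \<phi> u v by (intro eqI) auto
    }
    fix a assume a: "a \<in> carrier K"
    have "a \<odot>\<^bsub>V\<^esub> (u \<ominus>\<^bsub>V\<^esub> \<phi> u \<odot>\<^bsub>V\<^esub> h) \<in> N" using \<phi> u a by simp
    also have "a \<odot>\<^bsub>V\<^esub> (u \<ominus>\<^bsub>V\<^esub> \<phi> u \<odot>\<^bsub>V\<^esub> h) = a \<odot>\<^bsub>V\<^esub> u \<ominus>\<^bsub>V\<^esub> (a \<otimes>\<^bsub>K\<^esub> \<phi> u) \<odot>\<^bsub>V\<^esub> h"
      using \<phi> u a h by (simp add: M.minus_eq smult_r_distr smult_r_minus smult_assoc1)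
    finally show "\<phi> (a \<odot>\<^bsub>V\<^esub> u) = a \<otimes>\<^bsub>K\<^esub> \<phi> u" using \<phi> u a by (intro eqI) auto
  qed
  moreover have "\<phi> h = \<one>\<^bsub>K\<^esub>" using h by (intro eqI) (auto simp: M.minus_eq M.r_neg)
  ultimately show ?thesis using that by blast
qed

text \<open>
  Applying to the right factor a finite rank projection that fixes the finitely many vectors of \<open>W\<close>
  occurring in a tensor expresses the tensor through its slices.
\<close>

inductive finite_rank :: "('k, 'r) ring_scheme \<Rightarrow> ('k, 'w, 'd) module_scheme \<Rightarrow> ('w \<Rightarrow> 'w) \<Rightarrow> bool"
  for K W where
  finite_rank_zero: "finite_rank K W (\<lambda>_. \<zero>\<^bsub>W\<^esub>)"
| finite_rank_add: "\<lbrakk>finite_rank K W p; \<phi> \<in> module_hom K W (ground_algebra K); h \<in> carrier W\<rbrakk> \<Longrightarrow>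
    finite_rank K W (\<lambda>w. \<phi> w \<odot>\<^bsub>W\<^esub> h \<oplus>\<^bsub>W\<^esub> p w)"

lemma functional_smult_hom:
  assumes V: "vectorspace K V" and phi: "\<phi> \<in> module_hom K W (ground_algebra K)" and h: "h \<in> carrier V"
  shows "(\<lambda>w. \<phi> w \<odot>\<^bsub>V\<^esub> h) \<in> module_hom K W V"
proof -
  interpret V: vectorspace K V by fact
  show ?thesis using phi h
    by (auto simp: module_hom_def Pi_def V.smult_l_distr V.smult_assoc1)
qed

context vectorspace
begin

lemma finite_rank_hom: "finite_rank K V p \<Longrightarrow> p \<in> module_hom K V V"
  by (induction rule: finite_rank.induct)
    (auto intro!: module_hom_const_zero module_hom_plus functional_smult_hom vectorspace_axioms)

text \<open>If p fixes S but moves \<open>h\<close>, the rank one correction w |-> \<psi>(w - p w)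
  (h - p h) with \<psi>(h - p h) = 1 is added: it vanishes on S and supplies the missing h - p h at
  \<open>h\<close>.\<close>

lemma finite_rank_projection:
  assumes "finite S" "S \<subseteq> carrier V"
  shows "\<exists>p. finite_rank K V p \<and> (\<forall>h\<in>S. p h = h)"
  using assms
proof (induction rule: finite_induct)
  case empty
  then show ?case using finite_rank_zero by blast
next
  case (insert h S)
  then obtain p where p: "finite_rank K V p" "\<And>s. s \<in> S \<Longrightarrow> p s = s" by auto
  have ph: "p \<in> module_hom K V V" by (rule finite_rank_hom[OF p(1)])
  have h: "h \<in> carrier V" "p h \<in> carrier V" using insert.prems module_hom_in[OF ph] by auto
  let ?h = "h \<ominus>\<^bsub>V\<^esub> p h"
  show ?case
  proof (cases "?h = \<zero>\<^bsub>V\<^esub>")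
    case True
    then have "p h = h" using h by simp
    then show ?thesis using p by blast
  next
    case False
    then obtain \<psi> where psi: "\<psi> \<in> module_hom K V (ground_algebra K)" "\<psi> ?h = \<one>\<^bsub>K\<^esub>"
      using exists_functional[of ?h] h by auto
    let ?\<phi> = "\<lambda>w. \<psi> (w \<oplus>\<^bsub>V\<^esub> (\<ominus>\<^bsub>K\<^esub> \<one>\<^bsub>K\<^esub>) \<odot>\<^bsub>V\<^esub> p w)"
    have phi: "?\<phi> \<in> module_hom K V (ground_algebra K)"
      by (rule module_hom_comp[OF module_hom_plus[OF vectorspace_axioms module_hom_id
            module_hom_scale[OF vectorspace_axioms ph]] psi(1)]) simp
    have e: "?\<phi> w = \<psi> (w \<ominus>\<^bsub>V\<^esub> p w)" if "w \<in> carrier V" for w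
      using that module_hom_in[OF ph] by (simp add: smult_l_minus M.minus_eq)
    have fr: "finite_rank K V (\<lambda>w. ?\<phi> w \<odot>\<^bsub>V\<^esub> ?h \<oplus>\<^bsub>V\<^esub> p w)"
      using h by (intro finite_rank_add p(1) phi) simp
    have "?\<phi> s \<odot>\<^bsub>V\<^esub> ?h \<oplus>\<^bsub>V\<^esub> p s = s" if s: "s \<in> S" for s
    proof -
      have sV: "s \<in> carrier V" using s insert.prems by auto
      then have "?\<phi> s = \<psi> \<zero>\<^bsub>V\<^esub>" unfolding e[OF sV] using p(2)[OF s] by (simp add: M.minus_eq M.r_neg)
      then have "?\<phi> s = \<zero>\<^bsub>K\<^esub>"
        using module_hom_zero[OF vectorspace_axioms ground_algebra_vectorspace psi(1)] by simp
      then show ?thesis using p(2)[OF s] sV h by simp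
    qed
    moreover have "?\<phi> h \<odot>\<^bsub>V\<^esub> ?h \<oplus>\<^bsub>V\<^esub> p h = h"
      unfolding e[OF h(1)] psi(2) using h by (simp add: M.minus_eq M.a_assoc M.l_neg)
    ultimately show ?thesis using fr by (intro exI[of _ "\<lambda>w. ?\<phi> w \<odot>\<^bsub>V\<^esub> ?h \<oplus>\<^bsub>V\<^esub> p w"]) auto
  qed
qed

end

text \<open>The map id \<otimes> \<phi> followed by the identification of V \<otimes> K with
  V.\<close>

definition slice ::
  "('k, 'r) ring_scheme \<Rightarrow> ('k, 'v, 'c) module_scheme \<Rightarrow> ('w \<Rightarrow> 'k) \<Rightarrow> ('v \<times> 'w \<Rightarrow> 'k) set \<Rightarrow> 'v"
  where "slice K V \<phi> = tensor_lift K V (\<lambda>v w. \<phi> w \<odot>\<^bsub>V\<^esub> v)"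

text \<open>An image, since A \<otimes> B is not a subset of V \<otimes> W in this encoding. For
  \<open>B = carrier W\<close> it is the set that occurs in \<open>subcomodule\<close>.\<close>

definition tensor_sub ::
  "('k, 'r) ring_scheme \<Rightarrow> ('k, 'v, 'c) module_scheme \<Rightarrow> ('k, 'w, 'd) module_scheme \<Rightarrow>
    'v set \<Rightarrow> 'w set \<Rightarrow> ('v \<times> 'w \<Rightarrow> 'k) set set"
  where "tensor_sub K V W A B =
    tensor_map K V W (\<lambda>v. v) (\<lambda>w. w) ` carrier (tensor K (V\<lparr>carrier := A\<rparr>) (W\<lparr>carrier := B\<rparr>))"

context
  fixes K :: "('k, 'r) ring_scheme" and V :: "('k, 'v, 'c) module_scheme"
    and W :: "('k, 'w, 'd) module_scheme"
  assumes V: "vectorspace K V" and W: "vectorspace K W"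
begin

interpretation V: vectorspace K V by (rule V)
interpretation W: vectorspace K W by (rule W)
interpretation T: vectorspace K "tensor K V W" by (rule tensor_vectorspace[OF V W])

lemma slice_bilinear:
  assumes "\<phi> \<in> module_hom K W (ground_algebra K)"
  shows "bilinear_map K V W V (\<lambda>v w. \<phi> w \<odot>\<^bsub>V\<^esub> v)"
  using assms functional_smult_hom[OF V assms]
  by (auto intro!: bilinear_mapI module_homI
      simp: V.smult_r_distr V.smult_assoc1[symmetric] V.R.m_comm module_hom_def Pi_def)

lemma slice_hom:
  "\<phi> \<in> module_hom K W (ground_algebra K) \<Longrightarrow> slice K V \<phi> \<in> module_hom K (tensor K V W) V"
  unfolding slice_def by (intro tensor_lift_hom[OF V W V] slice_bilinear)

lemma slice_pure:
  "\<lbrakk>\<phi> \<in> module_hom K W (ground_algebra K); v \<in> carrier V; w \<in> carrier W\<rbrakk> \<Longrightarrow>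
    slice K V \<phi> (pure_tensor K V W v w) = \<phi> w \<odot>\<^bsub>V\<^esub> v"
  unfolding slice_def by (intro tensor_lift_pure[OF V W V] slice_bilinear)

context
  fixes A B
  assumes A: "submodule K A V" and B: "submodule K B W"
begin

interpretation A: submodule K A V by (rule A)
interpretation B: submodule K B W by (rule B)

lemmas VA = submodule_vectorspace[OF V A] and WB = submodule_vectorspace[OF W B]

lemmas tensor_incl_hom = 
  tensor_map_hom[OF V W VA WB submodule_incl_hom[OF A] submodule_incl_hom[OF B]]
lemmas tensor_incl_pure = 
  tensor_map_pure[OF V W VA WB submodule_incl_hom[OF A] submodule_incl_hom[OF B], simplified]

lemma tensor_sub_submodule: "submodule K (tensor_sub K V W A B) (tensor K V W)"
proof -
  note mh = mod_hom_of[OF tensor_vectorspace[OF VA WB] tensor_vectorspace[OF V W] tensor_incl_hom]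
  show ?thesis
    using mod_hom.im_is_submodule[OF mh] unfolding mod_hom.im_def[OF mh] tensor_sub_def .
qed

lemma pure_in_tensor_sub: "\<lbrakk>a \<in> A; b \<in> B\<rbrakk> \<Longrightarrow> pure_tensor K V W a b \<in> tensor_sub K V W A B"
  unfolding tensor_sub_def
  by (rule image_eqI[where x = "pure_tensor K (V\<lparr>carrier := A\<rparr>) (W\<lparr>carrier := B\<rparr>) a b"])
    (simp_all add: tensor_incl_pure pure_tensor_closed[OF VA WB])

lemma tensor_sub_hom_in:
  assumes Z: "vectorspace K Z" and f: "f \<in> module_hom K (tensor K V W) Z" and N: "submodule K N Z"
    and p: "\<And>v w. \<lbrakk>v \<in> A; w \<in> B\<rbrakk> \<Longrightarrow> f (pure_tensor K V W v w) \<in> N"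
    and t: "t \<in> tensor_sub K V W A B"
  shows "f t \<in> N"
proof -
  from t obtain s where s: "s \<in> carrier (tensor K (V\<lparr>carrier := A\<rparr>) (W\<lparr>carrier := B\<rparr>))"
    and t: "t = tensor_map K V W (\<lambda>v. v) (\<lambda>w. w) s" by (auto simp: tensor_sub_def)
  show ?thesis unfolding t
    by (rule tensor_hom_in_submodule[OF VA WB Z module_hom_comp[OF tensor_incl_hom f] N _ s])
      (simp add: tensor_incl_pure p)
qed

end

lemma tensor_sub_mono:
  assumes "submodule K A V" "submodule K B W" "submodule K A' V" "submodule K B' W"
    and "A \<subseteq> A'" "B \<subseteq> B'"
  shows "tensor_sub K V W A B \<subseteq> tensor_sub K V W A' B'"
  using tensor_sub_hom_in[OF assms(1,2) tensor_vectorspace[OF V W] module_hom_id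
      tensor_sub_submodule[OF assms(3,4)]] pure_in_tensor_sub[OF assms(3,4)] assms(5,6)
  by blast

text \<open>\<open>S\<close> collects the right factors of some expression of \<open>t\<close> by
  pure tensors. Speaking of the maps that fix \<open>S\<close> replaces the choice of a finite sum
  representing \<open>t\<close>.\<close>

lemma tensor_id_finite:
  assumes "t \<in> carrier (tensor K V W)"
  shows "\<exists>S. finite S \<and> S \<subseteq> carrier W \<and>
    (\<forall>p\<in>module_hom K W W. (\<forall>h\<in>S. p h = h) \<longrightarrow> tensor_map K V W (\<lambda>v. v) p t = t)"
  using assms
proof (induction rule: tensor_induct[OF V W, consumes 1, case_names zero pure add])
  case zero
  show ?case
    using module_hom_zero[OF tensor_vectorspace[OF V W] tensor_vectorspace[OF V W] 
        tensor_map_hom[OF V W V W module_hom_id]] by (intro exI[of _ "{}"]) auto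
next
  case (pure v w)
  then show ?case using tensor_map_pure[OF V W V W module_hom_id] by (intro exI[of _ "{w}"]) auto
next
  case (add s t)
  then obtain S S' where S: "finite S" "S \<subseteq> carrier W"
    "\<And>p. p\<in>module_hom K W W \<Longrightarrow> (\<forall>h\<in>S. p h = h) \<Longrightarrow> tensor_map K V W (\<lambda>v. v) p s = s"
    and S': "finite S'" "S' \<subseteq> carrier W"
    "\<And>p. p\<in>module_hom K W W \<Longrightarrow> (\<forall>h\<in>S'. p h = h) \<Longrightarrow> tensor_map K V W (\<lambda>v. v) p t = t"
    by metis
  then show ?case 
    using module_hom_add[OF tensor_map_hom[OF V W V W module_hom_id] add.hyps]
    by (intro exI[of _ "S \<union> S'"]) auto
qed

text \<open>For a rank one map w |-> \<phi>(w) h, tensoring with the identity turns \<open>t\<close>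
  into (slice of \<open>t\<close> by \<phi>) \<otimes> h, which lies in A \<otimes> W. Maps of
  finite rank are sums of these.\<close>

lemma tensor_map_finite_rank:
  assumes A: "submodule K A V" and t: "t \<in> carrier (tensor K V W)"
    and sl: "\<And>\<phi>. \<phi> \<in> module_hom K W (ground_algebra K) \<Longrightarrow> slice K V \<phi> t \<in> A"
    and p: "finite_rank K W p"
  shows "tensor_map K V W (\<lambda>v. v) p t \<in> tensor_sub K V W A (carrier W)"
  using p
proof induction
  note W' = carrier_submodule[OF W]
  note TV = tensor_vectorspace[OF V W]
  interpret TS: submodule K "tensor_sub K V W A (carrier W)" "tensor K V W"
    by (rule tensor_sub_submodule[OF A W'])
  {
    case finite_rank_zero
    have "tensor_map K V W (\<lambda>v. v) (\<lambda>_. \<zero>\<^bsub>W\<^esub>) t = \<zero>\<^bsub>tensor K V W\<^esub>"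
      by (rule tensor_hom_eqI[OF V W TV tensor_map_hom[OF V W V W module_hom_id module_hom_const_zero[OF W]]
          module_hom_const_zero[OF TV] _ t])
        (simp add: tensor_map_pure[OF V W V W module_hom_id module_hom_const_zero[OF W]]
            pure_tensor_zero_right[OF V W])
    then show ?case by simp
  next
    case (finite_rank_add p \<phi> h)
    note ph = W.finite_rank_hom[OF finite_rank_add(1)]
    note fh = W.finite_rank_hom[OF finite_rank.finite_rank_add[OF finite_rank_add(1-3)]]
    note sh = slice_hom[OF finite_rank_add(2)]
    have "tensor_map K V W (\<lambda>v. v) (\<lambda>w. \<phi> w \<odot>\<^bsub>W\<^esub> h \<oplus>\<^bsub>W\<^esub> p w) t =
      pure_tensor K V W (slice K V \<phi> t) h \<oplus>\<^bsub>tensor K V W\<^esub> tensor_map K V W (\<lambda>v. v) p t"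
    proof (rule tensor_hom_eqI[OF V W TV tensor_map_hom[OF V W V W module_hom_id fh]
          module_hom_plus[OF TV module_hom_comp[OF sh pure_tensor_hom_left[OF V W finite_rank_add(3)]]
            tensor_map_hom[OF V W V W module_hom_id ph]] _ t])
      fix v w assume v: "v \<in> carrier V" and w: "w \<in> carrier W"
      have c: "\<phi> w \<in> carrier K" "p w \<in> carrier W"
        using module_hom_in[OF finite_rank_add(2) w] module_hom_in[OF ph w] by auto
      show "tensor_map K V W (\<lambda>v. v) (\<lambda>w. \<phi> w \<odot>\<^bsub>W\<^esub> h \<oplus>\<^bsub>W\<^esub> p w) (pure_tensor K V W v w) =
        pure_tensor K V W (slice K V \<phi> (pure_tensor K V W v w)) h \<oplus>\<^bsub>tensor K V W\<^esub> 
        tensor_map K V W (\<lambda>v. v) p (pure_tensor K V W v w)"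
        using v w c finite_rank_add(3)
        by (simp add: tensor_map_pure[OF V W V W module_hom_id fh] tensor_map_pure[OF V W V W module_hom_id ph]
          slice_pure[OF finite_rank_add(2)] pure_tensor_add_right[OF V W] pure_tensor_smult_right[OF V W]
          pure_tensor_smult_left[OF V W])
    qed
    then show ?case
      using finite_rank_add sl pure_in_tensor_sub[OF A W'] by (auto intro!: TS.m_closed)
  }
qed

text \<open>With p of finite rank fixing the right factors that occur in \<open>t\<close>, the map
  id \<otimes> p sends \<open>t\<close> both to itself and into A \<otimes> W.\<close>

theorem tensor_sub_sliceI:
  assumes A: "submodule K A V" and t: "t \<in> carrier (tensor K V W)"
    and sl: "\<And>\<phi>. \<phi> \<in> module_hom K W (ground_algebra K) \<Longrightarrow> slice K V \<phi> t \<in> A"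
  shows "t \<in> tensor_sub K V W A (carrier W)"
proof -
  obtain S where S: "finite S" "S \<subseteq> carrier W"
    "\<And>p. p\<in>module_hom K W W \<Longrightarrow> (\<forall>h\<in>S. p h = h) \<Longrightarrow> tensor_map K V W (\<lambda>v. v) p t = t"
    using tensor_id_finite[OF t] by metis
  obtain p where p: "finite_rank K W p" "\<forall>h\<in>S. p h = h"
    using W.finite_rank_projection[OF S(1,2)] by auto
  show ?thesis
    using tensor_map_finite_rank[OF A t sl p(1)] S(3)[OF W.finite_rank_hom[OF p(1)] p(2)] by simp
qed

end

text \<open>The inclusion commutes with slicing, so an element of its kernel has only zero slices.
  The slice criterion for the zero subspace then places it in 0 \<otimes> W, which is 0.\<close>

lemma tensor_incl_inj:
  assumes V: "vectorspace K V" and W: "vectorspace K W" and A: "submodule K A V"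
  shows "inj_on (tensor_map K V W (\<lambda>v. v) (\<lambda>w. w)) (carrier (tensor K (V\<lparr>carrier := A\<rparr>) W))"
    (is "inj_on ?i (carrier ?TA)")
proof (rule inj_onI)
  interpret V: vectorspace K V by (rule V)
  interpret W: vectorspace K W by (rule W)
  interpret T: vectorspace K "tensor K V W" by (rule tensor_vectorspace[OF V W])
  note VA = submodule_vectorspace[OF V A]
  note TA = tensor_vectorspace[OF VA W]
  note ih = tensor_map_hom[OF V W VA W submodule_incl_hom[OF A] module_hom_id]
  note ip = tensor_map_pure[OF V W VA W submodule_incl_hom[OF A] module_hom_id, simplified]
  interpret A: submodule K A V by (rule A)
  interpret TA: vectorspace K ?TA by (rule TA)
  fix s t assume s: "s \<in> carrier ?TA" and t: "t \<in> carrier ?TA" and eq: "?i s = ?i t"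
  let ?d = "s \<ominus>\<^bsub>?TA\<^esub> t"
  have d: "?d \<in> carrier ?TA" using s t by simp
  have "?i ?d = ?i s \<ominus>\<^bsub>tensor K V W\<^esub> ?i t"
    by (rule module_hom_minus[OF TA tensor_vectorspace[OF V W] ih s t])
  then have i0: "?i ?d = \<zero>\<^bsub>tensor K V W\<^esub>"
    unfolding eq using module_hom_in[OF ih t] by (simp add: T.M.minus_eq T.M.r_neg)
  have "?d \<in> tensor_sub K (V\<lparr>carrier := A\<rparr>) W {\<zero>\<^bsub>V\<^esub>} (carrier W)"
  proof (rule tensor_sub_sliceI[OF VA W _ d])
    show "submodule K {\<zero>\<^bsub>V\<^esub>} (V\<lparr>carrier := A\<rparr>)" using zero_submodule[OF VA] by simp
    fix \<phi> assume phi: "\<phi> \<in> module_hom K W (ground_algebra K)"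
    have phi': "\<phi> w \<in> carrier K" if "w \<in> carrier W" for w using module_hom_in[OF phi that] by simp
    have "slice K V \<phi> (?i ?d) = slice K (V\<lparr>carrier := A\<rparr>) \<phi> ?d"
    proof (rule tensor_hom_eqI[OF VA W V module_hom_comp[OF ih slice_hom[OF V W phi]]
          module_hom_comp[OF slice_hom[OF VA W phi] submodule_incl_hom[OF A]] _ d])
      fix v w assume v: "v \<in> carrier (V\<lparr>carrier := A\<rparr>)" and w: "w \<in> carrier W"
      then have "v \<in> carrier V" using A.subset by auto
      with v w show "slice K V \<phi> (?i (pure_tensor K (V\<lparr>carrier := A\<rparr>) W v w)) =
          slice K (V\<lparr>carrier := A\<rparr>) \<phi> (pure_tensor K (V\<lparr>carrier := A\<rparr>) W v w)"
        by (simp add: ip slice_pure[OF V W phi] slice_pure[OF VA W phi])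
    qed
    then show "slice K (V\<lparr>carrier := A\<rparr>) \<phi> ?d \<in> {\<zero>\<^bsub>V\<^esub>}"
      using module_hom_zero[OF tensor_vectorspace[OF V W] V slice_hom[OF V W phi]] by (simp add: i0)
  qed
  then have "?d \<in> {\<zero>\<^bsub>?TA\<^esub>}"
    using tensor_sub_hom_in[OF VA W _ carrier_submodule[OF W] TA module_hom_id zero_submodule[OF TA], of "{\<zero>\<^bsub>V\<^esub>}"]
      zero_submodule[OF VA] pure_tensor_zero_left[OF VA W] by auto
  then show "s = t" using s t by simp
qed

section \<open>The free algebra\<close>

lemma free_algebra_simps [simp]:
  "carrier (free_algebra K X) = carrier (free_space K (lists X))"
  "\<zero>\<^bsub>free_algebra K X\<^esub> = \<zero>\<^bsub>free_space K (lists X)\<^esub>"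
  "add (free_algebra K X) = add (free_space K (lists X))"
  "smult (free_algebra K X) = smult (free_space K (lists X))"
  "\<one>\<^bsub>free_algebra K X\<^esub> = delta K []"
  by (simp_all add: free_algebra_def)

lemma free_algebra_mult:
  "c \<otimes>\<^bsub>free_algebra K X\<^esub> d = (\<lambda>w. \<Oplus>\<^bsub>K\<^esub>i\<in>{..length w}. c (take i w) \<otimes>\<^bsub>K\<^esub> d (drop i w))"
  by (simp add: free_algebra_def)

context field
begin

lemma free_space_hom_eqI:
  assumes Z: "vectorspace R Z"
    and f: "f \<in> module_hom R (free_space R X) Z" and g: "g \<in> module_hom R (free_space R X) Z"
    and eq: "\<And>x. x \<in> X \<Longrightarrow> f (delta R x) = g (delta R x)" and c: "c \<in> carrier (free_space R X)"
  shows "f c = g c"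
  using c
proof (induction rule: free_space_induct)
  note FV = free_space_vectorspace[of X]
  case zero
  show ?case by (simp only: module_hom_zero[OF FV Z f] module_hom_zero[OF FV Z g])
next
  interpret FV: vectorspace R "free_space R X" by (rule free_space_vectorspace)
  case (add a x c)
  then have "a \<odot>\<^bsub>free_space R X\<^esub> delta R x \<in> carrier (free_space R X)"
    by (intro FV.smult_closed delta_in_free_space)
  with add show ?case
    by (simp add: module_hom_add[OF f] module_hom_add[OF g] module_hom_smult[OF f] module_hom_smult[OF g] eq
        del: free_space_simps)
qed

lemma free_algebra_vectorspace: "vectorspace R (free_algebra R X)"
  by (rule vectorspace_cong[OF free_space_vectorspace]) simp_all

text \<open>In the sum over all cuts of \<open>w\<close>, only the cut after \<open>length u\<close>
  letters can match both \<open>u\<close> and \<open>v\<close>.\<close>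

lemma free_algebra_delta_mult:
  "delta R u \<otimes>\<^bsub>free_algebra R X\<^esub> delta R v = delta R (u @ v)"
proof
  fix w
  have "(\<Oplus>i\<in>{..length w}. delta R u (take i w) \<otimes> delta R v (drop i w))
      = (\<Oplus>i\<in>{..length w}. if length u = i then (if w = u @ v then \<one> else \<zero>) else \<zero>)"
    by (rule finsum_cong') (auto simp: delta_def)
  also have "\<dots> = (if w = u @ v then \<one> else \<zero>)"
  proof (cases "length u \<le> length w")
    case True
    then show ?thesis
      by (subst add.finprod_singleton) auto
  next
    case False
    then have "(\<Oplus>i\<in>{..length w}. if length u = i then (if w = u @ v then \<one> else \<zero>) else \<zero>) = \<zero>"
      by (intro add.finprod_one_eqI) auto
    with False show ?thesis by auto
  qed
  finally show "(delta R u \<otimes>\<^bsub>free_algebra R X\<^esub> delta R v) w = delta R (u @ v) w"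
    by (simp add: free_algebra_mult delta_def)
qed

text \<open>The combined form a c + c' matches the step of \<open>free_space_induct\<close>;
  additivity is the case a = 1 and homogeneity the case c' = 0.\<close>

lemma free_algebra_mult_left:
  assumes c: "c \<in> carrier (free_space R Y)" and c': "c' \<in> carrier (free_space R Y)"
    and d: "d \<in> carrier (free_space R Z)" and a: "a \<in> carrier R"
  shows "(a \<odot>\<^bsub>free_space R Y\<^esub> c \<oplus>\<^bsub>free_space R Y\<^esub> c') \<otimes>\<^bsub>free_algebra R X\<^esub> d =
    a \<odot>\<^bsub>free_space R Y\<^esub> (c \<otimes>\<^bsub>free_algebra R X\<^esub> d) \<oplus>\<^bsub>free_space R Y\<^esub> (c' \<otimes>\<^bsub>free_algebra R X\<^esub> d)"
proof
  fix w
  note [simp] = free_space_coeff[OF c] free_space_coeff[OF c'] free_space_coeff[OF d] a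
  have "(\<Oplus>i\<in>{..length w}. (a \<otimes> c (take i w) \<oplus> c' (take i w)) \<otimes> d (drop i w)) =
    (\<Oplus>i\<in>{..length w}. a \<otimes> (c (take i w) \<otimes> d (drop i w)) \<oplus> c' (take i w) \<otimes> d (drop i w))"
    by (rule finsum_cong') (auto simp: l_distr m_assoc)
  also have "\<dots> = a \<otimes> (\<Oplus>i\<in>{..length w}. c (take i w) \<otimes> d (drop i w)) \<oplus>
      (\<Oplus>i\<in>{..length w}. c' (take i w) \<otimes> d (drop i w))"
    by (subst finsum_addf) (auto simp: finsum_rdistr)
  finally show "((a \<odot>\<^bsub>free_space R Y\<^esub> c \<oplus>\<^bsub>free_space R Y\<^esub> c') \<otimes>\<^bsub>free_algebra R X\<^esub> d) w =
    (a \<odot>\<^bsub>free_space R Y\<^esub> (c \<otimes>\<^bsub>free_algebra R X\<^esub> d) \<oplus>\<^bsub>free_space R Y\<^esub> (c' \<otimes>\<^bsub>free_algebra R X\<^esub> d)) w"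
    by (simp add: free_algebra_mult)
qed

lemma free_algebra_mult_right:
  assumes c: "c \<in> carrier (free_space R Y)" and d: "d \<in> carrier (free_space R Z)"
    and d': "d' \<in> carrier (free_space R Z)" and a: "a \<in> carrier R"
  shows "c \<otimes>\<^bsub>free_algebra R X\<^esub> (a \<odot>\<^bsub>free_space R Y\<^esub> d \<oplus>\<^bsub>free_space R Y\<^esub> d') =
    a \<odot>\<^bsub>free_space R Y\<^esub> (c \<otimes>\<^bsub>free_algebra R X\<^esub> d) \<oplus>\<^bsub>free_space R Y\<^esub> (c \<otimes>\<^bsub>free_algebra R X\<^esub> d')"
proof
  fix w
  note [simp] = free_space_coeff[OF c] free_space_coeff[OF d] free_space_coeff[OF d'] a
  have "(\<Oplus>i\<in>{..length w}. c (take i w) \<otimes> (a \<otimes> d (drop i w) \<oplus> d' (drop i w))) =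
    (\<Oplus>i\<in>{..length w}. a \<otimes> (c (take i w) \<otimes> d (drop i w)) \<oplus> c (take i w) \<otimes> d' (drop i w))"
    by (rule finsum_cong') (auto simp: r_distr m_lcomm)
  also have "\<dots> = a \<otimes> (\<Oplus>i\<in>{..length w}. c (take i w) \<otimes> d (drop i w)) \<oplus>
      (\<Oplus>i\<in>{..length w}. c (take i w) \<otimes> d' (drop i w))"
    by (subst finsum_addf) (auto simp: finsum_rdistr)
  finally show "(c \<otimes>\<^bsub>free_algebra R X\<^esub> (a \<odot>\<^bsub>free_space R Y\<^esub> d \<oplus>\<^bsub>free_space R Y\<^esub> d')) w =
    (a \<odot>\<^bsub>free_space R Y\<^esub> (c \<otimes>\<^bsub>free_algebra R X\<^esub> d) \<oplus>\<^bsub>free_space R Y\<^esub> (c \<otimes>\<^bsub>free_algebra R X\<^esub> d')) w"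
    by (simp add: free_algebra_mult)
qed

lemma free_algebra_mult_zero_left:
  "d \<in> carrier (free_space R Z) \<Longrightarrow> (\<lambda>_. \<zero>) \<otimes>\<^bsub>free_algebra R X\<^esub> d = (\<lambda>_. \<zero>)"
  by (auto simp: free_algebra_mult fun_eq_iff free_space_coeff intro!: add.finprod_one_eqI)

lemma free_algebra_mult_zero_right:
  "c \<in> carrier (free_space R Z) \<Longrightarrow> c \<otimes>\<^bsub>free_algebra R X\<^esub> (\<lambda>_. \<zero>) = (\<lambda>_. \<zero>)"
  by (auto simp: free_algebra_mult fun_eq_iff free_space_coeff intro!: add.finprod_one_eqI)

lemma free_algebra_mult_closed:
  assumes c: "c \<in> carrier (free_space R (lists X))" and d: "d \<in> carrier (free_space R (lists X))"
  shows "c \<otimes>\<^bsub>free_algebra R X\<^esub> d \<in> carrier (free_space R (lists X))"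
  using c
proof (induction rule: free_space_induct)
  interpret F: vectorspace R "free_space R (lists X)" by (rule free_space_vectorspace)
  {
    case zero
    show ?case using free_algebra_mult_zero_left[OF d] F.M.zero_closed by simp
  next
    case (add a u c)
    have u: "delta R u \<in> carrier (free_space R (lists X))" using add by simp
    from d have "delta R u \<otimes>\<^bsub>free_algebra R X\<^esub> d \<in> carrier (free_space R (lists X))"
    proof (induction rule: free_space_induct)
      case zero
      show ?case using free_algebra_mult_zero_right[OF u] F.M.zero_closed by simp
    next
      case (add b v d)
      have v: "delta R v \<in> carrier (free_space R (lists X))" using add by simp
      have uv: "delta R (u @ v) \<in> carrier (free_space R (lists X))"
        using add \<open>u \<in> lists X\<close> by (intro delta_in_free_space) simp
      show ?case
        unfolding free_algebra_mult_right[OF u v add(3,1)] free_algebra_delta_mult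
        by (intro F.M.a_closed F.smult_closed add uv)
    qed
    then show ?case
      unfolding free_algebra_mult_left[OF u add(3) d add(1)]
      by (intro F.M.a_closed F.smult_closed add)
  }
qed

lemma free_algebra_bilinear:
  "bilinear_map R (free_space R (lists X)) (free_space R (lists X)) (free_space R (lists X)) (mult (free_algebra R X))"
proof -
  interpret F: vectorspace R "free_space R (lists X)" by (rule free_space_vectorspace)
  have zl: "\<zero>\<^bsub>free_space R (lists X)\<^esub> \<otimes>\<^bsub>free_algebra R X\<^esub> c = \<zero>\<^bsub>free_space R (lists X)\<^esub>"
    and zr: "c \<otimes>\<^bsub>free_algebra R X\<^esub> \<zero>\<^bsub>free_space R (lists X)\<^esub> = \<zero>\<^bsub>free_space R (lists X)\<^esub>"
    if "c \<in> carrier (free_space R (lists X))" for c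
    using that by (simp_all add: free_algebra_mult_zero_left free_algebra_mult_zero_right)
  note [simp del] = free_space_simps
  show ?thesis
  proof (intro bilinear_mapI module_homI free_algebra_mult_closed)
    fix c d e a assume c: "c \<in> carrier (free_space R (lists X))" and d: "d \<in> carrier (free_space R (lists X))"
      and e: "e \<in> carrier (free_space R (lists X))"
    show "c \<otimes>\<^bsub>free_algebra R X\<^esub> (d \<oplus>\<^bsub>free_space R (lists X)\<^esub> e) = c \<otimes>\<^bsub>free_algebra R X\<^esub> d
        \<oplus>\<^bsub>free_space R (lists X)\<^esub> c \<otimes>\<^bsub>free_algebra R X\<^esub> e"
      using free_algebra_mult_right[OF c d e one_closed, where X = X] c d e
      by (simp add: free_algebra_mult_closed)
    show "(d \<oplus>\<^bsub>free_space R (lists X)\<^esub> e) \<otimes>\<^bsub>free_algebra R X\<^esub> c = d \<otimes>\<^bsub>free_algebra R X\<^esub> c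
        \<oplus>\<^bsub>free_space R (lists X)\<^esub> e \<otimes>\<^bsub>free_algebra R X\<^esub> c"
      using free_algebra_mult_left[OF d e c one_closed, where X = X] c d e
      by (simp add: free_algebra_mult_closed)
  next
    fix c d a assume c: "c \<in> carrier (free_space R (lists X))" and d: "d \<in> carrier (free_space R (lists X))"
      and a: "a \<in> carrier R"
    show "c \<otimes>\<^bsub>free_algebra R X\<^esub> (a \<odot>\<^bsub>free_space R (lists X)\<^esub> d) =
      a \<odot>\<^bsub>free_space R (lists X)\<^esub> (c \<otimes>\<^bsub>free_algebra R X\<^esub> d)"
      using free_algebra_mult_right[OF c d F.M.zero_closed a, where X = X] c d a
      by (simp add: free_algebra_mult_closed zr)
    show "(a \<odot>\<^bsub>free_space R (lists X)\<^esub> d) \<otimes>\<^bsub>free_algebra R X\<^esub> c =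
      a \<odot>\<^bsub>free_space R (lists X)\<^esub> (d \<otimes>\<^bsub>free_algebra R X\<^esub> c)"
      using free_algebra_mult_left[OF d F.M.zero_closed c a, where X = X] c d a
      by (simp add: free_algebra_mult_closed zl)
  qed
qed

text \<open>Both sides of the associative law are linear in each argument, so it reduces
  successively to words in all three places, where it is associativity of concatenation.\<close>

lemma free_algebra_ring: "ring (free_algebra R X)"
proof -
  let ?F = "free_space R (lists X)" and ?m = "mult (free_algebra R X)"
  note FV = free_space_vectorspace[of "lists X"]
  note ml = bilinear_map_left[OF free_algebra_bilinear[of X]]
   and mr = bilinear_map_right[OF free_algebra_bilinear[of X]]
  note cl = free_algebra_mult_closed
  note d = delta_in_free_space
  show ?thesis
  proof (rule ringI)
    show "abelian_group (free_algebra R X)"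
      using free_algebra_vectorspace[of X] by (simp add: vectorspace_def module_def)
  next
    show "Group.monoid (free_algebra R X)"
    proof (rule monoidI)
      fix a b c assume "a \<in> carrier (free_algebra R X)" "b \<in> carrier (free_algebra R X)" "c \<in> carrier (free_algebra R X)"
      then have a: "a \<in> carrier ?F" and b: "b \<in> carrier ?F" and c: "c \<in> carrier ?F" by simp_all
      show "?m (?m a b) c = ?m a (?m b c)"
      proof (rule free_space_hom_eqI[OF FV module_hom_comp[OF ml[OF b] ml[OF c]] ml[OF cl[OF b c]] _ a])
        fix u assume u: "u \<in> lists X"
        show "?m (?m (delta R u) b) c = ?m (delta R u) (?m b c)"
        proof (rule free_space_hom_eqI[OF FV module_hom_comp[OF mr[OF d[OF u]] ml[OF c]]
              module_hom_comp[OF ml[OF c] mr[OF d[OF u]]] _ b])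
          fix v assume v: "v \<in> lists X"
          then have uv: "u @ v \<in> lists X" using u by simp
          show "?m (?m (delta R u) (delta R v)) c = ?m (delta R u) (?m (delta R v) c)"
            unfolding free_algebra_delta_mult
            by (rule free_space_hom_eqI[OF FV mr[OF d[OF uv]] module_hom_comp[OF mr[OF d[OF v]] mr[OF d[OF u]]] _ c])
              (simp add: free_algebra_delta_mult)
        qed
      qed
    next
      fix c assume "c \<in> carrier (free_algebra R X)"
      then have c: "c \<in> carrier ?F" by simp
      have n: "[] \<in> lists X" by simp
      show "?m \<one>\<^bsub>free_algebra R X\<^esub> c = c"
        using free_space_hom_eqI[OF FV mr[OF d[OF n]] module_hom_id _ c]
        by (simp add: free_algebra_delta_mult)
      show "?m c \<one>\<^bsub>free_algebra R X\<^esub> = c"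
        using free_space_hom_eqI[OF FV ml[OF d[OF n]] module_hom_id _ c]
        by (simp add: free_algebra_delta_mult)
    qed (simp_all add: cl)
  next
    fix x y z
    assume "x \<in> carrier (free_algebra R X)" "y \<in> carrier (free_algebra R X)" "z \<in> carrier (free_algebra R X)"
    then show "?m (x \<oplus>\<^bsub>free_algebra R X\<^esub> y) z = ?m x z \<oplus>\<^bsub>free_algebra R X\<^esub> ?m y z"
      "?m z (x \<oplus>\<^bsub>free_algebra R X\<^esub> y) = ?m z x \<oplus>\<^bsub>free_algebra R X\<^esub> ?m z y"
      using module_hom_add[OF ml] module_hom_add[OF mr] by (simp_all del: free_space_simps)
  qed
qed

end

section \<open>The enveloping algebra as an algebra\<close>

text \<open>Gives a name to the generators that are written out inside
  \<open>uea_ideal\<close>.\<close>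

definition uea_relations :: "('k, 'r) ring_scheme \<Rightarrow> ('k, 'g, 'c) lie_algebra_scheme \<Rightarrow> ('g list \<Rightarrow> 'k) set"
  where "uea_relations K L = (let T = free_algebra K (carrier L) in
    {delta K [x \<oplus>\<^bsub>L\<^esub> y] \<ominus>\<^bsub>T\<^esub> delta K [x] \<ominus>\<^bsub>T\<^esub> delta K [y] | x y. x \<in> carrier L \<and> y \<in> carrier L} \<union>
     {delta K [a \<odot>\<^bsub>L\<^esub> x] \<ominus>\<^bsub>T\<^esub> a \<odot>\<^bsub>T\<^esub> delta K [x] | a x. a \<in> carrier K \<and> x \<in> carrier L} \<union>
     {delta K [x] \<otimes>\<^bsub>T\<^esub> delta K [y] \<ominus>\<^bsub>T\<^esub> delta K [y] \<otimes>\<^bsub>T\<^esub> delta K [x] \<ominus>\<^bsub>T\<^esub> delta K [bracket L x y] | x y.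
        x \<in> carrier L \<and> y \<in> carrier L})"

lemma uea_ideal_eq: "uea_ideal K L = genideal (free_algebra K (carrier L)) (uea_relations K L)"
  by (simp add: uea_ideal_def uea_relations_def Let_def)

context lie_algebra
begin

abbreviation "FA \<equiv> free_algebra K (carrier L)"
abbreviation "FS \<equiv> free_space K (lists (carrier L))"
abbreviation "UI \<equiv> uea_ideal K L"
abbreviation "UA \<equiv> uea_algebra K L"
abbreviation "\<iota> \<equiv> uea_incl K L"

sublocale FA: ring FA by (rule free_algebra_ring)
sublocale FS: vectorspace K FS by (rule free_space_vectorspace)
sublocale FAV: vectorspace K FA by (rule free_algebra_vectorspace)

lemma word_closed: "set w \<subseteq> carrier L \<Longrightarrow> delta K w \<in> carrier FA"
  by (simp add: in_lists_conv_set subset_eq)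

lemma uea_relations_carrier: "uea_relations K L \<subseteq> carrier FA"
  unfolding uea_relations_def Let_def
  by (auto simp del: free_algebra_simps free_space_simps
      intro!: FA.minus_closed FAV.smult_closed word_closed FA.m_closed bracket_closed M.a_closed smult_closed)

sublocale UI: ideal UI FA
  unfolding uea_ideal_eq by (rule FA.genideal_ideal[OF uea_relations_carrier])

lemma uea_relation_in_ideal: "r \<in> uea_relations K L \<Longrightarrow> r \<in> UI"
  unfolding uea_ideal_eq using FA.genideal_self[OF uea_relations_carrier] by blast

lemma FA_smult_mult_left:
  assumes "a \<in> carrier K" "c \<in> carrier FA" "d \<in> carrier FA"
  shows "(a \<odot>\<^bsub>FA\<^esub> c) \<otimes>\<^bsub>FA\<^esub> d = a \<odot>\<^bsub>FA\<^esub> (c \<otimes>\<^bsub>FA\<^esub> d)"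
  using module_hom_smult[OF bilinear_map_left[OF free_algebra_bilinear]] assms
  by (simp del: free_space_simps)

lemma FA_smult_mult_right:
  assumes "a \<in> carrier K" "c \<in> carrier FA" "d \<in> carrier FA"
  shows "c \<otimes>\<^bsub>FA\<^esub> (a \<odot>\<^bsub>FA\<^esub> d) = a \<odot>\<^bsub>FA\<^esub> (c \<otimes>\<^bsub>FA\<^esub> d)"
  using module_hom_smult[OF bilinear_map_right[OF free_algebra_bilinear]] assms
  by (simp del: free_space_simps)

text \<open>A ring ideal is closed under scalars because a c = (a 1) c in the free algebra.\<close>

lemma UI_submodule: "submodule K UI FA"
proof
  fix a c assume a: "a \<in> carrier K" and c: "c \<in> UI"
  have cF: "c \<in> carrier FA" using c by (rule UI.a_Hcarr)
  have "a \<odot>\<^bsub>FA\<^esub> c = (a \<odot>\<^bsub>FA\<^esub> \<one>\<^bsub>FA\<^esub>) \<otimes>\<^bsub>FA\<^esub> c"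
    using FA_smult_mult_left[OF a FA.one_closed cF] cF FA.l_one by metis
  then show "a \<odot>\<^bsub>FA\<^esub> c \<in> UI"
    using UI.I_l_closed[OF c FAV.smult_closed[OF a FA.one_closed]] by metis
qed (auto simp del: free_algebra_simps free_space_simps intro: UI.a_Hcarr)

lemma uea_algebra_vectorspace: "vectorspace K UA"
  unfolding uea_algebra_def by (rule quotient_space_vectorspace[OF FAV.vectorspace_axioms UI_submodule])

sublocale UV: vectorspace K UA by (rule uea_algebra_vectorspace)

lemma uea_algebra_carrier_E:
  assumes "u \<in> carrier UA" obtains c where "c \<in> carrier FA" "u = UI +>\<^bsub>FA\<^esub> c"
  using assms unfolding uea_algebra_def by (rule quotient_space_E[OF FAV.vectorspace_axioms UI_submodule])

lemma uea_coset_hom: "(\<lambda>c. UI +>\<^bsub>FA\<^esub> c) \<in> module_hom K FA UA"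
  unfolding uea_algebra_def by (rule coset_hom[OF FAV.vectorspace_axioms UI_submodule])

lemmas uea_coset_closed = module_hom_in[OF uea_coset_hom]

lemma uea_coset_mult:
  "\<lbrakk>c \<in> carrier FA; d \<in> carrier FA\<rbrakk> \<Longrightarrow>
    (UI +>\<^bsub>FA\<^esub> c) \<otimes>\<^bsub>UA\<^esub> (UI +>\<^bsub>FA\<^esub> d) = UI +>\<^bsub>FA\<^esub> (c \<otimes>\<^bsub>FA\<^esub> d)"
  using UI.rcoset_mult_add by (simp add: uea_algebra_def quotient_space_def ring.defs FactRing_def)

lemma uea_algebra_one: "\<one>\<^bsub>UA\<^esub> = UI +>\<^bsub>FA\<^esub> delta K []"
  by (simp add: uea_algebra_def quotient_space_def ring.defs FactRing_def)

lemma uea_mult_bilinear: "bilinear_map K UA UA UA (mult UA)"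
proof (intro bilinear_mapI module_homI)
  note [simp del] = free_algebra_simps free_space_simps
  note [simp] = uea_coset_mult module_hom_add[OF uea_coset_hom, symmetric] FA.l_distr FA.r_distr 
     FA_smult_mult_left FA_smult_mult_right module_hom_smult[OF uea_coset_hom, symmetric] uea_coset_closed
  fix u v assume "u \<in> carrier UA" "v \<in> carrier UA"
  then obtain c d where c: "c \<in> carrier FA" "u = UI +>\<^bsub>FA\<^esub> c" and d: "d \<in> carrier FA" "v = UI +>\<^bsub>FA\<^esub> d"
    by (metis uea_algebra_carrier_E)
  show "u \<otimes>\<^bsub>UA\<^esub> v \<in> carrier UA" "u \<otimes>\<^bsub>UA\<^esub> v \<in> carrier UA" using c d by simp_all
  {
    fix w assume "w \<in> carrier UA"
    then obtain e where e: "e \<in> carrier FA" "w = UI +>\<^bsub>FA\<^esub> e" by (metis uea_algebra_carrier_E)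
    show "u \<otimes>\<^bsub>UA\<^esub> (v \<oplus>\<^bsub>UA\<^esub> w) = u \<otimes>\<^bsub>UA\<^esub> v \<oplus>\<^bsub>UA\<^esub> u \<otimes>\<^bsub>UA\<^esub> w"
      "(v \<oplus>\<^bsub>UA\<^esub> w) \<otimes>\<^bsub>UA\<^esub> u = v \<otimes>\<^bsub>UA\<^esub> u \<oplus>\<^bsub>UA\<^esub> w \<otimes>\<^bsub>UA\<^esub> u"
      using c d e by simp_all
  }
  fix a assume "a \<in> carrier K"
  then show "u \<otimes>\<^bsub>UA\<^esub> (a \<odot>\<^bsub>UA\<^esub> v) = a \<odot>\<^bsub>UA\<^esub> (u \<otimes>\<^bsub>UA\<^esub> v)"
    "(a \<odot>\<^bsub>UA\<^esub> v) \<otimes>\<^bsub>UA\<^esub> u = a \<odot>\<^bsub>UA\<^esub> (v \<otimes>\<^bsub>UA\<^esub> u)"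
    using c d by simp_all
qed

lemma uea_one_closed: "\<one>\<^bsub>UA\<^esub> \<in> carrier UA"
  unfolding uea_algebra_one by (rule uea_coset_closed[OF word_closed]) simp

lemma uea_m_assoc:
  assumes "u \<in> carrier UA" "v \<in> carrier UA" "w \<in> carrier UA"
  shows "u \<otimes>\<^bsub>UA\<^esub> v \<otimes>\<^bsub>UA\<^esub> w = u \<otimes>\<^bsub>UA\<^esub> (v \<otimes>\<^bsub>UA\<^esub> w)"
proof -
  note [simp del] = free_algebra_simps free_space_simps
  obtain c d e where "c \<in> carrier FA" "u = UI +>\<^bsub>FA\<^esub> c" "d \<in> carrier FA" "v = UI +>\<^bsub>FA\<^esub> d"
     "e \<in> carrier FA" "w = UI +>\<^bsub>FA\<^esub> e"
    using assms by (metis uea_algebra_carrier_E)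
  then show ?thesis by (simp add: uea_coset_mult FA.m_assoc)
qed

lemma uea_one_left: "u \<in> carrier UA \<Longrightarrow> \<one>\<^bsub>UA\<^esub> \<otimes>\<^bsub>UA\<^esub> u = u"
  and uea_one_right: "u \<in> carrier UA \<Longrightarrow> u \<otimes>\<^bsub>UA\<^esub> \<one>\<^bsub>UA\<^esub> = u"
proof -
  assume u: "u \<in> carrier UA"
  have o: "\<one>\<^bsub>UA\<^esub> = UI +>\<^bsub>FA\<^esub> \<one>\<^bsub>FA\<^esub>" by (simp add: uea_algebra_one)
  obtain c where c: "c \<in> carrier FA" "u = UI +>\<^bsub>FA\<^esub> c" using u by (metis uea_algebra_carrier_E)
  show "\<one>\<^bsub>UA\<^esub> \<otimes>\<^bsub>UA\<^esub> u = u" "u \<otimes>\<^bsub>UA\<^esub> \<one>\<^bsub>UA\<^esub> = u"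
    unfolding o c(2) using uea_coset_mult[OF FA.one_closed c(1)] uea_coset_mult[OF c(1) FA.one_closed]
      FA.l_one[OF c(1)] FA.r_one[OF c(1)] by metis+
qed

lemma uea_incl_closed: "x \<in> carrier L \<Longrightarrow> \<iota> x \<in> carrier UA"
  unfolding uea_incl_def by (rule uea_coset_closed[OF word_closed]) simp

lemma uea_incl_mult:
  "\<lbrakk>x \<in> carrier L; set w \<subseteq> carrier L\<rbrakk> \<Longrightarrow> \<iota> x \<otimes>\<^bsub>UA\<^esub> (UI +>\<^bsub>FA\<^esub> delta K w) = UI +>\<^bsub>FA\<^esub> delta K (x # w)"
  unfolding uea_incl_def by (subst uea_coset_mult) (auto simp: free_algebra_delta_mult word_closed[simplified] in_lists_conv_set subset_eq)

lemma uea_coset_relation: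
  assumes "c \<ominus>\<^bsub>FA\<^esub> d \<in> uea_relations K L" "c \<in> carrier FA" "d \<in> carrier FA"
  shows "UI +>\<^bsub>FA\<^esub> c = UI +>\<^bsub>FA\<^esub> d"
  using coset_eq_iff[OF FAV.vectorspace_axioms UI_submodule assms(2,3)] uea_relation_in_ideal assms(1)
  by blast

lemma uea_incl_hom: "\<iota> \<in> module_hom K L UA"
proof (rule module_homI[OF uea_incl_closed])
  note [simp del] = free_algebra_simps free_space_simps
  note [simp] = word_closed
  fix x assume x: "x \<in> carrier L"
  {
    fix y assume y: "y \<in> carrier L"
    have "delta K [x \<oplus>\<^bsub>L\<^esub> y] \<ominus>\<^bsub>FA\<^esub> delta K [x] \<ominus>\<^bsub>FA\<^esub> delta K [y] \<in> uea_relations K L"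
      unfolding uea_relations_def Let_def using x y by blast
    then have "UI +>\<^bsub>FA\<^esub> delta K [x \<oplus>\<^bsub>L\<^esub> y] = UI +>\<^bsub>FA\<^esub> (delta K [x] \<oplus>\<^bsub>FA\<^esub> delta K [y])"
      by (intro uea_coset_relation) (use x y in \<open>simp_all add: FA.minus_minus_eq\<close>)
    then show "\<iota> (x \<oplus>\<^bsub>L\<^esub> y) = \<iota> x \<oplus>\<^bsub>UA\<^esub> \<iota> y"
      unfolding uea_incl_def using x y by (simp add: module_hom_add[OF uea_coset_hom])
  }
  fix a assume a: "a \<in> carrier K"
  have "delta K [a \<odot>\<^bsub>L\<^esub> x] \<ominus>\<^bsub>FA\<^esub> a \<odot>\<^bsub>FA\<^esub> delta K [x] \<in> uea_relations K L"
    unfolding uea_relations_def Let_def using x a by blast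
  then have "UI +>\<^bsub>FA\<^esub> delta K [a \<odot>\<^bsub>L\<^esub> x] = UI +>\<^bsub>FA\<^esub> (a \<odot>\<^bsub>FA\<^esub> delta K [x])"
    by (intro uea_coset_relation) (use x a in simp_all)
  then show "\<iota> (a \<odot>\<^bsub>L\<^esub> x) = a \<odot>\<^bsub>UA\<^esub> \<iota> x"
    unfolding uea_incl_def using x a by (simp add: module_hom_smult[OF uea_coset_hom])
qed

lemma uea_incl_bracket:
  assumes x: "x \<in> carrier L" and y: "y \<in> carrier L"
  shows "\<iota> (bracket L x y) = \<iota> x \<otimes>\<^bsub>UA\<^esub> \<iota> y \<ominus>\<^bsub>UA\<^esub> \<iota> y \<otimes>\<^bsub>UA\<^esub> \<iota> x"
proof -
  note [simp del] = free_algebra_simps free_space_simps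
  note [simp] = word_closed bracket_closed
  let ?c = "delta K [x] \<otimes>\<^bsub>FA\<^esub> delta K [y]" and ?d = "delta K [y] \<otimes>\<^bsub>FA\<^esub> delta K [x]"
  have "?c \<ominus>\<^bsub>FA\<^esub> ?d \<ominus>\<^bsub>FA\<^esub> delta K [bracket L x y] \<in> uea_relations K L"
    unfolding uea_relations_def Let_def using x y by blast
  then have "UI +>\<^bsub>FA\<^esub> (?c \<ominus>\<^bsub>FA\<^esub> ?d) = UI +>\<^bsub>FA\<^esub> delta K [bracket L x y]"
    by (intro uea_coset_relation) (use x y in simp_all)
  then show ?thesis
    unfolding uea_incl_def using x y
    by (simp add: module_hom_minus[OF FAV.vectorspace_axioms uea_algebra_vectorspace uea_coset_hom] uea_coset_mult)
qed

text \<open>The induction principle for U: every word is reached from the unit by multiplying with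
  generators on the left, and the cosets of words span.\<close>

lemma uea_generated:
  assumes N: "submodule K N UA" and one: "\<one>\<^bsub>UA\<^esub> \<in> N"
    and step: "\<And>x u. \<lbrakk>x \<in> carrier L; u \<in> N\<rbrakk> \<Longrightarrow> \<iota> x \<otimes>\<^bsub>UA\<^esub> u \<in> N"
    and u: "u \<in> carrier UA"
  shows "u \<in> N"
proof -
  note [simp del] = free_algebra_simps free_space_simps
  interpret N: submodule K N UA by (rule N)
  have w: "UI +>\<^bsub>FA\<^esub> delta K w \<in> N" if "set w \<subseteq> carrier L" for w
    using that
  proof (induction w)
    case Nil
    then show ?case using one by (simp add: uea_algebra_one)
  next
    case (Cons x w)
    then show ?case using step[of x "UI +>\<^bsub>FA\<^esub> delta K w"] by (simp add: uea_incl_mult)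
  qed
  obtain c where c: "c \<in> carrier FA" "u = UI +>\<^bsub>FA\<^esub> c" using u by (rule uea_algebra_carrier_E)
  have "c \<in> carrier FS" using c by (simp add: free_algebra_simps)
  then have "UI +>\<^bsub>FA\<^esub> c \<in> N"
  proof (induction rule: free_space_induct)
    case zero
    have "UI +>\<^bsub>FA\<^esub> \<zero>\<^bsub>FA\<^esub> = \<zero>\<^bsub>UA\<^esub>"
      by (rule module_hom_zero[OF FAV.vectorspace_axioms uea_algebra_vectorspace uea_coset_hom])
    then show ?case by (simp add: free_algebra_simps)
  next
    case (add a v c)
    have v: "delta K v \<in> carrier FA" "set v \<subseteq> carrier L" using add by (auto intro: word_closed)
    have c: "c \<in> carrier FA" using add by (simp add: free_algebra_simps)
    have "UI +>\<^bsub>FA\<^esub> (a \<odot>\<^bsub>FA\<^esub> delta K v \<oplus>\<^bsub>FA\<^esub> c) =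
       a \<odot>\<^bsub>UA\<^esub> (UI +>\<^bsub>FA\<^esub> delta K v) \<oplus>\<^bsub>UA\<^esub> (UI +>\<^bsub>FA\<^esub> c)"
      using v c add(1) by (simp add: module_hom_add[OF uea_coset_hom] module_hom_smult[OF uea_coset_hom])
    then show ?case using w[OF v(2)] add by (simp add: free_algebra_simps)
  qed
  then show ?thesis using c by simp
qed

end

section \<open>Homomorphisms out of the enveloping algebra\<close>

text \<open>
  The elements of the free algebra that act as zero on a \<open>\<gg>\<close>-module form a two-sided ideal, so a
  linear map out of \<open>U(\<gg>)\<close> is well defined as soon as its target is a \<open>\<gg>\<close>-module. In particular
  associativity of the multiplication of \<open>U(\<gg>) \<otimes> U(\<gg>)\<close> is not needed.
\<close>

definition lie_rep ::
  "('k, 'r) ring_scheme \<Rightarrow> ('k, 'g, 'c) lie_algebra_scheme \<Rightarrow> ('k, 't, 'd) module_scheme \<Rightarrow>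
    ('g \<Rightarrow> 't \<Rightarrow> 't) \<Rightarrow> bool"
  where "lie_rep K L T f \<longleftrightarrow> (\<forall>x\<in>carrier L. f x \<in> module_hom K T T) \<and>
    (\<forall>x\<in>carrier L. \<forall>y\<in>carrier L. \<forall>t\<in>carrier T. f (x \<oplus>\<^bsub>L\<^esub> y) t = f x t \<oplus>\<^bsub>T\<^esub> f y t) \<and>
    (\<forall>a\<in>carrier K. \<forall>x\<in>carrier L. \<forall>t\<in>carrier T. f (a \<odot>\<^bsub>L\<^esub> x) t = a \<odot>\<^bsub>T\<^esub> f x t) \<and>
    (\<forall>x\<in>carrier L. \<forall>y\<in>carrier L. \<forall>t\<in>carrier T. f (bracket L x y) t = f x (f y t) \<ominus>\<^bsub>T\<^esub> f y (f x t))"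

context lie_algebra
begin

context
  fixes T :: "('k, 't, 'e) module_scheme" and f :: "'g \<Rightarrow> 't \<Rightarrow> 't"
  assumes T: "vectorspace K T" and rep: "lie_rep K L T f"
begin

interpretation T: vectorspace K T by (rule T)

lemma rep_hom: "x \<in> carrier L \<Longrightarrow> f x \<in> module_hom K T T"
  and rep_add: "\<lbrakk>x \<in> carrier L; y \<in> carrier L; t \<in> carrier T\<rbrakk> \<Longrightarrow> f (x \<oplus>\<^bsub>L\<^esub> y) t = f x t \<oplus>\<^bsub>T\<^esub> f y t"
  and rep_smult: "\<lbrakk>a \<in> carrier K; x \<in> carrier L; t \<in> carrier T\<rbrakk> \<Longrightarrow> f (a \<odot>\<^bsub>L\<^esub> x) t = a \<odot>\<^bsub>T\<^esub> f x t"
  and rep_bracket: "\<lbrakk>x \<in> carrier L; y \<in> carrier L; t \<in> carrier T\<rbrakk> \<Longrightarrow>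
    f (bracket L x y) t = f x (f y t) \<ominus>\<^bsub>T\<^esub> f y (f x t)"
  using rep by (auto simp: lie_rep_def)

lemmas rep_closed = module_hom_in[OF rep_hom]

text \<open>\<open>rep_ext t c\<close> is the result of letting the element \<open>c\<close> of the
  free algebra act on \<open>t\<close>; in a word the last letter acts first.\<close>

abbreviation (input) rep_ext where "rep_ext t \<equiv> lin_ext K T (\<lambda>w. foldr f w t)"

lemma foldr_rep_hom: "w \<in> lists (carrier L) \<Longrightarrow> foldr f w \<in> module_hom K T T"
proof (induction w)
  case Nil
  then show ?case using module_hom_id by (simp add: id_def)
next
  case (Cons x w)
  then show ?case using module_hom_comp[of "foldr f w" K T T "f x" T] by (simp add: rep_hom comp_def)
qed

lemma rep_ext_hom: 
  assumes t: "t \<in> carrier T" shows "rep_ext t \<in> module_hom K FS T"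
  by (rule lin_ext_hom[OF T]) (use module_hom_in[OF foldr_rep_hom t] in auto)

lemma rep_ext_hom': "t \<in> carrier T \<Longrightarrow> rep_ext t \<in> module_hom K FA T"
  using rep_ext_hom[of t] by (simp add: module_hom_def del: free_space_simps)

lemma rep_ext_delta: "\<lbrakk>t \<in> carrier T; w \<in> lists (carrier L)\<rbrakk> \<Longrightarrow> rep_ext t (delta K w) = foldr f w t"
  using module_hom_in[OF foldr_rep_hom] by (subst lin_ext_delta[OF T]) auto

lemma rep_ext_hom_right: "c \<in> carrier FS \<Longrightarrow> (\<lambda>t. rep_ext t c) \<in> module_hom K T T"
proof (induction rule: free_space_induct)
  note [simp del] = free_space_simps
  case zero
  show ?case
    by (rule module_hom_cong[OF module_hom_const_zero[OF T] T])
      (rule module_hom_zero[OF FS.vectorspace_axioms T rep_ext_hom, symmetric])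
next
  note [simp del] = free_space_simps
  case (add a w c)
  have "(\<lambda>t. a \<odot>\<^bsub>T\<^esub> foldr f w t \<oplus>\<^bsub>T\<^esub> rep_ext t c) \<in> module_hom K T T"
    by (intro module_hom_plus[OF T] module_hom_scale[OF T] foldr_rep_hom add)
  then show ?case
  proof (rule module_hom_cong[OF _ T])
    fix t assume t: "t \<in> carrier T"
    have w: "delta K w \<in> carrier FS" using add by simp
    show "a \<odot>\<^bsub>T\<^esub> foldr f w t \<oplus>\<^bsub>T\<^esub> rep_ext t c = rep_ext t (a \<odot>\<^bsub>FS\<^esub> delta K w \<oplus>\<^bsub>FS\<^esub> c)"
      using add w t by (simp add: module_hom_add[OF rep_ext_hom] module_hom_smult[OF rep_ext_hom] rep_ext_delta)
  qed
qed

text \<open>This makes \<open>rep_ext\<close> an action of the free algebra. For words it is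
  \<open>foldr\<close> over a concatenation, and both sides are linear in \<open>c\<close> and in
  \<open>d\<close>.\<close>

lemma rep_ext_mult:
  assumes c: "c \<in> carrier FS" and d: "d \<in> carrier FS" and t: "t \<in> carrier T"
  shows "rep_ext t (c \<otimes>\<^bsub>FA\<^esub> d) = rep_ext (rep_ext t d) c"
proof (rule free_space_hom_eqI[OF T _ rep_ext_hom[OF module_hom_in[OF rep_ext_hom[OF t] d]] _ c])
  note ml = bilinear_map_left[OF free_algebra_bilinear]
   and mr = bilinear_map_right[OF free_algebra_bilinear]
  show "(\<lambda>c. rep_ext t (c \<otimes>\<^bsub>FA\<^esub> d)) \<in> module_hom K FS T"
    by (rule module_hom_comp[OF ml[OF d] rep_ext_hom[OF t]])
  fix u assume u: "u \<in> lists (carrier L)"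
  then have uF: "delta K u \<in> carrier FS" by simp
  show "rep_ext t (delta K u \<otimes>\<^bsub>FA\<^esub> d) = rep_ext (rep_ext t d) (delta K u)"
  proof (rule free_space_hom_eqI[OF T module_hom_comp[OF mr[OF uF] rep_ext_hom[OF t]]
      module_hom_comp[OF rep_ext_hom[OF t] rep_ext_hom_right[OF uF]] _ d])
    fix v assume v: "v \<in> lists (carrier L)"
    then have "u @ v \<in> lists (carrier L)" using u by simp
    then show "rep_ext t (delta K u \<otimes>\<^bsub>FA\<^esub> delta K v) = rep_ext (rep_ext t (delta K v)) (delta K u)"
      using u v t module_hom_in[OF foldr_rep_hom]
      by (simp add: free_algebra_delta_mult rep_ext_delta)
  qed
qed

text \<open>The three families of relations act as zero by the last three clauses of
  \<open>lie_rep\<close>, in the same order.\<close>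

lemma rep_ext_relation:
  assumes r: "r \<in> uea_relations K L" and t: "t \<in> carrier T"
  shows "rep_ext t r = \<zero>\<^bsub>T\<^esub>"
proof -
  note [simp] = module_hom_minus[OF FAV.vectorspace_axioms T rep_ext_hom'] module_hom_smult[OF rep_ext_hom']
    word_closed
  have [simp]: "rep_ext t (c \<otimes>\<^bsub>FA\<^esub> d) = rep_ext (rep_ext t d) c" 
    if "c \<in> carrier FA" "d \<in> carrier FA" "t \<in> carrier T" for t c d using rep_ext_mult that by simp
  note [simp] = rep_ext_delta rep_closed bracket_closed
  note [simp del] = free_algebra_simps free_space_simps
  show ?thesis
    using r t unfolding uea_relations_def Let_def
    by (auto simp: rep_add rep_smult rep_bracket T.M.minus_minus_eq T.M.minus_self)
qed

lemma rep_ext_ideal: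
  assumes c: "c \<in> UI" and t: "t \<in> carrier T"
  shows "rep_ext t c = \<zero>\<^bsub>T\<^esub>"
proof -
  note [simp del] = free_algebra_simps free_space_simps
  \<comment> \<open>The annihilator of all of \<open>T\<close>, not of the single vector
    \<open>t\<close>: the product of \<open>a\<close> and \<open>x\<close> acts on a vector by
    letting \<open>a\<close> act on the image of that vector under \<open>x\<close>, so closure
    under right multiplication needs \<open>a\<close> to kill every vector.\<close>
  let ?J = "{c \<in> carrier FA. \<forall>t\<in>carrier T. rep_ext t c = \<zero>\<^bsub>T\<^esub>}"
  have mult: "rep_ext t (c \<otimes>\<^bsub>FA\<^esub> d) = rep_ext (rep_ext t d) c" 
    if "c \<in> carrier FA" "d \<in> carrier FA" "t \<in> carrier T" for t c d
    using rep_ext_mult that by (simp add: free_algebra_simps)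
  have zero: "rep_ext \<zero>\<^bsub>T\<^esub> c = \<zero>\<^bsub>T\<^esub>" if "c \<in> carrier FA" for c
    using module_hom_zero[OF T T rep_ext_hom_right] that by (simp add: free_algebra_simps)
  have sub: "subgroup ?J (add_monoid FA)"
  proof (rule subgroup.intro)
    fix x assume x: "x \<in> ?J"
    have "\<ominus>\<^bsub>T\<^esub> \<zero>\<^bsub>T\<^esub> = \<zero>\<^bsub>T\<^esub>" using T.M.r_neg[OF T.M.zero_closed] by simp
    then show "inv\<^bsub>add_monoid FA\<^esub> x \<in> ?J"
      using x module_hom_neg[OF FAV.vectorspace_axioms T rep_ext_hom'] 
      by (simp add: a_inv_def[symmetric])
  qed (auto simp: module_hom_add[OF rep_ext_hom'] module_hom_zero[OF FAV.vectorspace_axioms T rep_ext_hom'])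
  have "ideal ?J FA"
  proof (rule idealI[OF FA.ring_axioms sub])
    fix a x assume a: "a \<in> ?J" and x: "x \<in> carrier FA"
    show "x \<otimes>\<^bsub>FA\<^esub> a \<in> ?J"
      using a x by (auto simp: mult zero)
    show "a \<otimes>\<^bsub>FA\<^esub> x \<in> ?J"
      using a x by (auto simp: mult module_hom_in[OF rep_ext_hom'])
  qed
  then have "UI \<subseteq> ?J"
    unfolding uea_ideal_eq
    by (rule FA.genideal_minimal) (use uea_relations_carrier rep_ext_relation in auto)
  then show ?thesis using c t by auto
qed

text \<open>The orbit map u |-> u t of the induced U-action: since the ideal acts as zero, the
  action of the free algebra descends to the quotient.\<close>

lemma rep_lift:
  assumes t: "t \<in> carrier T"
  shows "(\<lambda>u. the_elem (rep_ext t ` u)) \<in> module_hom K UA T"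
    and "the_elem (rep_ext t ` \<one>\<^bsub>UA\<^esub>) = t"
    and "\<lbrakk>x \<in> carrier L; u \<in> carrier UA\<rbrakk> \<Longrightarrow>
      the_elem (rep_ext t ` (\<iota> x \<otimes>\<^bsub>UA\<^esub> u)) = f x (the_elem (rep_ext t ` u))"
proof -
  have te: "the_elem (rep_ext t ` (UI +>\<^bsub>FA\<^esub> c)) = rep_ext t c" if "c \<in> carrier FA" for c
    by (rule the_elem_coset[OF FAV.vectorspace_axioms UI_submodule T rep_ext_hom'[OF t] rep_ext_ideal[OF _ t] that])
  show "(\<lambda>u. the_elem (rep_ext t ` u)) \<in> module_hom K UA T"
    unfolding uea_algebra_def
    by (rule the_elem_hom[OF FAV.vectorspace_axioms UI_submodule T rep_ext_hom'[OF t] rep_ext_ideal[OF _ t]])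
  show "the_elem (rep_ext t ` \<one>\<^bsub>UA\<^esub>) = t"
    unfolding uea_algebra_one using te[OF word_closed, of "[]"] t by (simp add: rep_ext_delta)
  assume x: "x \<in> carrier L" and u: "u \<in> carrier UA"
  from u obtain c where c: "c \<in> carrier FA" "u = UI +>\<^bsub>FA\<^esub> c" by (rule uea_algebra_carrier_E)
  have dx: "delta K [x] \<in> carrier FA" using x by (intro word_closed) simp
  have "the_elem (rep_ext t ` (\<iota> x \<otimes>\<^bsub>UA\<^esub> u)) = rep_ext t (delta K [x] \<otimes>\<^bsub>FA\<^esub> c)"
    unfolding c(2) uea_incl_def uea_coset_mult[OF dx c(1)] by (rule te[OF FA.m_closed[OF dx c(1)]])
  also have "\<dots> = rep_ext (rep_ext t c) (delta K [x])"
    using c dx t by (intro rep_ext_mult) simp_all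
  also have "\<dots> = f x (rep_ext t c)"
    using x module_hom_in[OF rep_ext_hom'[OF t] c(1)] by (simp add: rep_ext_delta)
  also have "rep_ext t c = the_elem (rep_ext t ` u)"
    unfolding c(2) by (rule te[OF c(1), symmetric])
  finally show "the_elem (rep_ext t ` (\<iota> x \<otimes>\<^bsub>UA\<^esub> u)) = f x (the_elem (rep_ext t ` u))" .
qed

end

context
  fixes A :: "('k, 'z, 'e) module_scheme" and f :: "'g \<Rightarrow> 'z"
  assumes A: "vectorspace K A" and rep: "lie_rep K L A (\<lambda>x z. f x \<otimes>\<^bsub>A\<^esub> z)" and one: "\<one>\<^bsub>A\<^esub> \<in> carrier A"
begin

text \<open>\<open>A\<close> is acted on by left multiplication with f x, and
  \<open>uea_lift\<close> is the orbit map of its unit.\<close>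

lemma uea_lift_hom: "uea_lift K A f \<in> module_hom K UA A"
  and uea_lift_one: "uea_lift K A f \<one>\<^bsub>UA\<^esub> = \<one>\<^bsub>A\<^esub>"
  and uea_lift_mult: "\<lbrakk>x \<in> carrier L; u \<in> carrier UA\<rbrakk> \<Longrightarrow>
    uea_lift K A f (\<iota> x \<otimes>\<^bsub>UA\<^esub> u) = f x \<otimes>\<^bsub>A\<^esub> uea_lift K A f u"
  using rep_lift[OF A rep one] by (simp_all add: uea_lift_def[abs_def])

end

end

section \<open>The Hopf algebra structure of the enveloping algebra\<close>

text \<open>The interface between the two halves of the proof: the filtration argument sees U only
  through these properties, without cosets of the free algebra. The formula in
  \<open>comult_mult\<close> is \<Delta>(x u) = (x \<otimes> 1 + 1 \<otimes> x) \<Delta> u, and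
  \<open>generated\<close> is the induction principle over left multiplication by
  primitives.\<close>

locale primitively_generated = vectorspace K H
  for K :: "('k, 'r) ring_scheme" and H :: "('k, 'h, 'c) hopf_algebra_scheme" and P :: "'h set" +
  assumes mult_bilinear: "bilinear_map K H H H (mult H)"
    and one_closed_H: "\<one>\<^bsub>H\<^esub> \<in> carrier H"
    and one_left: "u \<in> carrier H \<Longrightarrow> \<one>\<^bsub>H\<^esub> \<otimes>\<^bsub>H\<^esub> u = u"
    and one_right: "u \<in> carrier H \<Longrightarrow> u \<otimes>\<^bsub>H\<^esub> \<one>\<^bsub>H\<^esub> = u"
    and primitive_closed: "x \<in> P \<Longrightarrow> x \<in> carrier H"
    and comult_hom: "comult H \<in> module_hom K H (tensor K H H)"
    and comult_one: "comult H \<one>\<^bsub>H\<^esub> = pure_tensor K H H \<one>\<^bsub>H\<^esub> \<one>\<^bsub>H\<^esub>"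
    and comult_mult: "\<lbrakk>x \<in> P; u \<in> carrier H\<rbrakk> \<Longrightarrow> comult H (x \<otimes>\<^bsub>H\<^esub> u) =
      tensor_map K H H (\<lambda>a. x \<otimes>\<^bsub>H\<^esub> a) (\<lambda>b. b) (comult H u) \<oplus>\<^bsub>tensor K H H\<^esub>
      tensor_map K H H (\<lambda>a. a) (\<lambda>b. x \<otimes>\<^bsub>H\<^esub> b) (comult H u)"
    and counit_hom: "counit H \<in> module_hom K H (ground_algebra K)"
    and counit_one: "counit H \<one>\<^bsub>H\<^esub> = \<one>\<^bsub>K\<^esub>"
    and antipode_hom: "antipode H \<in> module_hom K H H"
    and antipode_one: "antipode H \<one>\<^bsub>H\<^esub> = \<one>\<^bsub>H\<^esub>"
    and antipode_primitive: "x \<in> P \<Longrightarrow> antipode H x = \<ominus>\<^bsub>H\<^esub> x"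
    and generated: "\<lbrakk>submodule K N H; \<one>\<^bsub>H\<^esub> \<in> N; \<And>x u. \<lbrakk>x \<in> P; u \<in> N\<rbrakk> \<Longrightarrow> x \<otimes>\<^bsub>H\<^esub> u \<in> N;
      u \<in> carrier H\<rbrakk> \<Longrightarrow> u \<in> N"

section \<open>Comultiplication, counit and antipode of the enveloping algebra\<close>

context lie_algebra
begin

abbreviation "UT \<equiv> tensor K UA UA"
abbreviation "TP \<equiv> tensor_algebra_product K UA UA"
abbreviation "pt \<equiv> pure_tensor K UA UA"

lemma uea_algebra_ring: "ring UA"
proof (rule ringI)
  show "abelian_group UA" by (rule UV.M.abelian_group_axioms)
  show "Group.monoid UA"
    by (rule monoidI) (auto simp: uea_m_assoc uea_one_left uea_one_right uea_one_closed bilinear_map_in[OF uea_mult_bilinear])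
qed (auto simp: module_hom_add[OF bilinear_map_left[OF uea_mult_bilinear]]
    module_hom_add[OF bilinear_map_right[OF uea_mult_bilinear]])

sublocale UR: ring UA by (rule uea_algebra_ring)
sublocale UT: vectorspace K UT by (rule tensor_vectorspace[OF UV.vectorspace_axioms UV.vectorspace_axioms])

lemma TP_simps [simp]:
  "carrier TP = carrier UT" "\<zero>\<^bsub>TP\<^esub> = \<zero>\<^bsub>UT\<^esub>" "add TP = add UT" "smult TP = smult UT"
  "\<one>\<^bsub>TP\<^esub> = pt \<one>\<^bsub>UA\<^esub> \<one>\<^bsub>UA\<^esub>"
  by (simp_all add: tensor_algebra_product_def Let_def)

text \<open>For fixed a and b the inner lift is the tensor product of the left multiplications by a
  and by b.\<close>

lemma TP_mult: "s \<otimes>\<^bsub>TP\<^esub> t = tensor_lift K UT (\<lambda>a b. tensor_map K UA UA (mult UA a) (mult UA b) t) s"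
  by (simp add: tensor_algebra_product_def Let_def tensor_map_def)

lemma TP_vectorspace: "vectorspace K TP"
  by (rule vectorspace_cong[OF UT.vectorspace_axioms]) simp_all

lemma TP_hom: "module_hom K TP TP = module_hom K UT UT"
  by (simp add: module_hom_def)

lemma TP_minus: "a_minus TP s t = a_minus UT s t"
  by (simp add: a_minus_def a_inv_def)

lemmas uea_mult_left_hom = bilinear_map_left[OF uea_mult_bilinear]
  and uea_mult_right_hom = bilinear_map_right[OF uea_mult_bilinear]

lemmas UUT = UV.vectorspace_axioms UV.vectorspace_axioms
lemmas UTV = UT.vectorspace_axioms

lemma TP_mult_bilinear:
  assumes t: "t \<in> carrier UT"
  shows "bilinear_map K UA UA UT (\<lambda>a b. tensor_map K UA UA (mult UA a) (mult UA b) t)"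
proof (rule bilinear_mapI)
  note pb = pure_tensor_bilinear[OF UUT]
  have bil: "bilinear_map K UA UA UT (\<lambda>a' b'. pt (a \<otimes>\<^bsub>UA\<^esub> a') (b \<otimes>\<^bsub>UA\<^esub> b'))"
    if "a \<in> carrier UA" "b \<in> carrier UA" for a b
    using that by (intro bilinear_map_comp[OF pb] uea_mult_right_hom)
  fix a assume a: "a \<in> carrier UA"
  show "(\<lambda>b. tensor_map K UA UA (mult UA a) (mult UA b) t) \<in> module_hom K UA UT"
    unfolding tensor_map_def
  proof (rule bilinear_map_left[OF tensor_lift_bilinear[OF UUT UTV _ bil[OF a] UV.vectorspace_axioms] t])
    show "(\<lambda>x. pt (a \<otimes>\<^bsub>UA\<^esub> v) (x \<otimes>\<^bsub>UA\<^esub> w)) \<in> module_hom K UA UT"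
      if "v \<in> carrier UA" "w \<in> carrier UA" for v w
      using a that by (intro module_hom_comp[OF uea_mult_left_hom bilinear_map_right[OF pb]]) auto
  qed
next
  note pb = pure_tensor_bilinear[OF UUT]
  have bil: "bilinear_map K UA UA UT (\<lambda>a' b'. pt (a \<otimes>\<^bsub>UA\<^esub> a') (b \<otimes>\<^bsub>UA\<^esub> b'))"
    if "a \<in> carrier UA" "b \<in> carrier UA" for a b
    using that by (intro bilinear_map_comp[OF pb] uea_mult_right_hom)
  fix b assume b: "b \<in> carrier UA"
  show "(\<lambda>a. tensor_map K UA UA (mult UA a) (mult UA b) t) \<in> module_hom K UA UT"
    unfolding tensor_map_def
  proof (rule bilinear_map_left[OF tensor_lift_bilinear[OF UUT UTV _ bil[OF _ b] UV.vectorspace_axioms] t])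
    show "(\<lambda>x. pt (x \<otimes>\<^bsub>UA\<^esub> v) (b \<otimes>\<^bsub>UA\<^esub> w)) \<in> module_hom K UA UT"
      if "v \<in> carrier UA" "w \<in> carrier UA" for v w
      using b that by (intro module_hom_comp[OF uea_mult_left_hom bilinear_map_left[OF pb]]) auto
  qed
qed

lemma TP_mult_pure:
  assumes "a \<in> carrier UA" "b \<in> carrier UA" "a' \<in> carrier UA" "b' \<in> carrier UA"
  shows "pt a b \<otimes>\<^bsub>TP\<^esub> pt a' b' = pt (a \<otimes>\<^bsub>UA\<^esub> a') (b \<otimes>\<^bsub>UA\<^esub> b')"
  unfolding TP_mult using assms
  by (simp add: tensor_lift_pure[OF UUT UTV TP_mult_bilinear] pure_tensor_closed[OF UUT]
      tensor_map_pure[OF UUT UUT uea_mult_right_hom uea_mult_right_hom])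

lemma TP_mult_hom: "s \<in> carrier UT \<Longrightarrow> mult TP s \<in> module_hom K UT UT"
proof -
  assume s: "s \<in> carrier UT"
  have "bilinear_map K UT UT UT (\<lambda>t s. tensor_lift K UT (\<lambda>a b. tensor_map K UA UA (mult UA a) (mult UA b) t) s)"
    by (rule tensor_lift_bilinear[OF UUT UTV _ TP_mult_bilinear UTV])
      (intro tensor_map_hom[OF UUT UUT] uea_mult_right_hom)
  from bilinear_map_left[OF this s] show ?thesis by (simp add: TP_mult[abs_def])
qed

lemma TP_mult_add:
  "\<lbrakk>s \<in> carrier UT; s' \<in> carrier UT; t \<in> carrier UT\<rbrakk> \<Longrightarrow> (s \<oplus>\<^bsub>UT\<^esub> s') \<otimes>\<^bsub>TP\<^esub> t = s \<otimes>\<^bsub>TP\<^esub> t \<oplus>\<^bsub>UT\<^esub> s' \<otimes>\<^bsub>TP\<^esub> t"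
  unfolding TP_mult by (rule module_hom_add[OF tensor_lift_hom[OF UUT UTV TP_mult_bilinear]])

lemma TP_mult_smult:
  "\<lbrakk>a \<in> carrier K; s \<in> carrier UT; t \<in> carrier UT\<rbrakk> \<Longrightarrow> (a \<odot>\<^bsub>UT\<^esub> s) \<otimes>\<^bsub>TP\<^esub> t = a \<odot>\<^bsub>UT\<^esub> (s \<otimes>\<^bsub>TP\<^esub> t)"
  unfolding TP_mult by (rule module_hom_smult[OF tensor_lift_hom[OF UUT UTV TP_mult_bilinear]])

abbreviation "prim x \<equiv> pt (\<iota> x) \<one>\<^bsub>UA\<^esub> \<oplus>\<^bsub>UT\<^esub> pt \<one>\<^bsub>UA\<^esub> (\<iota> x)"

lemma prim_closed: "x \<in> carrier L \<Longrightarrow> prim x \<in> carrier UT"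
  by (simp add: pure_tensor_closed[OF UUT] uea_incl_closed)

lemma prim_hom: "(\<lambda>x. prim x) \<in> module_hom K L UT"
  by (intro module_hom_plus[OF UTV] module_hom_comp[OF uea_incl_hom]
      pure_tensor_hom_left[OF UUT] pure_tensor_hom_right[OF UUT]) simp_all

lemma prim_mult_pure:
  assumes "x \<in> carrier L" "a \<in> carrier UA" "b \<in> carrier UA"
  shows "prim x \<otimes>\<^bsub>TP\<^esub> pt a b = pt (\<iota> x \<otimes>\<^bsub>UA\<^esub> a) b \<oplus>\<^bsub>UT\<^esub> pt a (\<iota> x \<otimes>\<^bsub>UA\<^esub> b)"
  using assms by (simp add: TP_mult_add TP_mult_pure pure_tensor_closed[OF UUT] uea_incl_closed)

lemma prim_mult:
  assumes x: "x \<in> carrier L" and t: "t \<in> carrier UT"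
  shows "prim x \<otimes>\<^bsub>TP\<^esub> t =
    tensor_map K UA UA (\<lambda>a. \<iota> x \<otimes>\<^bsub>UA\<^esub> a) (\<lambda>b. b) t \<oplus>\<^bsub>UT\<^esub> tensor_map K UA UA (\<lambda>a. a) (\<lambda>b. \<iota> x \<otimes>\<^bsub>UA\<^esub> b) t"
proof -
  note h = uea_mult_right_hom[OF uea_incl_closed[OF x]]
  show ?thesis
    by (rule tensor_hom_eqI[OF UUT UTV TP_mult_hom[OF prim_closed[OF x]]
        module_hom_plus[OF UTV tensor_map_hom[OF UUT UUT h module_hom_id]
          tensor_map_hom[OF UUT UUT module_hom_id h]] _ t])
      (simp add: prim_mult_pure x tensor_map_pure[OF UUT UUT h module_hom_id]
         tensor_map_pure[OF UUT UUT module_hom_id h])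
qed

text \<open>On a pure tensor, acting by y and then by x yields x y a \<otimes> b + y a \<otimes> x b
  + x a \<otimes> y b + a \<otimes> x y b. The two mixed terms are exchanged when x and y are, so
  they cancel in the commutator.\<close>

lemma prim_rep: "lie_rep K L TP (\<lambda>x z. prim x \<otimes>\<^bsub>TP\<^esub> z)"
proof -
  have "prim (bracket L x y) \<otimes>\<^bsub>TP\<^esub> t = prim x \<otimes>\<^bsub>TP\<^esub> (prim y \<otimes>\<^bsub>TP\<^esub> t) \<ominus>\<^bsub>UT\<^esub> prim y \<otimes>\<^bsub>TP\<^esub> (prim x \<otimes>\<^bsub>TP\<^esub> t)"
    if x: "x \<in> carrier L" and y: "y \<in> carrier L" and t: "t \<in> carrier UT" for x y t
  proof -
    note px = TP_mult_hom[OF prim_closed[OF x]] and py = TP_mult_hom[OF prim_closed[OF y]]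
    show ?thesis
    proof (rule tensor_hom_eqI[OF UUT UTV TP_mult_hom[OF prim_closed[OF bracket_closed[OF x y]]]
          module_hom_diff[OF UTV module_hom_comp[OF py px] module_hom_comp[OF px py]] _ t])
      fix a b assume ab: "a \<in> carrier UA" "b \<in> carrier UA"
      let ?x = "\<iota> x" and ?y = "\<iota> y"
      have c: "?x \<in> carrier UA" "?y \<in> carrier UA" using x y by (auto intro: uea_incl_closed)
      define p q r s where "p = pt (?x \<otimes>\<^bsub>UA\<^esub> (?y \<otimes>\<^bsub>UA\<^esub> a)) b" and "q = pt (?y \<otimes>\<^bsub>UA\<^esub> (?x \<otimes>\<^bsub>UA\<^esub> a)) b"
        and "r = pt a (?x \<otimes>\<^bsub>UA\<^esub> (?y \<otimes>\<^bsub>UA\<^esub> b))" and "s = pt a (?y \<otimes>\<^bsub>UA\<^esub> (?x \<otimes>\<^bsub>UA\<^esub> b))"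
      define g h where "g = pt (?y \<otimes>\<^bsub>UA\<^esub> a) (?x \<otimes>\<^bsub>UA\<^esub> b)" and "h = pt (?x \<otimes>\<^bsub>UA\<^esub> a) (?y \<otimes>\<^bsub>UA\<^esub> b)"
      note defs = p_def q_def r_def s_def g_def h_def
      have C: "p \<in> carrier UT" "q \<in> carrier UT" "r \<in> carrier UT" "s \<in> carrier UT" "g \<in> carrier UT" "h \<in> carrier UT"
        unfolding defs using ab c by (auto intro!: pure_tensor_closed[OF UUT])
      have br: "\<iota> (bracket L x y) \<otimes>\<^bsub>UA\<^esub> z = ?x \<otimes>\<^bsub>UA\<^esub> (?y \<otimes>\<^bsub>UA\<^esub> z) \<ominus>\<^bsub>UA\<^esub> ?y \<otimes>\<^bsub>UA\<^esub> (?x \<otimes>\<^bsub>UA\<^esub> z)"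
        if "z \<in> carrier UA" for z
        unfolding uea_incl_bracket[OF x y] using c that
        by (simp add: UV.M.minus_eq UR.l_distr UR.l_minus UR.m_assoc)
      have "prim (bracket L x y) \<otimes>\<^bsub>TP\<^esub> pt a b = (p \<ominus>\<^bsub>UT\<^esub> q) \<oplus>\<^bsub>UT\<^esub> (r \<ominus>\<^bsub>UT\<^esub> s)"
        using ab c by (simp add: prim_mult_pure[OF bracket_closed[OF x y]] br defs
            pure_tensor_minus_left[OF UUT] pure_tensor_minus_right[OF UUT])
      \<comment> \<open>The mixed terms \<open>g\<close> and \<open>h\<close> are inserted as a
        difference equal to zero, so that the sum can be regrouped into the two iterated
        actions.\<close>
      also have "\<dots> = ((p \<ominus>\<^bsub>UT\<^esub> q) \<oplus>\<^bsub>UT\<^esub> (r \<ominus>\<^bsub>UT\<^esub> s)) \<oplus>\<^bsub>UT\<^esub> ((g \<oplus>\<^bsub>UT\<^esub> h) \<ominus>\<^bsub>UT\<^esub> (g \<oplus>\<^bsub>UT\<^esub> h))"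
        using C by (simp add: UT.M.minus_eq UT.M.r_neg)
      also have "\<dots> = ((p \<oplus>\<^bsub>UT\<^esub> g) \<oplus>\<^bsub>UT\<^esub> (h \<oplus>\<^bsub>UT\<^esub> r)) \<ominus>\<^bsub>UT\<^esub> ((q \<oplus>\<^bsub>UT\<^esub> h) \<oplus>\<^bsub>UT\<^esub> (g \<oplus>\<^bsub>UT\<^esub> s))"
        using C by (simp add: UT.M.minus_eq UT.M.minus_add UT.M.a_ac)
      also have "\<dots> = prim x \<otimes>\<^bsub>TP\<^esub> (prim y \<otimes>\<^bsub>TP\<^esub> pt a b) \<ominus>\<^bsub>UT\<^esub> prim y \<otimes>\<^bsub>TP\<^esub> (prim x \<otimes>\<^bsub>TP\<^esub> pt a b)"
        using ab c x y by (simp add: prim_mult_pure module_hom_add[OF px] module_hom_add[OF py] defs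
            pure_tensor_closed[OF UUT])
      finally show "prim (bracket L x y) \<otimes>\<^bsub>TP\<^esub> pt a b =
        prim x \<otimes>\<^bsub>TP\<^esub> (prim y \<otimes>\<^bsub>TP\<^esub> pt a b) \<ominus>\<^bsub>UT\<^esub> prim y \<otimes>\<^bsub>TP\<^esub> (prim x \<otimes>\<^bsub>TP\<^esub> pt a b)" .
    qed
  qed
  then show ?thesis
    unfolding lie_rep_def TP_hom TP_simps TP_minus
    by (auto simp: module_hom_add[OF prim_hom] module_hom_smult[OF prim_hom] TP_mult_add TP_mult_smult
        prim_closed intro: TP_mult_hom)
qed

lemma zero_rep: "lie_rep K L (ground_algebra K) (\<lambda>x z. \<zero>\<^bsub>K\<^esub> \<otimes>\<^bsub>ground_algebra K\<^esub> z)"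
proof -
  interpret G: vectorspace K "ground_algebra K" by (rule ground_algebra_vectorspace)
  have "\<zero>\<^bsub>K\<^esub> \<ominus>\<^bsub>ground_algebra K\<^esub> \<zero>\<^bsub>K\<^esub> = \<zero>\<^bsub>K\<^esub>"
    using G.M.r_neg[OF G.M.zero_closed] by (simp add: G.M.minus_eq)
  then show ?thesis by (auto simp: lie_rep_def module_hom_def)
qed

abbreviation "UO \<equiv> opposite_algebra UA"

lemma UO_simps [simp]:
  "carrier UO = carrier UA" "\<zero>\<^bsub>UO\<^esub> = \<zero>\<^bsub>UA\<^esub>" "add UO = add UA" "smult UO = smult UA"
  "\<one>\<^bsub>UO\<^esub> = \<one>\<^bsub>UA\<^esub>" "u \<otimes>\<^bsub>UO\<^esub> v = v \<otimes>\<^bsub>UA\<^esub> u"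
  by (simp_all add: opposite_algebra_def)

lemma UO_vectorspace: "vectorspace K UO"
  by (rule vectorspace_cong[OF UV.vectorspace_axioms]) simp_all

text \<open>Passing to the opposite algebra changes the sign of commutators, and x |-> -x
  compensates for it: the commutator of -x and -y in the opposite algebra is -[x, y].\<close>

lemma antipode_rep: "lie_rep K L UO (\<lambda>x z. (\<ominus>\<^bsub>UA\<^esub> \<iota> x) \<otimes>\<^bsub>UO\<^esub> z)"
proof -
  have m: "a_minus UO u v = a_minus UA u v" for u v by (simp add: a_minus_def a_inv_def)
  have h: "module_hom K UO UO = module_hom K UA UA" by (simp add: module_hom_def)
  show ?thesis
    unfolding lie_rep_def h UO_simps m
  proof (intro conjI ballI)
    fix x assume x: "x \<in> carrier L"
    then show "(\<lambda>z. z \<otimes>\<^bsub>UA\<^esub> (\<ominus>\<^bsub>UA\<^esub> \<iota> x)) \<in> module_hom K UA UA"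
      by (intro uea_mult_left_hom) (simp add: uea_incl_closed)
    fix y t assume y: "y \<in> carrier L" and t: "t \<in> carrier UA"
    have c: "\<iota> x \<in> carrier UA" "\<iota> y \<in> carrier UA" using x y by (auto intro: uea_incl_closed)
    show "t \<otimes>\<^bsub>UA\<^esub> (\<ominus>\<^bsub>UA\<^esub> \<iota> (x \<oplus>\<^bsub>L\<^esub> y)) = t \<otimes>\<^bsub>UA\<^esub> (\<ominus>\<^bsub>UA\<^esub> \<iota> x) \<oplus>\<^bsub>UA\<^esub> t \<otimes>\<^bsub>UA\<^esub> (\<ominus>\<^bsub>UA\<^esub> \<iota> y)"
      using c t x y by (simp add: module_hom_add[OF uea_incl_hom] UV.M.minus_add UR.r_distr UR.r_minus)
    show "t \<otimes>\<^bsub>UA\<^esub> (\<ominus>\<^bsub>UA\<^esub> \<iota> (bracket L x y)) =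
        t \<otimes>\<^bsub>UA\<^esub> (\<ominus>\<^bsub>UA\<^esub> \<iota> y) \<otimes>\<^bsub>UA\<^esub> (\<ominus>\<^bsub>UA\<^esub> \<iota> x) \<ominus>\<^bsub>UA\<^esub> t \<otimes>\<^bsub>UA\<^esub> (\<ominus>\<^bsub>UA\<^esub> \<iota> x) \<otimes>\<^bsub>UA\<^esub> (\<ominus>\<^bsub>UA\<^esub> \<iota> y)"
      unfolding uea_incl_bracket[OF x y]
      using c t by (simp add: UV.M.minus_eq UV.M.minus_add UR.r_distr UR.r_minus UR.l_minus UR.m_assoc UV.M.a_comm)
  next
    fix a x t assume a: "a \<in> carrier K" and x: "x \<in> carrier L" and t: "t \<in> carrier UA"
    have c: "\<iota> x \<in> carrier UA" using x by (rule uea_incl_closed)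
    have "\<ominus>\<^bsub>UA\<^esub> \<iota> (a \<odot>\<^bsub>L\<^esub> x) = a \<odot>\<^bsub>UA\<^esub> (\<ominus>\<^bsub>UA\<^esub> \<iota> x)"
      using a x c by (simp add: module_hom_smult[OF uea_incl_hom] UV.smult_r_minus)
    then show "t \<otimes>\<^bsub>UA\<^esub> (\<ominus>\<^bsub>UA\<^esub> \<iota> (a \<odot>\<^bsub>L\<^esub> x)) = a \<odot>\<^bsub>UA\<^esub> (t \<otimes>\<^bsub>UA\<^esub> (\<ominus>\<^bsub>UA\<^esub> \<iota> x))"
      using a c t by (simp add: module_hom_smult[OF uea_mult_right_hom[OF t]])
  qed
qed

abbreviation "UH \<equiv> uea K L"

lemma uea_simps [simp]:
  "carrier UH = carrier UA" "\<zero>\<^bsub>UH\<^esub> = \<zero>\<^bsub>UA\<^esub>" "add UH = add UA" "smult UH = smult UA"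
  "\<one>\<^bsub>UH\<^esub> = \<one>\<^bsub>UA\<^esub>" "mult UH = mult UA"
  by (simp_all add: uea_def Let_def module.defs)

lemma uea_maps:
  "comult UH = uea_lift K TP (\<lambda>x. prim x)"
  "counit UH = uea_lift K (ground_algebra K) (\<lambda>_. \<zero>\<^bsub>K\<^esub>)"
  "antipode UH = uea_lift K UO (\<lambda>x. \<ominus>\<^bsub>UA\<^esub> \<iota> x)"
  by (simp_all add: uea_def Let_def module.defs)

text \<open>The records \<open>UA\<close> and \<open>UH\<close> have different types, but the tensor
  constructions read only carrier, addition and scalar multiplication, which agree.\<close>

lemma uea_tensor:
  "tensor K UH UH = UT" "pure_tensor K UH UH = pt" "tensor_map K UH UH = tensor_map K UA UA"
proof -
  have k: "tensor_kernel K UH UH = tensor_kernel K UA UA"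
    by (simp add: tensor_kernel_def tensor_relations_def)
  then show p: "pure_tensor K UH UH = pt" by (simp add: pure_tensor_def fun_eq_iff)
  show t: "tensor K UH UH = UT" using k by (simp add: tensor_def)
  show "tensor_map K UH UH = tensor_map K UA UA" by (simp add: tensor_map_def fun_eq_iff p t)
qed

lemma uea_hom_cong: 
  "module_hom K UH Z = module_hom K UA Z" "module_hom K Y UH = module_hom K Y UA"
  by (simp_all add: module_hom_def)

lemma uea_vectorspace: "vectorspace K UH"
  by (rule vectorspace_cong[OF UV.vectorspace_axioms]) simp_all

lemma uea_submodule: "submodule K N UH \<longleftrightarrow> submodule K N UA"
  using uea_vectorspace UV.vectorspace_axioms by (auto simp: submodule_def vectorspace_def)

text \<open>\<Delta>, \<epsilon> and S are the lifts attached to \<open>prim_rep\<close>,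
  \<open>zero_rep\<close> and \<open>antipode_rep\<close>. Their values on 1 come from
  \<open>uea_lift_one\<close>, and the formulas for \<Delta>(x u) and S x come from
  \<open>uea_lift_mult\<close>.\<close>

lemma uea_primitively_generated: "primitively_generated K UH (\<iota> ` carrier L)"
proof (rule primitively_generated.intro[OF uea_vectorspace], unfold_locales,
    unfold uea_hom_cong uea_simps uea_tensor)
  have one: "\<one>\<^bsub>TP\<^esub> \<in> carrier TP" by (simp add: pure_tensor_closed[OF UUT])
  note D = TP_vectorspace prim_rep one
  have one': "\<one>\<^bsub>ground_algebra K\<^esub> \<in> carrier (ground_algebra K)" by simp
  note E = ground_algebra_vectorspace zero_rep one'
  have one'': "\<one>\<^bsub>UO\<^esub> \<in> carrier UO" by simp
  note S = UO_vectorspace antipode_rep one''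
  show "bilinear_map K UH UH UH (mult UA)"
    using uea_mult_bilinear by (simp add: bilinear_map_def uea_hom_cong)
  have Dh: "comult UH \<in> module_hom K UA UT"
    using uea_lift_hom[OF D] by (simp add: uea_maps module_hom_def)
  then show "comult UH \<in> module_hom K UA UT" .
  show "comult UH \<one>\<^bsub>UA\<^esub> = pt \<one>\<^bsub>UA\<^esub> \<one>\<^bsub>UA\<^esub>"
    using uea_lift_one[OF D] by (simp add: uea_maps)
  show "comult UH (x \<otimes>\<^bsub>UA\<^esub> u) =
      tensor_map K UA UA (\<lambda>a. x \<otimes>\<^bsub>UA\<^esub> a) (\<lambda>b. b) (comult UH u) \<oplus>\<^bsub>UT\<^esub>
      tensor_map K UA UA (\<lambda>a. a) (\<lambda>b. x \<otimes>\<^bsub>UA\<^esub> b) (comult UH u)"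
    if "x \<in> \<iota> ` carrier L" and u: "u \<in> carrier UA" for x u
  proof -
    from that obtain y where y: "y \<in> carrier L" "x = \<iota> y" by auto
    have "comult UH (x \<otimes>\<^bsub>UA\<^esub> u) = prim y \<otimes>\<^bsub>TP\<^esub> comult UH u"
      using uea_lift_mult[OF D y(1) u] by (simp add: uea_maps y)
    then show ?thesis using prim_mult[OF y(1) module_hom_in[OF Dh u]] by (simp add: y)
  qed
  show "counit UH \<in> module_hom K UA (ground_algebra K)"
    using uea_lift_hom[OF E] by (simp add: uea_maps)
  show "counit UH \<one>\<^bsub>UA\<^esub> = \<one>\<^bsub>K\<^esub>"
    using uea_lift_one[OF E] by (simp add: uea_maps)
  show "antipode UH \<in> module_hom K UA UA"
    using uea_lift_hom[OF S] by (simp add: uea_maps module_hom_def)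
  show a1: "antipode UH \<one>\<^bsub>UA\<^esub> = \<one>\<^bsub>UA\<^esub>"
    using uea_lift_one[OF S] by (simp add: uea_maps)
  show "antipode UH x = \<ominus>\<^bsub>UH\<^esub> x" if "x \<in> \<iota> ` carrier L" for x
  proof -
    from that obtain y where y: "y \<in> carrier L" "x = \<iota> y" by auto
    have x: "x \<in> carrier UA" using y by (simp add: uea_incl_closed)
    have "antipode UH x = \<ominus>\<^bsub>UA\<^esub> x"
      using uea_lift_mult[OF S y(1) UR.one_closed] a1 x by (simp add: uea_maps y)
    \<comment> \<open>Negation is computed in each record separately; the identity, being linear
      from \<open>UA\<close> to \<open>UH\<close>, matches the two.\<close>
    also have "\<dots> = \<ominus>\<^bsub>UH\<^esub> x"
      using module_hom_neg[OF UV.vectorspace_axioms uea_vectorspace _ x, of "\<lambda>x. x"] module_hom_id[of K UA]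
      by (simp add: uea_hom_cong)
    finally show ?thesis .
  qed
  show "u \<in> N" if "submodule K N UH" "\<one>\<^bsub>UA\<^esub> \<in> N"
     "\<And>x u. x \<in> \<iota> ` carrier L \<Longrightarrow> u \<in> N \<Longrightarrow> x \<otimes>\<^bsub>UA\<^esub> u \<in> N" "u \<in> carrier UA" for N u
    using uea_generated[of N u] that by (auto simp: uea_submodule)
qed (auto simp: uea_incl_closed)

end

section \<open>Reassociation of triple tensor products\<close>

lemma tensor_lift_family_hom:
  assumes "vectorspace K V" "vectorspace K W" "vectorspace K Z" "vectorspace K X"
    and "\<And>v w. \<lbrakk>v \<in> carrier V; w \<in> carrier W\<rbrakk> \<Longrightarrow> (\<lambda>x. f x v w) \<in> module_hom K X Z"
    and "\<And>x. x \<in> carrier X \<Longrightarrow> bilinear_map K V W Z (f x)"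
    and "t \<in> carrier (tensor K V W)"
  shows "(\<lambda>x. tensor_lift K Z (f x) t) \<in> module_hom K X Z"
  using bilinear_map_left[OF tensor_lift_bilinear[OF assms(1-3,5,6,4)] assms(7)] .

context
  fixes K :: "('k, 'r) ring_scheme" and U :: "('k, 'u, 'b) module_scheme"
    and V :: "('k, 'v, 'c) module_scheme" and W :: "('k, 'w, 'd) module_scheme"
  assumes U: "vectorspace K U" and V: "vectorspace K V" and W: "vectorspace K W"
begin

lemmas tensor_vectorspaces =
  tensor_vectorspace[OF U V] tensor_vectorspace[OF V W]
  tensor_vectorspace[OF U tensor_vectorspace[OF V W]]
  tensor_vectorspace[OF tensor_vectorspace[OF U V] W]

lemma assoc_inner_bilinear:
  assumes w: "w \<in> carrier W"
  shows "bilinear_map K U V (tensor K U (tensor K V W))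
    (\<lambda>u v. pure_tensor K U (tensor K V W) u (pure_tensor K V W v w))"
  by (rule bilinear_map_comp[OF pure_tensor_bilinear[OF U tensor_vectorspaces(2)] module_hom_id
        pure_tensor_hom_left[OF V W w]])

lemma assoc_bilinear:
  "bilinear_map K (tensor K U V) W (tensor K U (tensor K V W)) (\<lambda>s w.
    tensor_lift K (tensor K U (tensor K V W))
      (\<lambda>u v. pure_tensor K U (tensor K V W) u (pure_tensor K V W v w)) s)"
proof (rule bilinear_mapI)
  fix s assume s: "s \<in> carrier (tensor K U V)"
  show "(\<lambda>w. tensor_lift K (tensor K U (tensor K V W))
      (\<lambda>u v. pure_tensor K U (tensor K V W) u (pure_tensor K V W v w)) s)
      \<in> module_hom K W (tensor K U (tensor K V W))"
    by (rule tensor_lift_family_hom[OF U V tensor_vectorspaces(3) W _ assoc_inner_bilinear s])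
      (rule module_hom_comp[OF pure_tensor_hom_right[OF V W] pure_tensor_hom_right[OF U tensor_vectorspaces(2)]])
qed (rule tensor_lift_hom[OF U V tensor_vectorspaces(3) assoc_inner_bilinear])

lemma tensor_assoc_hom: "tensor_assoc K U V W \<in>
    module_hom K (tensor K (tensor K U V) W) (tensor K U (tensor K V W))"
  unfolding tensor_assoc_def Let_def
  by (rule tensor_lift_hom[OF tensor_vectorspaces(1) W tensor_vectorspaces(3) assoc_bilinear])

lemma tensor_assoc_pure_right:
  "\<lbrakk>s \<in> carrier (tensor K U V); w \<in> carrier W\<rbrakk> \<Longrightarrow>
    tensor_assoc K U V W (pure_tensor K (tensor K U V) W s w) =
    tensor_lift K (tensor K U (tensor K V W))
      (\<lambda>u v. pure_tensor K U (tensor K V W) u (pure_tensor K V W v w)) s"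
  unfolding tensor_assoc_def Let_def
  by (rule tensor_lift_pure[OF tensor_vectorspaces(1) W tensor_vectorspaces(3) assoc_bilinear])

lemma tensor_assoc_pure:
  assumes "u \<in> carrier U" "v \<in> carrier V" "w \<in> carrier W"
  shows "tensor_assoc K U V W (pure_tensor K (tensor K U V) W (pure_tensor K U V u v) w) =
    pure_tensor K U (tensor K V W) u (pure_tensor K V W v w)"
  using assms
  by (simp add: tensor_assoc_pure_right pure_tensor_closed[OF U V]
      tensor_lift_pure[OF U V tensor_vectorspaces(3) assoc_inner_bilinear])

text \<open>\<open>s\<close> is an arbitrary tensor rather than a pure one because the application
  to coassociativity has s = \<rho> v. After reassociation \<phi> still sees only the last factor
  \<open>w\<close>.\<close>

lemma slice_tensor_assoc:
  assumes phi: "\<phi> \<in> module_hom K W (ground_algebra K)"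
    and s: "s \<in> carrier (tensor K U V)" and w: "w \<in> carrier W"
  shows "tensor_map K U V (\<lambda>u. u) (slice K V \<phi>)
      (tensor_assoc K U V W (pure_tensor K (tensor K U V) W s w)) = \<phi> w \<odot>\<^bsub>tensor K U V\<^esub> s"
proof -
  note sl = slice_hom[OF V W phi]
  note mh = tensor_map_hom[OF U V U tensor_vectorspaces(2) module_hom_id sl]
  have pw: "\<phi> w \<in> carrier K" using module_hom_in[OF phi w] by simp
  show ?thesis
    by (rule tensor_hom_eqI[OF U V tensor_vectorspaces(1)
          module_hom_comp[OF module_hom_comp[OF pure_tensor_hom_left[OF tensor_vectorspaces(1) W w] tensor_assoc_hom] mh]
          module_hom_scale[OF tensor_vectorspaces(1) module_hom_id pw] _ s])
      (use w pw in \<open>simp add: tensor_assoc_pure pure_tensor_closed[OF V W]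
        tensor_map_pure[OF U V U tensor_vectorspaces(2) module_hom_id sl] slice_pure[OF V W phi]
        pure_tensor_smult_right[OF U V]\<close>)
qed

end

context primitively_generated
begin

section \<open>The word length filtration\<close>

lemmas HV = vectorspace_axioms
lemmas HHV = tensor_vectorspace[OF HV HV]
lemmas mult_left_hom = bilinear_map_left[OF mult_bilinear]
  and mult_right_hom = bilinear_map_right[OF mult_bilinear]

text \<open>\<open>word_filt n\<close> is spanned by the words of length less than \<open>n\<close>, that is, it is \<open>U\<^sub>n\<^sub>-\<^sub>1\<close>.\<close>

inductive word_filt :: "nat \<Rightarrow> 'h \<Rightarrow> bool" where
  zero: "word_filt n \<zero>\<^bsub>H\<^esub>"
| add: "\<lbrakk>word_filt n u; word_filt n v\<rbrakk> \<Longrightarrow> word_filt n (u \<oplus>\<^bsub>H\<^esub> v)"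
| smult: "\<lbrakk>a \<in> carrier K; word_filt n u\<rbrakk> \<Longrightarrow> word_filt n (a \<odot>\<^bsub>H\<^esub> u)"
| one: "word_filt (Suc n) \<one>\<^bsub>H\<^esub>"
| mult: "\<lbrakk>x \<in> P; word_filt n u\<rbrakk> \<Longrightarrow> word_filt (Suc n) (x \<otimes>\<^bsub>H\<^esub> u)"

abbreviation "words n \<equiv> {u. word_filt n u}"

lemma word_filt_closed: "word_filt n u \<Longrightarrow> u \<in> carrier H"
  by (induction rule: word_filt.induct)
    (auto simp: one_closed_H primitive_closed bilinear_map_in[OF mult_bilinear])

lemma words_submodule: "submodule K (words n) H"
  by unfold_locales (auto intro: word_filt.intros word_filt_closed)

lemma word_filt_Suc: "word_filt n u \<Longrightarrow> word_filt (Suc n) u"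
  by (induction rule: word_filt.induct) (auto intro: word_filt.intros)

lemma word_filt_mono: "\<lbrakk>n \<le> m; word_filt n u\<rbrakk> \<Longrightarrow> word_filt m u"
  by (induction rule: dec_induct) (auto intro: word_filt_Suc)

lemma word_filt_0: "word_filt 0 u \<Longrightarrow> u = \<zero>\<^bsub>H\<^esub>"
  by (induction "0::nat" u rule: word_filt.induct) auto

lemma word_filt_exhaust: "u \<in> carrier H \<Longrightarrow> \<exists>n. word_filt n u"
proof -
  let ?N = "{u. \<exists>n. word_filt n u}"
  have "submodule K ?N H"
  proof
    fix u v assume "u \<in> ?N" "v \<in> ?N"
    then obtain n m where "word_filt n u" "word_filt m v" by auto
    then have "word_filt (max n m) u" "word_filt (max n m) v" by (auto intro: word_filt_mono[rotated])
    then show "u \<oplus>\<^bsub>H\<^esub> v \<in> ?N" by (auto intro: word_filt.add)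
  qed (auto intro: word_filt.intros word_filt_closed)
  then show "u \<in> carrier H \<Longrightarrow> \<exists>n. word_filt n u"
    using generated[of ?N u] by (auto intro: word_filt.intros)
qed

text \<open>\<Delta>(x u) - x u \<otimes> 1 is the sum of u \<otimes> x and of the images of
  \<Delta> u - u \<otimes> 1 under x \<otimes> 1 and 1 \<otimes> x; in all three the left factor has
  a length bound one below that of x u. Since \<open>words n\<close> stands for lengths below n,
  losing a letter is n - 1. At n = 0 the truncated difference is harmless, because then u =
  0.\<close>

lemma comult_word_filt:
  "word_filt n u \<Longrightarrow> comult H u \<ominus>\<^bsub>tensor K H H\<^esub> pure_tensor K H H u \<one>\<^bsub>H\<^esub>
    \<in> tensor_sub K H H (words (n - 1)) (carrier H)" (is "_ \<Longrightarrow> ?d u \<in> ?S n")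
proof (induction rule: word_filt.induct)
  interpret T: vectorspace K "tensor K H H" by (rule HHV)
  have S: "submodule K (tensor_sub K H H (words k) (carrier H)) (tensor K H H)" for k
    by (rule tensor_sub_submodule[OF HV HV words_submodule carrier_submodule[OF HV]])
  have d: "?d \<in> module_hom K H (tensor K H H)"
    by (rule module_hom_diff[OF HHV comult_hom pure_tensor_hom_left[OF HV HV one_closed_H]])
  {
    case (zero n)
    show ?case using module_hom_zero[OF HV HHV d] submodule.zero_closed[OF S] by simp
  next
    case (add n u v)
    then show ?case
      using module_hom_add[OF d] submodule.m_closed[OF S] by (simp add: word_filt_closed)
  next
    case (smult a n u)
    then show ?case
      using module_hom_smult[OF d] submodule.smult_closed[OF S] by (simp add: word_filt_closed)
  next
    case (one n)
    have "?d \<one>\<^bsub>H\<^esub> = \<zero>\<^bsub>tensor K H H\<^esub>"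
      unfolding comult_one using pure_tensor_closed[OF HV HV one_closed_H one_closed_H]
      by (simp add: T.M.minus_eq T.M.r_neg)
    then show ?case using submodule.zero_closed[OF S] by simp
  next
    case (mult x n u)
    have x: "x \<in> carrier H" and u: "u \<in> carrier H"
      using mult by (auto simp: primitive_closed word_filt_closed)
    note xh = mult_right_hom[OF x]
    let ?L = "tensor_map K H H (\<lambda>a. x \<otimes>\<^bsub>H\<^esub> a) (\<lambda>b. b)" and ?R = "tensor_map K H H (\<lambda>a. a) (\<lambda>b. x \<otimes>\<^bsub>H\<^esub> b)"
    note Lh = tensor_map_hom[OF HV HV HV HV xh module_hom_id]
     and Rh = tensor_map_hom[OF HV HV HV HV module_hom_id xh]
     and Lp = tensor_map_pure[OF HV HV HV HV xh module_hom_id]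
     and Rp = tensor_map_pure[OF HV HV HV HV module_hom_id xh]
    note c = one_closed_H x u pure_tensor_closed[OF HV HV] bilinear_map_in[OF mult_bilinear]
      module_hom_in[OF comult_hom] module_hom_in[OF Lh] module_hom_in[OF Rh] module_hom_in[OF d]
    let ?p = "pure_tensor K H H u \<one>\<^bsub>H\<^esub>"
    have e: "comult H u = ?d u \<oplus>\<^bsub>tensor K H H\<^esub> ?p"
      using c by (simp add: T.M.minus_eq T.M.a_assoc T.M.l_neg)
    have "comult H (x \<otimes>\<^bsub>H\<^esub> u) = ?L (comult H u) \<oplus>\<^bsub>tensor K H H\<^esub> ?R (comult H u)"
      by (rule comult_mult[OF mult(1) u])
    also have "?L (comult H u) = ?L (?d u) \<oplus>\<^bsub>tensor K H H\<^esub> pure_tensor K H H (x \<otimes>\<^bsub>H\<^esub> u) \<one>\<^bsub>H\<^esub>"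
      by (subst e) (use c in \<open>simp add: module_hom_add[OF Lh] Lp\<close>)
    also have "?R (comult H u) = ?R (?d u) \<oplus>\<^bsub>tensor K H H\<^esub> pure_tensor K H H u x"
      by (subst e) (use c in \<open>simp add: module_hom_add[OF Rh] Rp one_right\<close>)
    \<comment> \<open>\<open>?L\<close> sends u \<otimes> 1 to the x u \<otimes> 1 that is
      subtracted, while \<open>?R\<close> sends it to the remaining u \<otimes> x.\<close>
    finally have "?d (x \<otimes>\<^bsub>H\<^esub> u) = ?L (?d u) \<oplus>\<^bsub>tensor K H H\<^esub> (?R (?d u) \<oplus>\<^bsub>tensor K H H\<^esub> pure_tensor K H H u x)"
      using c by (simp add: T.M.minus_eq T.M.a_ac T.M.r_neg T.M.l_neg T.M.r_neg1 T.M.r_neg2)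
    moreover have "?L (?d u) \<in> ?S (Suc n)"
    proof (rule tensor_sub_hom_in[OF HV HV words_submodule carrier_submodule[OF HV] HHV Lh S _ mult.IH])
      fix a b assume a: "a \<in> words (n - 1)" and b: "b \<in> carrier H"
      \<comment> \<open>For n = 0 truncation keeps n - 1 at 0, and the rule
        \<open>word_filt.mult\<close> would only give the bound 1; there a = 0 is used
        instead.\<close>
      have "word_filt n (x \<otimes>\<^bsub>H\<^esub> a)"
      proof (cases n)
        case 0
        then have "a = \<zero>\<^bsub>H\<^esub>" using a word_filt_0 by auto
        then show ?thesis using module_hom_zero[OF HV HV xh] word_filt.zero by simp
      next
        case (Suc k)
        then show ?thesis using a word_filt.mult[OF mult(1)] by auto
      qed
      then show "?L (pure_tensor K H H a b) \<in> ?S (Suc n)"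
        using a b Lp pure_in_tensor_sub[OF HV HV words_submodule carrier_submodule[OF HV]]
        by (simp add: word_filt_closed)
    qed
    moreover have "?R (?d u) \<in> ?S (Suc n)"
    proof (rule tensor_sub_hom_in[OF HV HV words_submodule carrier_submodule[OF HV] HHV Rh S _ mult.IH])
      fix a b assume a: "a \<in> words (n - 1)" and b: "b \<in> carrier H"
      then have "word_filt n a" using word_filt_mono[of "n - 1" n] by simp
      then show "?R (pure_tensor K H H a b) \<in> ?S (Suc n)"
        using a b c Rp pure_in_tensor_sub[OF HV HV words_submodule carrier_submodule[OF HV]]
        by (simp add: word_filt_closed)
    qed
    moreover have "pure_tensor K H H u x \<in> ?S (Suc n)"
      using mult x pure_in_tensor_sub[OF HV HV words_submodule carrier_submodule[OF HV]] by simp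
    ultimately show ?case using submodule.m_closed[OF S] by simp
  }
qed

end

section \<open>The filtration of a crossed module\<close>

locale crossed_module_primitively_generated =
  H: primitively_generated K H P + M: crossed_module K H M act \<rho>
  for K :: "('k, 'r) ring_scheme" and H :: "('k, 'h, 'c) hopf_algebra_scheme" and P
    and M :: "('k, 'm, 'd) module_scheme" and act \<rho>
begin

abbreviation "MH \<equiv> tensor K M H"
abbreviation "pm \<equiv> pure_tensor K M H"
abbreviation "TS N \<equiv> tensor_sub K M H N (carrier H)"
abbreviation "\<delta> m \<equiv> \<rho> m \<ominus>\<^bsub>MH\<^esub> pm m \<one>\<^bsub>H\<^esub>"

lemmas MV = M.vectorspace_axioms and HV = H.vectorspace_axioms and HC = carrier_submodule[OF H.vectorspace_axioms]
lemmas MHV = tensor_vectorspace[OF MV HV]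
sublocale T: vectorspace K MH by (rule MHV)

lemmas rho_hom = M.coaction_linear
lemmas delta_hom = module_hom_diff[OF MHV rho_hom pure_tensor_hom_left[OF MV HV H.one_closed_H]]
lemmas pm_closed = pure_tensor_closed[OF MV HV]
lemmas TS_submodule = tensor_sub_submodule[OF MV HV _ HC]

lemma rho_delta: "m \<in> carrier M \<Longrightarrow> \<rho> m = \<delta> m \<oplus>\<^bsub>MH\<^esub> pm m \<one>\<^bsub>H\<^esub>"
  using module_hom_in[OF rho_hom] pm_closed[OF _ H.one_closed_H]
  by (simp add: T.M.minus_eq T.M.a_assoc T.M.l_neg)

text \<open>\<open>filt n\<close> is \<open>F\<^sub>n\<^sub>-\<^sub>1\<close>.\<close>

primrec filt :: "nat \<Rightarrow> 'm set" where
  "filt 0 = {\<zero>\<^bsub>M\<^esub>}"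
| "filt (Suc n) = {m \<in> carrier M. \<delta> m \<in> TS (filt n)}"

lemma filt_submodule: "submodule K (filt n) M"
proof (induction n)
  case 0
  then show ?case using zero_submodule[OF MV] by simp
next
  case (Suc n)
  then show ?case using module_hom_vimage_submodule[OF MV MHV delta_hom TS_submodule] by simp
qed

lemma filt_carrier: "filt n \<subseteq> carrier M"
  by (rule submodule.subset[OF filt_submodule])

lemma filt_Suc: "filt n \<subseteq> filt (Suc n)"
proof (induction n)
  case 0
  have "\<delta> \<zero>\<^bsub>M\<^esub> = \<zero>\<^bsub>MH\<^esub>" by (rule module_hom_zero[OF MV MHV delta_hom])
  then show ?case using submodule.zero_closed[OF TS_submodule[OF filt_submodule[of 0]]] by simp
next
  case (Suc n)
  show ?case
    using tensor_sub_mono[OF MV HV filt_submodule HC filt_submodule HC Suc order_refl] by auto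
qed

lemma delta_filt: "m \<in> filt (Suc n) \<Longrightarrow> \<delta> m \<in> TS (filt n)"
  by simp

text \<open>Both summands of \<rho> m = \<delta> m + m \<otimes> 1 have left factors in
  \<open>filt n\<close>, the first because m also lies in the next member of the chain.\<close>

lemma rho_filt: "m \<in> filt n \<Longrightarrow> \<rho> m \<in> TS (filt n)"
proof -
  assume m: "m \<in> filt n"
  then have mM: "m \<in> carrier M" using filt_carrier by auto
  have "\<delta> m \<in> TS (filt n)" using m filt_Suc delta_filt by blast
  moreover have "pm m \<one>\<^bsub>H\<^esub> \<in> TS (filt n)"
    by (rule pure_in_tensor_sub[OF MV HV filt_submodule HC m H.one_closed_H])
  ultimately show ?thesis
    using rho_delta[OF mM] submodule.m_closed[OF TS_submodule[OF filt_submodule]] by metis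
qed

section \<open>Stability of the filtration under the action\<close>

lemma act_hom_right: "h \<in> carrier H \<Longrightarrow> act h \<in> module_hom K M M"
  and act_hom_left: "m \<in> carrier M \<Longrightarrow> (\<lambda>h. act h m) \<in> module_hom K H M"
  by (auto intro!: module_homI simp: M.act_closed M.act_add_left M.act_add_right M.act_smult_left M.act_smult_right)

text \<open>The value x m \<otimes> u + m \<otimes> [x, u]. Its summands, in the order written, are
  the contributions of x \<otimes> 1 \<otimes> 1, 1 \<otimes> x \<otimes> 1 and 1 \<otimes> 1
  \<otimes> x in the twofold coproduct of a primitive x, with S x = -x and S 1 = 1.\<close>

definition prim_act :: "'h \<Rightarrow> 'm \<Rightarrow> 'h \<Rightarrow> ('m \<times> 'h \<Rightarrow> 'k) set" where
  "prim_act x m u = pm m (u \<otimes>\<^bsub>H\<^esub> (\<ominus>\<^bsub>H\<^esub> x)) \<oplus>\<^bsub>MH\<^esub> (pm (act x m) u \<oplus>\<^bsub>MH\<^esub> pm m (x \<otimes>\<^bsub>H\<^esub> u))"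

lemma prim_act_bilinear_aux:
  assumes x: "x \<in> carrier H"
  shows "bilinear_map K M H MH (\<lambda>m u. pm m (u \<otimes>\<^bsub>H\<^esub> (\<ominus>\<^bsub>H\<^esub> x)))"
    "bilinear_map K M H MH (\<lambda>m u. pm (act x m) u)"
    "bilinear_map K M H MH (\<lambda>m u. pm m (x \<otimes>\<^bsub>H\<^esub> u))"
  using x
  by (intro bilinear_map_comp[OF pure_tensor_bilinear[OF MV HV]] module_hom_id act_hom_right
      H.mult_left_hom H.mult_right_hom; simp)+

lemma prim_act_bilinear: "x \<in> carrier H \<Longrightarrow> bilinear_map K M H MH (prim_act x)"
  unfolding prim_act_def[abs_def]
  by (intro bilinear_map_plus[OF MHV] prim_act_bilinear_aux)

lemma comult_primitive:
  assumes x: "x \<in> P"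
  shows "comult H x = pure_tensor K H H x \<one>\<^bsub>H\<^esub> \<oplus>\<^bsub>tensor K H H\<^esub> pure_tensor K H H \<one>\<^bsub>H\<^esub> x"
proof -
  have xH: "x \<in> carrier H" by (rule H.primitive_closed[OF x])
  show ?thesis
    using H.comult_mult[OF x H.one_closed_H] H.one_closed_H xH
    by (simp add: H.one_right H.comult_one tensor_map_pure[OF HV HV HV HV H.mult_right_hom[OF xH] module_hom_id]
        tensor_map_pure[OF HV HV HV HV module_hom_id H.mult_right_hom[OF xH]])
qed

lemma rho_primitive_act:
  assumes x: "x \<in> P" and m: "m \<in> carrier M"
  shows "\<rho> (act x m) = tensor_lift K MH (prim_act x) (\<rho> m)"
proof -
  have xH: "x \<in> carrier H" by (rule H.primitive_closed[OF x])
  note HHV = tensor_vectorspace[OF HV HV]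
  note HHHV = tensor_vectorspace[OF HV HHV]
  have r: "\<rho> m \<in> carrier MH" by (rule module_hom_in[OF rho_hom m])
  let ?b = "\<lambda>h1 h2 h3 m0 m1. pm (act h2 m0) (h3 \<otimes>\<^bsub>H\<^esub> m1 \<otimes>\<^bsub>H\<^esub> antipode H h1)"
  \<comment> \<open>The innermost sum for fixed legs of the twofold coproduct. It must be linear in
    each of the three legs before the two outer lifts can be evaluated; \<open>g1\<close>,
    \<open>g2\<close> and \<open>g3\<close> supply this.\<close>
  let ?g = "\<lambda>h1 h2 h3. tensor_lift K MH (?b h1 h2 h3) (\<rho> m)"
  note mc = bilinear_map_in[OF H.mult_bilinear] and ac = module_hom_in[OF H.antipode_hom]
  have b: "bilinear_map K M H MH (?b h1 h2 h3)" 
    if "h1 \<in> carrier H" "h2 \<in> carrier H" "h3 \<in> carrier H" for h1 h2 h3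
    using that by (intro bilinear_map_comp[OF pure_tensor_bilinear[OF MV HV]] act_hom_right
        module_hom_comp[OF H.mult_right_hom H.mult_left_hom] ac)
  have g1: "(\<lambda>h1. ?g h1 h2 h3) \<in> module_hom K H MH" if "h2 \<in> carrier H" "h3 \<in> carrier H" for h2 h3
    by (rule tensor_lift_family_hom[OF MV HV MHV HV _ b r])
      (use that in \<open>auto intro!: module_hom_comp[OF module_hom_comp[OF H.antipode_hom H.mult_right_hom]
        pure_tensor_hom_right[OF MV HV]] mc M.act_closed\<close>)
  have g2: "(\<lambda>h2. ?g h1 h2 h3) \<in> module_hom K H MH" if "h1 \<in> carrier H" "h3 \<in> carrier H" for h1 h3
    by (rule tensor_lift_family_hom[OF MV HV MHV HV _ b r])
      (use that in \<open>auto intro!: module_hom_comp[OF act_hom_left pure_tensor_hom_left[OF MV HV]] mc ac\<close>)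
  have g3: "(\<lambda>h3. ?g h1 h2 h3) \<in> module_hom K H MH" if "h1 \<in> carrier H" "h2 \<in> carrier H" for h1 h2
    by (rule tensor_lift_family_hom[OF MV HV MHV HV _ b r])
      (use that in \<open>auto intro!: module_hom_comp[OF module_hom_comp[OF H.mult_left_hom H.mult_left_hom]
        pure_tensor_hom_right[OF MV HV]] ac M.act_closed\<close>)
  have g: "bilinear_map K H H MH (?g h1)" if "h1 \<in> carrier H" for h1
    using that by (intro bilinear_mapI g2 g3)
  note ob = tensor_lift_bilinear[OF HV HV MHV g1 g HV]
  let ?o = "tensor_lift K MH (\<lambda>h1 t. tensor_lift K MH (?g h1) t)"
  note oh = tensor_lift_hom[OF HV HHV MHV ob] and op = tensor_lift_pure[OF HV HHV MHV ob]
    and gp = tensor_lift_pure[OF HV HV MHV g]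
  note Dh = tensor_map_hom[OF HV HHV HV HV module_hom_id H.comult_hom]
    and Dp = tensor_map_pure[OF HV HHV HV HV module_hom_id H.comult_hom]
  note c = H.one_closed_H xH pure_tensor_closed[OF HV HV] pure_tensor_closed[OF HV HHV]
  have one: "\<one>\<^bsub>H\<^esub> \<in> carrier H" by (rule H.one_closed_H)
  interpret HH: vectorspace K "tensor K H H" by (rule HHV)
  interpret HHH: vectorspace K "tensor K H (tensor K H H)" by (rule HHHV)
  have "tensor_map K H (tensor K H H) (\<lambda>h. h) (comult H) (comult H x) =
    pure_tensor K H (tensor K H H) x (pure_tensor K H H \<one>\<^bsub>H\<^esub> \<one>\<^bsub>H\<^esub>) \<oplus>\<^bsub>tensor K H (tensor K H H)\<^esub>
    pure_tensor K H (tensor K H H) \<one>\<^bsub>H\<^esub> (pure_tensor K H H x \<one>\<^bsub>H\<^esub> \<oplus>\<^bsub>tensor K H H\<^esub> pure_tensor K H H \<one>\<^bsub>H\<^esub> x)"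
    using c by (subst comult_primitive[OF x])
      (simp add: module_hom_add[OF Dh] Dp H.comult_one comult_primitive[OF x])
  then have "\<rho> (act x m) = ?o (pure_tensor K H (tensor K H H) x (pure_tensor K H H \<one>\<^bsub>H\<^esub> \<one>\<^bsub>H\<^esub>) \<oplus>\<^bsub>tensor K H (tensor K H H)\<^esub>
    pure_tensor K H (tensor K H H) \<one>\<^bsub>H\<^esub> (pure_tensor K H H x \<one>\<^bsub>H\<^esub> \<oplus>\<^bsub>tensor K H H\<^esub> pure_tensor K H H \<one>\<^bsub>H\<^esub> x))"
    using M.coaction_act[OF xH m] by simp
  also have "\<dots> = ?g x \<one>\<^bsub>H\<^esub> \<one>\<^bsub>H\<^esub> \<oplus>\<^bsub>MH\<^esub> (?g \<one>\<^bsub>H\<^esub> x \<one>\<^bsub>H\<^esub> \<oplus>\<^bsub>MH\<^esub> ?g \<one>\<^bsub>H\<^esub> \<one>\<^bsub>H\<^esub> x)"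
    using c by (simp add: module_hom_add[OF oh] op gp module_hom_add[OF tensor_lift_hom[OF HV HV MHV g]])
  also have "?g x \<one>\<^bsub>H\<^esub> \<one>\<^bsub>H\<^esub> = tensor_lift K MH (\<lambda>m u. pm m (u \<otimes>\<^bsub>H\<^esub> (\<ominus>\<^bsub>H\<^esub> x))) (\<rho> m)"
    by (rule tensor_lift_cong[OF MV HV MHV b[OF xH one one] prim_act_bilinear_aux(1)[OF xH] _ r])
      (simp add: M.act_one H.one_left H.antipode_primitive[OF x])
  also have "?g \<one>\<^bsub>H\<^esub> x \<one>\<^bsub>H\<^esub> = tensor_lift K MH (\<lambda>m u. pm (act x m) u) (\<rho> m)"
    by (rule tensor_lift_cong[OF MV HV MHV b[OF one xH one] prim_act_bilinear_aux(2)[OF xH] _ r])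
      (simp add: H.one_left H.one_right H.antipode_one)
  also have "?g \<one>\<^bsub>H\<^esub> \<one>\<^bsub>H\<^esub> x = tensor_lift K MH (\<lambda>m u. pm m (x \<otimes>\<^bsub>H\<^esub> u)) (\<rho> m)"
    by (rule tensor_lift_cong[OF MV HV MHV b[OF one one xH] prim_act_bilinear_aux(3)[OF xH] _ r])
      (simp add: M.act_one H.one_right H.antipode_one mc xH)
  also have "tensor_lift K MH (\<lambda>m u. pm m (u \<otimes>\<^bsub>H\<^esub> (\<ominus>\<^bsub>H\<^esub> x))) (\<rho> m) \<oplus>\<^bsub>MH\<^esub>
    (tensor_lift K MH (\<lambda>m u. pm (act x m) u) (\<rho> m) \<oplus>\<^bsub>MH\<^esub> tensor_lift K MH (\<lambda>m u. pm m (x \<otimes>\<^bsub>H\<^esub> u)) (\<rho> m))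
    = tensor_lift K MH (prim_act x) (\<rho> m)"
    unfolding prim_act_def[abs_def]
    by (simp add: tensor_lift_plus[OF MV HV MHV _ _ r] prim_act_bilinear_aux[OF xH]
        bilinear_map_plus[OF MHV])
  finally show ?thesis .
qed

text \<open>The lift of \<open>prim_act x\<close> carries \<delta> m to \<delta> of
  \<open>act x m\<close>, and it preserves \<open>TS (filt n)\<close>, because the induction
  hypothesis keeps the only left factor that changes, \<open>act x v\<close>, inside
  \<open>filt n\<close>.\<close>

lemma filt_primitive_act:
  assumes x: "x \<in> P" shows "m \<in> filt n \<Longrightarrow> act x m \<in> filt n"
proof (induction n arbitrary: m)
  have xH: "x \<in> carrier H" by (rule H.primitive_closed[OF x])
  case 0
  then show ?case using module_hom_zero[OF MV MV act_hom_right[OF xH]] by simp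
next
  have xH: "x \<in> carrier H" by (rule H.primitive_closed[OF x])
  case (Suc n)
  have m: "m \<in> carrier M" using Suc.prems by simp
  note am = M.act_closed[OF xH m]
  let ?t = "tensor_lift K MH (prim_act x)"
  note th = tensor_lift_hom[OF MV HV MHV prim_act_bilinear[OF xH]]
   and tp = tensor_lift_pure[OF MV HV MHV prim_act_bilinear[OF xH]]
  have "?t (pm m \<one>\<^bsub>H\<^esub>) = pm m (\<one>\<^bsub>H\<^esub> \<otimes>\<^bsub>H\<^esub> (\<ominus>\<^bsub>H\<^esub> x)) \<oplus>\<^bsub>MH\<^esub> (pm (act x m) \<one>\<^bsub>H\<^esub> \<oplus>\<^bsub>MH\<^esub> pm m (x \<otimes>\<^bsub>H\<^esub> \<one>\<^bsub>H\<^esub>))"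
    using m H.one_closed_H by (simp add: tp prim_act_def)
  \<comment> \<open>At u = 1 the two halves of the commutator [x, u] become m \<otimes> x and its
    negative, and they cancel.\<close>
  also have "\<dots> = \<ominus>\<^bsub>MH\<^esub> pm m x \<oplus>\<^bsub>MH\<^esub> (pm m x \<oplus>\<^bsub>MH\<^esub> pm (act x m) \<one>\<^bsub>H\<^esub>)"
    using m xH am H.one_closed_H pm_closed
    by (simp add: H.one_left H.one_right pure_tensor_neg_right[OF MV HV] T.M.a_comm)
  also have "\<dots> = pm (act x m) \<one>\<^bsub>H\<^esub>"
    using m xH am H.one_closed_H pm_closed by (simp add: T.M.r_neg1)
  finally have "\<delta> (act x m) = ?t (\<delta> m)"
    using rho_primitive_act[OF x m] m module_hom_in[OF rho_hom] H.one_closed_H pm_closed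
    by (simp add: module_hom_minus[OF MHV MHV th])
  moreover have "?t (\<delta> m) \<in> TS (filt n)"
  proof (rule tensor_sub_hom_in[OF MV HV filt_submodule HC MHV th TS_submodule[OF filt_submodule] _ delta_filt[OF Suc.prems]])
    interpret TS: submodule K "TS (filt n)" MH by (rule TS_submodule[OF filt_submodule])
    note pin = pure_in_tensor_sub[OF MV HV filt_submodule HC]
    fix v w assume v: "v \<in> filt n" and w: "w \<in> carrier H"
    then have vM: "v \<in> carrier M" using filt_carrier by auto
    show "?t (pm v w) \<in> TS (filt n)"
      unfolding tp[OF vM w] prim_act_def using xH w v Suc.IH[OF v]
      by (intro TS.m_closed pin bilinear_map_in[OF H.mult_bilinear]) simp_all
  qed
  ultimately show ?case using am by simp
qed

text \<open>The elements of \<open>H\<close> that preserve \<open>filt n\<close> form a subspace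
  containing 1 and closed under left multiplication by primitives, so \<open>generated\<close>
  applies.\<close>

lemma filt_act:
  assumes h: "h \<in> carrier H" and m: "m \<in> filt n" shows "act h m \<in> filt n"
proof -
  interpret N: submodule K "filt n" M by (rule filt_submodule)
  have c: "m \<in> carrier M" if "m \<in> filt n" for m using that filt_carrier by auto
  let ?N = "{h \<in> carrier H. \<forall>m\<in>filt n. act h m \<in> filt n}"
  have "submodule K ?N H"
    by unfold_locales (auto simp: M.act_add_left M.act_smult_left c module_hom_zero[OF HV MV act_hom_left])
  then have "h \<in> ?N"
  proof (rule H.generated[OF _ _ _ h])
    show "\<one>\<^bsub>H\<^esub> \<in> ?N" by (auto simp: H.one_closed_H M.act_one c)
    show "x \<otimes>\<^bsub>H\<^esub> u \<in> ?N" if "x \<in> P" "u \<in> ?N" for x u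
      using that filt_primitive_act
      by (auto simp: M.act_mult c H.primitive_closed bilinear_map_in[OF H.mult_bilinear])
  qed
  then show ?thesis using m by auto
qed

lemma tensor_sub_carrier_right:
  "TS N = tensor_map K M H (\<lambda>m. m) (\<lambda>h. h) ` carrier (tensor K (M\<lparr>carrier := N\<rparr>) H)"
  by (simp add: tensor_sub_def)

lemma filt_crossed_submodule: "crossed_submodule K H M act \<rho> (filt n)"
proof -
  have "subspace K (filt n) M" by (simp add: subspace_def MV filt_submodule)
  then show ?thesis
    using filt_act rho_filt
    by (auto simp: crossed_submodule_def subcomodule_def tensor_sub_carrier_right[symmetric])
qed

section \<open>Exhaustion of the module by the filtration\<close>

lemma rho_inj:
  assumes m: "m \<in> carrier M" and z: "\<rho> m = \<zero>\<^bsub>MH\<^esub>" shows "m = \<zero>\<^bsub>M\<^esub>"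
  using M.coaction_counit[OF m] module_hom_zero[OF MHV MV slice_hom[OF MV HV H.counit_hom]]
  by (simp add: z slice_def)

text \<open>Coassociativity, sliced by \<open>\<phi>\<close> in the last factor.\<close>

lemma rho_slice:
  assumes phi: "\<phi> \<in> module_hom K H (ground_algebra K)" and m: "m \<in> carrier M"
  shows "\<rho> (slice K M \<phi> (\<rho> m)) = tensor_map K M H (\<lambda>m. m) (\<lambda>u. slice K H \<phi> (comult H u)) (\<rho> m)"
proof -
  note HHV = tensor_vectorspace[OF HV HV]
  note sM = slice_hom[OF MV HV phi] and sH = slice_hom[OF HV HV phi]
  note ah = tensor_assoc_hom[OF MV HV HV]
  let ?th = "tensor_map K M H (\<lambda>m. m) (slice K H \<phi>)"
  let ?ri = "tensor_map K MH H \<rho> (\<lambda>h. h)"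
  let ?iD = "tensor_map K M (tensor K H H) (\<lambda>m. m) (comult H)"
  note thh = tensor_map_hom[OF MV HV MV HHV module_hom_id sH]
   and thp = tensor_map_pure[OF MV HV MV HHV module_hom_id sH]
  note rih = tensor_map_hom[OF MHV HV MV HV rho_hom module_hom_id]
   and rip = tensor_map_pure[OF MHV HV MV HV rho_hom module_hom_id]
  note iDh = tensor_map_hom[OF MV HHV MV HV module_hom_id H.comult_hom]
   and iDp = tensor_map_pure[OF MV HHV MV HV module_hom_id H.comult_hom]
  note sDh = module_hom_comp[OF H.comult_hom sH]
  have r: "\<rho> m \<in> carrier MH" by (rule module_hom_in[OF rho_hom m])
  \<comment> \<open>\<open>?th\<close> slices the last of three factors and is applied to both sides
    of coassociativity: on the left it turns (\<rho> \<otimes> id)(\<rho> m) into \<rho> of a slice,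
    on the right it merges with \<Delta>.\<close>
  have "?th (tensor_assoc K M H H (?ri (\<rho> m))) = \<rho> (slice K M \<phi> (\<rho> m))"
  proof (rule tensor_hom_eqI[OF MV HV MHV module_hom_comp[OF module_hom_comp[OF rih ah] thh] 
        module_hom_comp[OF sM rho_hom] _ r])
    fix v w assume v: "v \<in> carrier M" and w: "w \<in> carrier H"
    show "?th (tensor_assoc K M H H (?ri (pm v w))) = \<rho> (slice K M \<phi> (pm v w))"
      using v w module_hom_in[OF phi w] module_hom_in[OF rho_hom v]
      by (simp add: rip slice_tensor_assoc[OF MV HV HV phi] slice_pure[OF MV HV phi] module_hom_smult[OF rho_hom])
  qed
  moreover have "?th (?iD (\<rho> m)) = tensor_map K M H (\<lambda>m. m) (\<lambda>u. slice K H \<phi> (comult H u)) (\<rho> m)"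
    by (rule tensor_hom_eqI[OF MV HV MHV module_hom_comp[OF iDh thh]
          tensor_map_hom[OF MV HV MV HV module_hom_id sDh] _ r])
      (simp add: iDp thp module_hom_in[OF H.comult_hom] tensor_map_pure[OF MV HV MV HV module_hom_id sDh])
  ultimately show ?thesis using M.coaction_coassoc[OF m] by simp
qed

text \<open>The induction hypothesis is used for the slices of \<delta> m, one for each \<phi>, so
  \<open>m\<close> is generalized. In the base case \<open>words 0\<close> is zero, hence \<rho> m =
  0, and m = 0 by the counit axiom.\<close>

lemma rho_words_filt:
  "\<lbrakk>m \<in> carrier M; \<rho> m \<in> tensor_sub K M H (carrier M) (H.words n)\<rbrakk> \<Longrightarrow> m \<in> filt n"
proof (induction n arbitrary: m)
  note MC = carrier_submodule[OF MV]
  case (0 m)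
  have "\<rho> m \<in> {\<zero>\<^bsub>MH\<^esub>}"
    by (rule tensor_sub_hom_in[OF MV HV MC H.words_submodule MHV module_hom_id zero_submodule[OF MHV] _ 0(2)])
      (auto dest!: H.word_filt_0 simp: pure_tensor_zero_right[OF MV HV])
  then show ?case using rho_inj 0 by auto
next
  note MC = carrier_submodule[OF MV]
  case (Suc n m)
  have m: "m \<in> carrier M" by (rule Suc.prems)
  have r: "\<rho> m \<in> carrier MH" by (rule module_hom_in[OF rho_hom m])
  have "slice K M \<phi> (\<delta> m) \<in> filt n" if phi: "\<phi> \<in> module_hom K H (ground_algebra K)" for \<phi>
  proof (rule Suc.IH)
    note sM = slice_hom[OF MV HV phi] and sH = slice_hom[OF HV HV phi]
    note HHV = tensor_vectorspace[OF HV HV]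
    have one: "\<one>\<^bsub>H\<^esub> \<in> carrier H" by (rule H.one_closed_H)
    have p1: "\<phi> \<one>\<^bsub>H\<^esub> \<in> carrier K" using module_hom_in[OF phi one] by simp
    show "slice K M \<phi> (\<delta> m) \<in> carrier M"
      by (rule module_hom_in[OF sM module_hom_in[OF delta_hom m]])
    let ?sD = "\<lambda>u. slice K H \<phi> (comult H u)"
    \<comment> \<open>The operator u |-> (id \<otimes> \<phi>)(\<Delta> u - u \<otimes> 1), as
      \<phi>(1) u is the slice of u \<otimes> 1. By \<open>comult_word_filt\<close> it takes
      \<open>words (Suc n)\<close> into \<open>words n\<close>.\<close>
    let ?q = "\<lambda>u. ?sD u \<ominus>\<^bsub>H\<^esub> \<phi> \<one>\<^bsub>H\<^esub> \<odot>\<^bsub>H\<^esub> u"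
    note sDh = module_hom_comp[OF H.comult_hom sH]
    note qh = module_hom_diff[OF HV sDh module_hom_scale[OF HV module_hom_id p1]]
    note Qh = tensor_map_hom[OF MV HV MV HV module_hom_id qh] 
      and Qp = tensor_map_pure[OF MV HV MV HV module_hom_id qh]
    have "slice K M \<phi> (\<delta> m) = slice K M \<phi> (\<rho> m) \<ominus>\<^bsub>M\<^esub> \<phi> \<one>\<^bsub>H\<^esub> \<odot>\<^bsub>M\<^esub> m"
      using m one r by (simp add: module_hom_minus[OF MHV MV sM] pm_closed slice_pure[OF MV HV phi])
    then have "\<rho> (slice K M \<phi> (\<delta> m)) = \<rho> (slice K M \<phi> (\<rho> m)) \<ominus>\<^bsub>MH\<^esub> \<phi> \<one>\<^bsub>H\<^esub> \<odot>\<^bsub>MH\<^esub> \<rho> m"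
      using m p1 module_hom_in[OF sM r] by (simp add: module_hom_minus[OF MV MHV rho_hom] module_hom_smult[OF rho_hom])
    also have "\<dots> = tensor_map K M H (\<lambda>m. m) ?sD (\<rho> m) \<ominus>\<^bsub>MH\<^esub> \<phi> \<one>\<^bsub>H\<^esub> \<odot>\<^bsub>MH\<^esub> \<rho> m"
      by (simp add: rho_slice[OF phi m])
    also have "\<dots> = tensor_map K M H (\<lambda>m. m) ?q (\<rho> m)"
      by (rule tensor_hom_eqI[OF MV HV MHV module_hom_diff[OF MHV tensor_map_hom[OF MV HV MV HV module_hom_id sDh]
              module_hom_scale[OF MHV module_hom_id p1]] Qh _ r])
        (use p1 in \<open>simp add: tensor_map_pure[OF MV HV MV HV module_hom_id sDh] Qp pure_tensor_minus_right[OF MV HV]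
          pure_tensor_smult_right[OF MV HV] module_hom_in[OF sDh]\<close>)
    also have "\<dots> \<in> tensor_sub K M H (carrier M) (H.words n)"
    proof (rule tensor_sub_hom_in[OF MV HV MC H.words_submodule MHV Qh
          tensor_sub_submodule[OF MV HV MC H.words_submodule] _ Suc.prems(2)])
      fix v u assume v: "v \<in> carrier M" and u: "u \<in> H.words (Suc n)"
      have uH: "u \<in> carrier H" using u H.word_filt_closed by auto
      have "slice K H \<phi> (comult H u \<ominus>\<^bsub>tensor K H H\<^esub> pure_tensor K H H u \<one>\<^bsub>H\<^esub>) \<in> H.words n"
      proof (rule tensor_sub_hom_in[OF HV HV H.words_submodule HC HV sH H.words_submodule])
        show "comult H u \<ominus>\<^bsub>tensor K H H\<^esub> pure_tensor K H H u \<one>\<^bsub>H\<^esub> \<in> tensor_sub K H H (H.words n) (carrier H)"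
          using H.comult_word_filt[of "Suc n" u] u by simp
        fix a b assume a: "a \<in> H.words n" and b: "b \<in> carrier H"
        then show "slice K H \<phi> (pure_tensor K H H a b) \<in> H.words n"
          using module_hom_in[OF phi b] by (simp add: slice_pure[OF HV HV phi] H.word_filt_closed H.word_filt.smult)
      qed
      also have "slice K H \<phi> (comult H u \<ominus>\<^bsub>tensor K H H\<^esub> pure_tensor K H H u \<one>\<^bsub>H\<^esub>) = ?q u"
        using uH one module_hom_in[OF H.comult_hom uH]
        by (simp add: module_hom_minus[OF HHV HV sH] pure_tensor_closed[OF HV HV] slice_pure[OF HV HV phi])
      finally show "tensor_map K M H (\<lambda>m. m) ?q (pm v u) \<in> tensor_sub K M H (carrier M) (H.words n)"
        unfolding Qp[OF v uH] by (rule pure_in_tensor_sub[OF MV HV MC H.words_submodule v])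
    qed
    finally show "\<rho> (slice K M \<phi> (\<delta> m)) \<in> tensor_sub K M H (carrier M) (H.words n)" .
  qed
  then have "\<delta> m \<in> TS (filt n)"
    by (rule tensor_sub_sliceI[OF MV HV filt_submodule module_hom_in[OF delta_hom m]])
  then show ?case using m by simp
qed

text \<open>A tensor involves finitely many elements of \<open>H\<close>, each of bounded word
  length, so \<rho> m has all its right factors in one \<open>words n\<close>.\<close>

lemma filt_exhaust: "(\<Union>n. filt n) = carrier M"
proof
  show "(\<Union>n. filt n) \<subseteq> carrier M" using filt_carrier by auto
  show "carrier M \<subseteq> (\<Union>n. filt n)"
  proof
    note MC = carrier_submodule[OF MV]
    note S = tensor_sub_submodule[OF MV HV MC H.words_submodule]
    fix m assume m: "m \<in> carrier M"
    have "\<exists>n. t \<in> tensor_sub K M H (carrier M) (H.words n)" if "t \<in> carrier MH" for t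
      using that
    proof (induction rule: tensor_induct[OF MV HV, consumes 1, case_names zero pure add])
      case zero
      show ?case using submodule.zero_closed[OF S] by blast
    next
      case (pure v w)
      then show ?case
        using H.word_filt_exhaust[OF pure(2)] pure_in_tensor_sub[OF MV HV MC H.words_submodule] by blast
    next
      case (add s t)
      then obtain i j where "s \<in> tensor_sub K M H (carrier M) (H.words i)"
        "t \<in> tensor_sub K M H (carrier M) (H.words j)" by auto
      moreover have "tensor_sub K M H (carrier M) (H.words k) \<subseteq> tensor_sub K M H (carrier M) (H.words (max i j))"
        if "k \<le> max i j" for k
        by (rule tensor_sub_mono[OF MV HV MC H.words_submodule MC H.words_submodule order_refl])
          (use H.word_filt_mono[OF that] in auto)
      ultimately have "s \<in> tensor_sub K M H (carrier M) (H.words (max i j))"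
        "t \<in> tensor_sub K M H (carrier M) (H.words (max i j))" by (meson max.cobounded1 max.cobounded2 subsetD)+
      then show ?case using submodule.m_closed[OF S] by blast
    qed
    then show "m \<in> (\<Union>n. filt n)" using rho_words_filt[OF m] module_hom_in[OF rho_hom m] by blast
  qed
qed

text \<open>\<open>sub_coaction\<close> inverts the inclusion of F \<otimes> H, so its value is
  compared with m \<otimes> 1 inside M \<otimes> H. There the difference is \<delta> m, which comes
  from N \<otimes> H; injectivity pulls this back to F \<otimes> H, and the projection to F / N
  kills it. The case N = F is included, as it arises in negative degrees.\<close>

lemma trivial_quotient:
  assumes F: "submodule K F M" and N: "submodule K N M" and NF: "N \<subseteq> F"
    and rhoF: "\<And>m. m \<in> F \<Longrightarrow> \<rho> m \<in> TS F" and deltaF: "\<And>m. m \<in> F \<Longrightarrow> \<delta> m \<in> TS N"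
  shows "trivial_comodule K H (quotient_space (M\<lparr>carrier := F\<rparr>) N)
    (quotient_coaction K H (M\<lparr>carrier := F\<rparr>) (sub_coaction K H M \<rho> F) N)"
proof -
  let ?F = "M\<lparr>carrier := F\<rparr>" and ?N = "M\<lparr>carrier := N\<rparr>"
  let ?Q = "quotient_space ?F N"
  let ?\<sigma> = "sub_coaction K H M \<rho> F" and ?\<kappa> = "quotient_coaction K H ?F (sub_coaction K H M \<rho> F) N"
  let ?i = "tensor_map K M H (\<lambda>m. m) (\<lambda>h. h)"
  note FV = submodule_vectorspace[OF MV F] and NV = submodule_vectorspace[OF MV N]
  have NsF: "submodule K N ?F"
    using F N NF FV by (auto simp: submodule_def vectorspace_def)
  note QV = quotient_space_vectorspace[OF FV NsF]
  note FHV = tensor_vectorspace[OF FV HV] and QHV = tensor_vectorspace[OF QV HV]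
  interpret FH: vectorspace K "tensor K ?F H" by (rule FHV)
  have one: "\<one>\<^bsub>H\<^esub> \<in> carrier H" by (rule H.one_closed_H)
  have FM: "m \<in> carrier M" if "m \<in> F" for m using that submodule.subset[OF F] by auto
  have NM: "m \<in> carrier M" if "m \<in> N" for m using that submodule.subset[OF N] by auto
  note ih = tensor_map_hom[OF MV HV FV HV submodule_incl_hom[OF F] module_hom_id]
   and ip = tensor_map_pure[OF MV HV FV HV submodule_incl_hom[OF F] module_hom_id, simplified]
  note jh = tensor_map_hom[OF MV HV NV HV submodule_incl_hom[OF N] module_hom_id]
   and jp = tensor_map_pure[OF MV HV NV HV submodule_incl_hom[OF N] module_hom_id, simplified]
  let ?k = "tensor_map K ?F H (\<lambda>m. m) (\<lambda>h. h)"
  have NFh: "(\<lambda>v. v) \<in> module_hom K ?N ?F" using submodule_incl_hom[OF NsF] by simp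
  note kh = tensor_map_hom[OF FV HV NV HV NFh module_hom_id]
   and kp = tensor_map_pure[OF FV HV NV HV NFh module_hom_id, simplified]
  have sig: "?\<sigma> m \<in> carrier (tensor K ?F H)" "?i (?\<sigma> m) = \<rho> m" if "m \<in> F" for m
  proof -
    have "\<rho> m \<in> ?i ` carrier (tensor K ?F H)" using rhoF[OF that] by (simp add: tensor_sub_carrier_right)
    then show "?\<sigma> m \<in> carrier (tensor K ?F H)" "?i (?\<sigma> m) = \<rho> m"
      unfolding sub_coaction_def by (rule inv_into_into, rule f_inv_into_f)
  qed
  let ?p = "\<lambda>x. N +>\<^bsub>?F\<^esub> x"
  note ph = coset_hom[OF FV NsF]
  let ?pi = "tensor_map K ?Q H ?p (\<lambda>h. h)"
  note pih = tensor_map_hom[OF QV HV FV HV ph module_hom_id]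
   and pip = tensor_map_pure[OF QV HV FV HV ph module_hom_id]
  have val: "?pi (?\<sigma> m) = pure_tensor K ?Q H (?p m) \<one>\<^bsub>H\<^esub>" if m: "m \<in> F" for m
  proof -
    let ?pm = "pure_tensor K ?F H m \<one>\<^bsub>H\<^esub>"
    have pmc: "?pm \<in> carrier (tensor K ?F H)" using m one by (intro pure_tensor_closed[OF FV HV]) simp_all
    let ?d = "?\<sigma> m \<ominus>\<^bsub>tensor K ?F H\<^esub> ?pm"
    have dc: "?d \<in> carrier (tensor K ?F H)" using sig[OF m] pmc by simp
    have "?i ?d = \<delta> m"
      using sig[OF m] pmc m one by (simp add: module_hom_minus[OF FHV MHV ih] ip)
    then obtain e where e: "e \<in> carrier (tensor K ?N H)" "?i ?d = ?i e"
      using deltaF[OF m] by (auto simp: tensor_sub_carrier_right)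
    \<comment> \<open>The same function \<open>?i\<close> serves as the inclusion of F \<otimes> H
      and of N \<otimes> H, because \<open>tensor_map\<close> does not mention its source.
      \<open>?k\<close> is the inclusion of N \<otimes> H into F \<otimes> H.\<close>
    have "?i (?k e) = ?i e"
      by (rule tensor_hom_eqI[OF NV HV MHV module_hom_comp[OF kh ih] jh _ e(1)])
        (use NF in \<open>auto simp: kp ip jp\<close>)
    then have "?d = ?k e"
      using inj_onD[OF tensor_incl_inj[OF MV HV F] _ dc module_hom_in[OF kh e(1)]] e by simp
    moreover have "?pi (?k e) = \<zero>\<^bsub>tensor K ?Q H\<^esub>"
      by (rule tensor_hom_eqI[OF NV HV QHV module_hom_comp[OF kh pih] module_hom_const_zero[OF QHV] _ e(1)])
        (use NF in \<open>auto simp: kp pip coset_zero[OF FV NsF] pure_tensor_zero_left[OF QV HV]\<close>)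
    moreover have "?\<sigma> m = ?d \<oplus>\<^bsub>tensor K ?F H\<^esub> ?pm"
      using sig[OF m] pmc by (simp add: FH.M.minus_eq FH.M.a_assoc FH.M.l_neg)
    ultimately have "?pi (?\<sigma> m) = \<zero>\<^bsub>tensor K ?Q H\<^esub> \<oplus>\<^bsub>tensor K ?Q H\<^esub> ?pi ?pm"
      using module_hom_add[OF pih dc pmc] by simp
    also have "?pi ?pm = pure_tensor K ?Q H (?p m) \<one>\<^bsub>H\<^esub>" using m one by (simp add: pip)
    finally show ?thesis
      using pure_tensor_closed[OF QV HV coset_carrier[OF FV NsF] one, of m] m
        vectorspace.axioms(1)[OF QHV] by (simp add: module_def abelian_group_def abelian_monoid.l_zero)
  qed
  interpret N: abelian_subgroup N ?F by (rule submodule_abelian_subgroup[OF FV NsF])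
  have kap: "?\<kappa> X = pure_tensor K ?Q H X \<one>\<^bsub>H\<^esub>" if X: "X \<in> carrier ?Q" for X
  proof -
    obtain m where m: "m \<in> carrier ?F" "X = ?p m" using X by (rule quotient_space_E[OF FV NsF])
    have "?pi (?\<sigma> v) = pure_tensor K ?Q H X \<one>\<^bsub>H\<^esub>" if v: "v \<in> X" for v
    proof -
      have vF: "v \<in> carrier ?F" using v m N.a_elemrcos_carrier by blast
      have "?p v = X" using N.a_repr_independence'[OF _ m(1)] v m(2) by auto
      then show ?thesis using val[of v] vF by simp
    qed
    moreover have "m \<in> X" using N.a_rcos_self[OF m(1)] m(2) by simp
    ultimately have "(\<lambda>v. ?pi (?\<sigma> v)) ` X = {pure_tensor K ?Q H X \<one>\<^bsub>H\<^esub>}"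
      by (intro image_eq_singleton)
    then show ?thesis by (simp add: quotient_coaction_def)
  qed
  have kh': "?\<kappa> \<in> module_hom K ?Q (tensor K ?Q H)"
    by (rule module_hom_cong[OF pure_tensor_hom_left[OF QV HV one] QV]) (simp add: kap)
  note HHV = tensor_vectorspace[OF HV HV]
  \<comment> \<open>As the coaction is X |-> X \<otimes> 1, coassociativity reduces to \<Delta> 1 =
    1 \<otimes> 1 and the counit axiom to \<epsilon>(1) = 1.\<close>
  have "right_comodule K H ?Q ?\<kappa>"
  proof (intro right_comodule.intro[OF QV] right_comodule_axioms.intro kh')
    fix X assume X: "X \<in> carrier ?Q"
    note pc = pure_tensor_closed[OF QV HV X one]
    show "tensor_assoc K ?Q H H (tensor_map K (tensor K ?Q H) H ?\<kappa> (\<lambda>h. h) (?\<kappa> X)) =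
        tensor_map K ?Q (tensor K H H) (\<lambda>m. m) (comult H) (?\<kappa> X)"
      using X one pc
      by (simp add: kap tensor_map_pure[OF QHV HV QV HV kh' module_hom_id] tensor_assoc_pure[OF QV HV HV]
        tensor_map_pure[OF QV HHV QV HV module_hom_id H.comult_hom] H.comult_one)
    have "slice K ?Q (counit H) (?\<kappa> X) = \<one>\<^bsub>K\<^esub> \<odot>\<^bsub>?Q\<^esub> X"
      using X one by (simp add: kap slice_pure[OF QV HV H.counit_hom] H.counit_one)
    also have "\<dots> = X" using X QV by (simp add: vectorspace_def module.smult_one)
    finally show "tensor_lift K ?Q (\<lambda>m h. counit H h \<odot>\<^bsub>?Q\<^esub> m) (?\<kappa> X) = X"
      by (simp add: slice_def)
  qed
  then show ?thesis using kap by (simp add: trivial_comodule_def)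
qed

end

section \<open>Reindexing the filtration by the integers\<close>

theorem lemma6p2:
  fixes K :: "('k, 'r) ring_scheme"
    and L :: "('k, 'g, 'c) lie_algebra_scheme"
    and M :: "('k, 'm, 'd) module_scheme"
    and act :: "('g list \<Rightarrow> 'k) set \<Rightarrow> 'm \<Rightarrow> 'm"
    and \<rho> :: "'m \<Rightarrow> ('m \<times> ('g list \<Rightarrow> 'k) set \<Rightarrow> 'k) set"
  assumes "field K"
    and "lie_algebra K L"
    and "crossed_module K (uea K L) M act \<rho>"
  shows "\<exists>F :: int \<Rightarrow> 'm set.
    (\<forall>p. crossed_submodule K (uea K L) M act \<rho> (F p)) \<and>
    (\<forall>p. F p \<subseteq> F (p + 1)) \<and>
    (\<forall>p<0. F p = {\<zero>\<^bsub>M\<^esub>}) \<and>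
    (\<Union>p. F p) = carrier M \<and>
    (\<forall>p. trivial_comodule K (uea K L)
      (quotient_space (M\<lparr>carrier := F p\<rparr>) (F (p - 1)))
      (quotient_coaction K (uea K L) (M\<lparr>carrier := F p\<rparr>)
        (sub_coaction K (uea K L) M \<rho> (F p)) (F (p - 1))))"
proof -
  interpret L: lie_algebra K L by fact
  interpret C: crossed_module_primitively_generated K "uea K L" "uea_incl K L ` carrier L" M act \<rho>
    by (intro crossed_module_primitively_generated.intro L.uea_primitively_generated assms)
  \<comment> \<open>The shift by one puts \<open>filt 0\<close> in degree -1, and \<open>nat\<close>
    sends all lower degrees to \<open>filt 0\<close> as well.\<close>
  define F where "F p = C.filt (nat (p + 1))" for p
  \<comment> \<open>The first alternative is p at least 0, with consecutive members of the chain;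
    the second is negative p, where both spaces are zero.\<close>
  have step: "F p = C.filt (Suc (nat p)) \<and> F (p - 1) = C.filt (nat p) \<or>
      F p = C.filt 0 \<and> F (p - 1) = C.filt 0" for p
    by (cases "p \<ge> 0") (auto simp: F_def nat_add_distrib)
  have "F p \<subseteq> F (p + 1)" for p
    using step[of "p + 1"] C.filt_Suc by auto
  moreover have "F p = {\<zero>\<^bsub>M\<^esub>}" if "p < 0" for p using that by (simp add: F_def)
  moreover have "(\<Union>p. F p) = carrier M"
  proof -
    have "C.filt n = F (int n - 1)" for n by (simp add: F_def)
    then have "C.filt n \<subseteq> (\<Union>p. F p)" for n by blast
    moreover have "F p \<subseteq> (\<Union>n. C.filt n)" for p unfolding F_def by blast
    ultimately show ?thesis unfolding C.filt_exhaust[symmetric] by blast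
  qed
  moreover have "trivial_comodule K (uea K L) (quotient_space (M\<lparr>carrier := F p\<rparr>) (F (p - 1)))
      (quotient_coaction K (uea K L) (M\<lparr>carrier := F p\<rparr>) (sub_coaction K (uea K L) M \<rho> (F p)) (F (p - 1)))" for p
  proof (rule C.trivial_quotient)
    show "submodule K (F p) M" "submodule K (F (p - 1)) M" by (simp_all add: F_def C.filt_submodule)
    show "F (p - 1) \<subseteq> F p" using step[of p] C.filt_Suc[of "nat p"] by auto
    fix m assume m: "m \<in> F p"
    then show "\<rho> m \<in> C.TS (F p)" unfolding F_def by (rule C.rho_filt)
    from step[of p] show "C.\<delta> m \<in> C.TS (F (p - 1))"
    proof
      assume F: "F p = C.filt (Suc (nat p)) \<and> F (p - 1) = C.filt (nat p)"
      show ?thesis using C.delta_filt m by (simp only: F)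
    next
      assume F: "F p = C.filt 0 \<and> F (p - 1) = C.filt 0"
      \<comment> \<open>In negative degrees \<delta> m must still lie in \<open>TS (filt 0)\<close>;
        regarding m as an element of \<open>filt (Suc 0)\<close> gives this.\<close>
      have "m \<in> C.filt (Suc 0)" using m C.filt_Suc[of 0] unfolding conjunct1[OF F] by (rule subsetD[rotated])
      then show ?thesis unfolding conjunct2[OF F] by (rule C.delta_filt)
    qed
  qed
  ultimately show ?thesis using C.filt_crossed_submodule
    by (intro exI[of _ F] conjI allI impI) (simp_all only: F_def)
qed

end
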